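(* Let $0\le\underline\sigma\le\overline\sigma$. There exists $\alpha\in(0,1)$, depending on $\underline\sigma,\overline\sigma$, such that the following holds. Let $\varphi\in C_{l.Lip}(\mathbb R)$, with $C_\varphi>0$ and $k\in\mathbb N$ such that $|\varphi(x)-\varphi(y)|\le C_\varphi(1+|x|^k+|y|^k)|x-y|$ for all $x,y\in\mathbb R$. Let $u$ be the solution of the $G$-heat equation $$u_t+G(u_{xx})=0,\qquad u|_{t=1}=\varphi,\qquad G(a)=\tfrac12(\overline\sigma^2a^+-\underline\sigma^2a^-),$$ on $[0,1]\times\mathbb R$. For each integer $n\ge1$ define $\varphi_{0,n}:=\varphi$ and $$\varphi_{i+1,n}(x):=\max_{v\in[\underline\sigma,\overline\sigma]}E\big[\varphi_{i,n}\big(N(x,v^2/n)\big)\big],\qquad i=0,1,\dots,n-1 .$$ Let $X\sim N(0,[\underline\sigma^2,\overline\sigma^2])$ be $G$-normally distributed, let $W_0:=0$ and let $\{W_i\}_{i\ge1}$ be an i.i.d. sequence with $W_i\sim\hat N(0,[\underline\sigma^2,\overline\sigma^2])$ (semi-$G$-normal). Then there are constants $K,N>0$, not depending on $n$, $p$, $x$, such that for every $p\in(0,1]$, every $x\in\mathbb R$ and every $n\ge1$ with $np\ge N$, $$\big|u(1-p,x)-\varphi_{\lfloor np\rfloor,n}(x)\big|=\Big|\hat{\mathbb E}[\varphi(x+\sqrt p\,X)]-\hat{\mathbb E}\Big[\varphi\Big(x+\sum_{i=0}^{\lfloor np\rfloor}\frac{W_i}{\sqrt n}\Big)\Big]\Big|\le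 C_\varphi(1+|x|^k)\,\frac{K}{(np)^{\alpha/2}} .$$ For $p=0$, $u(1,x)=\varphi(x)=\varphi_{0,n}(x)$.
   Context: $C_{l.Lip}(\mathbb R^d)$ is the space of functions $\varphi:\mathbb R^d\to\mathbb R$ for which there are $C_\varphi>0$ and $k\in\mathbb N$ with $|\varphi(x)-\varphi(y)|\le C_\varphi(1+|x|^k+|y|^k)|x-y|$ for all $x,y$. Also $a^+=\max\{a,0\}$, $a^-=\max\{-a,0\}$, and $\lfloor\cdot\rfloor$ is the floor function. Sublinear expectation space $(\Omega,\mathcal H,\hat{\mathbb E})$ (on which all random variables live): $\Omega$ is a set; $\mathcal H$ is a linear space of real functions on $\Omega$ containing the constants, with $|X|\in\mathcal H$ whenever $X\in\mathcal H$, and with $\varphi(X_1,\dots,X_d)\in\mathcal H$ whenever $X_1,\dots,X_d\in\mathcal H$ and $\varphi\in C_{l.Lip}(\mathbb R^d)$; $\hat{\mathbb E}:\mathcal H\to\mathbb R$ satisfies monotonicity, constant preservation, sub-additivity ($\hat{\mathbb E}[X+Y]\le\hat{\mathbb E}[X]+\hat{\mathbb E}[Y]$) and positive homogeneity ($\hat{\mathbb E}[\lambda X]=\lambda\hat{\mathbb E}[X]$ for $\lambda\ge0$). $X$ and $Y$ are identically distributed if $\hat{\mathbb E}[\varphi(X)]=\hat{\mathbb E}[\varphi(Y)]$ for all $\varphi\in C_{l.Lip}$. $Y$ is independent from $X$ (written $X\dashrightarrow Y$; the order matters) if for all $\varphi\in C_{l.Lip}$, $\hat{\mathbb E}[\varphi(X,Y)]=\hat{\mathbb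 E}\big[\hat{\mathbb E}[\varphi(x,Y)]_{x=X}\big]$. A sequence $\{X_i\}_{i\ge1}$ is i.i.d. if $X_{i+1}$ and $X_i$ are identically distributed and $(X_1,\dots,X_i)\dashrightarrow X_{i+1}$ for each $i\ge1$. $Z\sim M[\underline\sigma,\overline\sigma]$ (maximal distribution) means $\hat{\mathbb E}[\varphi(Z)]=\max_{v\in[\underline\sigma,\overline\sigma]}\varphi(v)$ for all $\varphi\in C_{l.Lip}(\mathbb R)$. $Y\sim N(0,[1,1])$ means $\hat{\mathbb E}[\varphi(Y)]=\int_{\mathbb R}\frac1{\sqrt{2\pi}}e^{-y^2/2}\varphi(y)\,dy$ for all $\varphi\in C_{l.Lip}(\mathbb R)$. Semi-$G$-normal distribution: $W\sim\hat N(0,[\underline\sigma^2,\overline\sigma^2])$ if there exist $Y\sim N(0,[1,1])$ and $Z\sim M[\underline\sigma,\overline\sigma]$ with $Z\dashrightarrow Y$ such that $W=Z\cdot Y$. $G$-normal distribution: $X\sim N(0,[\underline\sigma^2,\overline\sigma^2])$ means that for every $\varphi\in C_{l.Lip}(\mathbb R)$ the function $(t,x)\mapsto\hat{\mathbb E}[\varphi(x+\sqrt{1-t}\,X)]$ on $[0,1]\times\mathbb R$ is the (unique viscosity, of polynomial growth) solution of the $G$-heat equation $u_t+G(u_{xx})=0$, $u|_{t=1}=\varphi$, with $G(a)=\frac12\hat{\mathbb E}[aX^2]=\frac12(\overline\sigma^2a^+-\underline\sigma^2a^-)$. $E$ denotes the classical linear expectation, and $E[\psi(N(\mu,s^2))]$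 denotes the expectation of $\psi$ of a classical normal random variable with mean $\mu$ and variance $s^2$ (point mass at $\mu$ if $s=0$). *)

theory Defs
  imports "HOL-Probability.Probability"
begin

section \<open>Locally Lipschitz functions of polynomial growth\<close>

definition lLip_bound :: "real \<Rightarrow> nat \<Rightarrow> (real \<Rightarrow> real) \<Rightarrow> bool" where
  "lLip_bound C k \<phi> \<longleftrightarrow>
     C > 0 \<and> (\<forall>x y. \<bar>\<phi> x - \<phi> y\<bar> \<le> C * (1 + \<bar>x\<bar> ^ k + \<bar>y\<bar> ^ k) * \<bar>x - y\<bar>)"

definition C_lLip :: "(real \<Rightarrow> real) set" where
  "C_lLip = {\<phi>. \<exists>C k. lLip_bound C k \<phi>}"

text \<open>
  A point of d-dimensional space is represented by the coordinates with index below \<open>d\<close> of a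
  function on the naturals, with Euclidean norm \<open>L2_set x {..<d}\<close>. The inequality makes \<open>\<phi>\<close>
  independent of all other coordinates, since points that agree below \<open>d\<close> have distance 0.
\<close>

definition C_lLip_dim :: "nat \<Rightarrow> ((nat \<Rightarrow> real) \<Rightarrow> real) set" where
  "C_lLip_dim d = {\<phi>. \<exists>C > 0. \<exists>k::nat. \<forall>x y.
     \<bar>\<phi> x - \<phi> y\<bar> \<le> C * (1 + L2_set x {..<d} ^ k + L2_set y {..<d} ^ k)
                      * L2_set (\<lambda>i. x i - y i) {..<d}}"


section \<open>Sublinear expectation spaces\<close>

text \<open>
  The sample space is the type \<open>'w\<close>. Only the values of \<open>E\<close> on \<open>H\<close> are constrained.
\<close>

locale sublinear_expectation_space =
  fixes H :: "('w \<Rightarrow> real) set" and E :: "('w \<Rightarrow> real) \<Rightarrow> real"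
  assumes const_in: "(\<lambda>_. c) \<in> H"
    and add_in: "X \<in> H \<Longrightarrow> Y \<in> H \<Longrightarrow> (\<lambda>\<omega>. X \<omega> + Y \<omega>) \<in> H"
    and scale_in: "X \<in> H \<Longrightarrow> (\<lambda>\<omega>. c * X \<omega>) \<in> H"
    and abs_in: "X \<in> H \<Longrightarrow> (\<lambda>\<omega>. \<bar>X \<omega>\<bar>) \<in> H"
    and lLip_in: "0 < d \<Longrightarrow> (\<And>i. i < d \<Longrightarrow> V i \<in> H) \<Longrightarrow> \<phi> \<in> C_lLip_dim d
                    \<Longrightarrow> (\<lambda>\<omega>. \<phi> (\<lambda>i. V i \<omega>)) \<in> H"
    and mono: "X \<in> H \<Longrightarrow> Y \<in> H \<Longrightarrow> (\<And>\<omega>. X \<omega> \<le> Y \<omega>) \<Longrightarrow> E X \<le> E Y"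
    and const: "E (\<lambda>_. c) = c"
    and subadd: "X \<in> H \<Longrightarrow> Y \<in> H \<Longrightarrow> E (\<lambda>\<omega>. X \<omega> + Y \<omega>) \<le> E X + E Y"
    and pos_homogeneous: "X \<in> H \<Longrightarrow> 0 \<le> c \<Longrightarrow> E (\<lambda>\<omega>. c * X \<omega>) = c * E X"

definition identically_distributed ::
    "(('w \<Rightarrow> real) \<Rightarrow> real) \<Rightarrow> ('w \<Rightarrow> real) \<Rightarrow> ('w \<Rightarrow> real) \<Rightarrow> bool" where
  "identically_distributed E X Y \<longleftrightarrow>
     (\<forall>\<phi>\<in>C_lLip. E (\<lambda>\<omega>. \<phi> (X \<omega>)) = E (\<lambda>\<omega>. \<phi> (Y \<omega>)))"

text \<open>
  \<open>Y\<close> is independent from the vector \<open>(V 0, \<dots>, V (m - 1))\<close>; in the vector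
  \<open>(V 0, \<dots>, V (m - 1), Y)\<close> the variable \<open>Y\<close> is the coordinate with index \<open>m\<close>.
\<close>

definition independent_from ::
    "(('w \<Rightarrow> real) \<Rightarrow> real) \<Rightarrow> nat \<Rightarrow> (nat \<Rightarrow> 'w \<Rightarrow> real) \<Rightarrow> ('w \<Rightarrow> real) \<Rightarrow> bool" where
  "independent_from E m V Y \<longleftrightarrow>
     (\<forall>\<phi>\<in>C_lLip_dim (Suc m).
        E (\<lambda>\<omega>. \<phi> ((\<lambda>i. V i \<omega>)(m := Y \<omega>))) =
        E (\<lambda>\<omega>. E (\<lambda>\<omega>'. \<phi> ((\<lambda>i. V i \<omega>)(m := Y \<omega>')))))"

text \<open>The sequence starts at index 1; \<open>X 0\<close> plays no role.\<close>

definition iid_sequence ::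
    "('w \<Rightarrow> real) set \<Rightarrow> (('w \<Rightarrow> real) \<Rightarrow> real) \<Rightarrow> (nat \<Rightarrow> 'w \<Rightarrow> real) \<Rightarrow> bool" where
  "iid_sequence H E X \<longleftrightarrow>
     (\<forall>i\<ge>1. X i \<in> H \<and> identically_distributed E (X (i + 1)) (X i)
             \<and> independent_from E i (\<lambda>j. X (j + 1)) (X (i + 1)))"


section \<open>Maximal, standard normal and semi-G-normal distributions\<close>

text \<open>The maximum of \<open>f\<close> over \<open>[a, b]\<close>; it exists whenever \<open>a \<le> b\<close> and \<open>f\<close> is continuous.\<close>

definition max_over :: "real \<Rightarrow> real \<Rightarrow> (real \<Rightarrow> real) \<Rightarrow> real" where
  "max_over a b f = (GREATEST y. y \<in> f ` {a..b})"

definition maximal_distributed ::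
    "('w \<Rightarrow> real) set \<Rightarrow> (('w \<Rightarrow> real) \<Rightarrow> real) \<Rightarrow> real \<Rightarrow> real \<Rightarrow> ('w \<Rightarrow> real) \<Rightarrow> bool" where
  "maximal_distributed H E sl su Z \<longleftrightarrow>
     Z \<in> H \<and> (\<forall>\<phi>\<in>C_lLip. E (\<lambda>\<omega>. \<phi> (Z \<omega>)) = max_over sl su \<phi>)"

definition std_normal_distributed ::
    "('w \<Rightarrow> real) set \<Rightarrow> (('w \<Rightarrow> real) \<Rightarrow> real) \<Rightarrow> ('w \<Rightarrow> real) \<Rightarrow> bool" where
  "std_normal_distributed H E Y \<longleftrightarrow>
     Y \<in> H \<and>
     (\<forall>\<phi>\<in>C_lLip. E (\<lambda>\<omega>. \<phi> (Y \<omega>)) = (\<integral>y. std_normal_density y * \<phi> y \<partial>lborel))"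

definition semi_G_normal ::
    "('w \<Rightarrow> real) set \<Rightarrow> (('w \<Rightarrow> real) \<Rightarrow> real) \<Rightarrow> real \<Rightarrow> real \<Rightarrow> ('w \<Rightarrow> real) \<Rightarrow> bool" where
  "semi_G_normal H E sl su W \<longleftrightarrow>
     (\<exists>Y Z. std_normal_distributed H E Y \<and> maximal_distributed H E sl su Z
          \<and> independent_from E 1 (\<lambda>_. Z) Y \<and> W = (\<lambda>\<omega>. Z \<omega> * Y \<omega>))"


section \<open>The G-heat equation and the G-normal distribution\<close>

definition G_fun :: "real \<Rightarrow> real \<Rightarrow> real \<Rightarrow> real" where
  "G_fun sl su a = (su\<^sup>2 * max a 0 - sl\<^sup>2 * max (- a) 0) / 2"

text \<open>\<open>\<psi>\<close> is of class \<open>C^{1,2}\<close> on \<open>(0, 1) \<times> \<real>\<close> with the displayed partial derivatives.\<close>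

definition C12_strip ::
    "(real \<Rightarrow> real \<Rightarrow> real) \<Rightarrow> (real \<Rightarrow> real \<Rightarrow> real) \<Rightarrow> (real \<Rightarrow> real \<Rightarrow> real)
      \<Rightarrow> (real \<Rightarrow> real \<Rightarrow> real) \<Rightarrow> bool" where
  "C12_strip \<psi> \<psi>t \<psi>x \<psi>xx \<longleftrightarrow>
     (\<forall>t\<in>{0<..<1}. \<forall>x.
        ((\<lambda>s. \<psi> s x) has_real_derivative \<psi>t t x) (at t) \<and>
        ((\<lambda>y. \<psi> t y) has_real_derivative \<psi>x t x) (at x) \<and>
        ((\<lambda>y. \<psi>x t y) has_real_derivative \<psi>xx t x) (at x)) \<and>
     (\<forall>f\<in>{\<psi>, \<psi>t, \<psi>x, \<psi>xx}. continuous_on ({0<..<1} \<times> UNIV) (\<lambda>(t, x). f t x))"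

text \<open>
  Viscosity sub- and supersolutions of \<open>u_t + G (u_xx) = 0\<close> on \<open>(0, 1) \<times> \<real>\<close>. The equation runs
  backwards from the terminal time 1, so a subsolution satisfies \<open>u_t + G (u_xx) \<ge> 0\<close>.
\<close>

definition viscosity_subsolution :: "(real \<Rightarrow> real) \<Rightarrow> (real \<Rightarrow> real \<Rightarrow> real) \<Rightarrow> bool" where
  "viscosity_subsolution G u \<longleftrightarrow>
     (\<forall>\<psi> \<psi>t \<psi>x \<psi>xx. \<forall>t\<in>{0<..<1}. \<forall>x.
        C12_strip \<psi> \<psi>t \<psi>x \<psi>xx \<and>
        (\<forall>\<^sub>F (s, y) in nhds (t, x). u s y - \<psi> s y \<le> u t x - \<psi> t x) \<longrightarrow>
        \<psi>t t x + G (\<psi>xx t x) \<ge> 0)"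

definition viscosity_supersolution :: "(real \<Rightarrow> real) \<Rightarrow> (real \<Rightarrow> real \<Rightarrow> real) \<Rightarrow> bool" where
  "viscosity_supersolution G u \<longleftrightarrow>
     (\<forall>\<psi> \<psi>t \<psi>x \<psi>xx. \<forall>t\<in>{0<..<1}. \<forall>x.
        C12_strip \<psi> \<psi>t \<psi>x \<psi>xx \<and>
        (\<forall>\<^sub>F (s, y) in nhds (t, x). u s y - \<psi> s y \<ge> u t x - \<psi> t x) \<longrightarrow>
        \<psi>t t x + G (\<psi>xx t x) \<le> 0)"

text \<open>
  Viscosity solution of polynomial growth with terminal value \<open>\<phi>\<close>. Only the values of \<open>u\<close> on
  \<open>[0, 1] \<times> \<real>\<close> matter. Uniqueness is not part of the definition.
\<close>

definition heat_solution ::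
    "(real \<Rightarrow> real) \<Rightarrow> (real \<Rightarrow> real) \<Rightarrow> (real \<Rightarrow> real \<Rightarrow> real) \<Rightarrow> bool" where
  "heat_solution G \<phi> u \<longleftrightarrow>
     continuous_on ({0..1} \<times> UNIV) (\<lambda>(t, x). u t x) \<and>
     (\<exists>B. \<exists>m::nat. \<forall>t\<in>{0..1}. \<forall>x. \<bar>u t x\<bar> \<le> B * (1 + \<bar>x\<bar> ^ m)) \<and>
     viscosity_subsolution G u \<and> viscosity_supersolution G u \<and>
     (\<forall>x. u 1 x = \<phi> x)"

definition G_normal ::
    "('w \<Rightarrow> real) set \<Rightarrow> (('w \<Rightarrow> real) \<Rightarrow> real) \<Rightarrow> real \<Rightarrow> real \<Rightarrow> ('w \<Rightarrow> real) \<Rightarrow> bool" where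
  "G_normal H E sl su X \<longleftrightarrow>
     X \<in> H \<and>
     (\<forall>a. E (\<lambda>\<omega>. a * (X \<omega>)\<^sup>2) / 2 = G_fun sl su a) \<and>
     (\<forall>\<phi>\<in>C_lLip. heat_solution (G_fun sl su) \<phi>
                     (\<lambda>t x. E (\<lambda>\<omega>. \<phi> (x + sqrt (1 - t) * X \<omega>))))"


section \<open>The discrete scheme\<close>

text \<open>The classical normal law with mean \<open>m\<close> and variance \<open>s2\<close> (not standard deviation).\<close>

definition normal_law :: "real \<Rightarrow> real \<Rightarrow> real measure" where
  "normal_law m s2 =
     (if s2 = 0 then return borel m else density lborel (normal_density m (sqrt s2)))"

primrec scheme ::
    "real \<Rightarrow> real \<Rightarrow> (real \<Rightarrow> real) \<Rightarrow> nat \<Rightarrow> nat \<Rightarrow> real \<Rightarrow> real" where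
  "scheme sl su \<phi> n 0 = \<phi>"
| "scheme sl su \<phi> n (Suc i) =
     (\<lambda>x. max_over sl su (\<lambda>v. \<integral>y. scheme sl su \<phi> n i y \<partial>normal_law x (v\<^sup>2 / real n)))"

end

theory Submission
  imports Defs
begin

text \<open>
  The operator \<open>G\<close> is the supremum of the linear operators \<open>v\<^sup>2 / 2\<close> times the second derivative, with
  \<open>v\<close> in \<open>[sl, su]\<close>, and this lets smooth comparison functions replace the general comparison
  principle for viscosity solutions. From below, \<open>u\<close> is a supersolution of every linear equation, so it
  dominates each heat flow started from its own values, and hence every value of the scheme at the grid
  times, without error. From above, the Gaussian mollification with variance \<open>\<epsilon>\<^sup>2\<close> of the scheme
  dominates each mollified heat step; interpolated linearly in time it is a smooth supersolution up to an
  error of order \<open>n\<^sup>-\<^sup>1\<^sup>/\<^sup>2 \<epsilon>\<^sup>-\<^sup>2\<close>, and mollifying costs an error of order \<open>\<epsilon>\<close>. The choice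
  \<open>\<epsilon> = n\<^sup>-\<^sup>1\<^sup>/\<^sup>6\<close> gives \<open>\<alpha> = 1/3\<close>.

  Letting \<open>n\<close> tend to infinity in the estimate shows that the solution is unique, which identifies \<open>u\<close>
  with the expectation over the \<open>G\<close>-normal variable.
\<close>

section \<open>Weights and functions of polynomial growth\<close>

text \<open>Two obstacles shape the estimates. The data grow polynomially, so errors are measured in
  the weight \<open>wt k\<close>, which is comparable with \<open>1 + \<bar>x\<bar> ^ k\<close> but
  smooth, hence usable in test functions. A normal step of variance \<open>s\<^sup>2\<close>
  multiplies its value by at most \<open>exp (c * s\<^sup>2)\<close>, because the first-order term
  averages out; the local Lipschitz constants therefore stay bounded over all n steps. The scheme
  itself is only locally Lipschitz and cannot be a test function. Mollification commutes with heat
  steps and preserves order, so it keeps the inequality between the maximal step and each heat step.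
  A second derivative then costs a factor \<epsilon>^(-2) against an increment of order n^(-1/2),
  and a barrier growing backwards in time absorbs the errors of all steps, so that they do not add
  up. Balancing n^(-1/2) \<epsilon>^(-2) with \<epsilon> makes both equal to n^(-1/6), that is
  n^(-\<alpha>/2).\<close>

definition wt :: "nat \<Rightarrow> real \<Rightarrow> real" where
  "wt k x = sqrt (1 + x\<^sup>2) ^ k"

lemma wt_ge_1: "1 \<le> wt k x"
  unfolding wt_def by (intro one_le_power) simp

lemma wt_pos: "0 < wt k x"
  using wt_ge_1[of k x] by linarith

lemma wt_nonneg [simp]: "0 \<le> wt k x"
  using wt_pos[of k x] by linarith

lemma abs_wt [simp]: "\<bar>wt k x\<bar> = wt k x"
  by simp

lemma continuous_on_wt [continuous_intros]:
  "continuous_on S f \<Longrightarrow> continuous_on S (\<lambda>x. wt k (f x))"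
  unfolding wt_def by (intro continuous_intros)

lemma wt_add: "wt (j + k) x = wt j x * wt k x"
  by (simp add: wt_def power_add)

lemma wt_2: "wt 2 x = 1 + x\<^sup>2"
  by (simp add: wt_def)

lemma abs_le_wt_1: "\<bar>x\<bar> \<le> wt 1 x"
  unfolding wt_def by (simp add: real_le_rsqrt)

lemma wt_mono: "j \<le> k \<Longrightarrow> wt j x \<le> wt k x"
  unfolding wt_def by (intro power_increasing) auto

lemma wt_abs_mono: "\<bar>x\<bar> \<le> \<bar>y\<bar> \<Longrightarrow> wt k x \<le> wt k y"
  unfolding wt_def by (intro power_mono) (auto simp: abs_le_square_iff)

lemma wt_le_pow: "wt k x \<le> (1 + \<bar>x\<bar>) ^ k"
  unfolding wt_def
proof (intro power_mono)
  have "1 + x\<^sup>2 \<le> (1 + \<bar>x\<bar>)\<^sup>2" by (simp add: power2_sum)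
  thus "sqrt (1 + x\<^sup>2) \<le> 1 + \<bar>x\<bar>"
    by (intro real_le_lsqrt) auto
qed simp

lemma one_plus_pow_le:
  fixes a :: real assumes "0 \<le> a" shows "(1 + a) ^ k \<le> 2 ^ k * (1 + a ^ k)"
proof -
  have "(1 + a) ^ k \<le> (2 * max 1 a) ^ k" using assms by (intro power_mono) auto
  also have "\<dots> = 2 ^ k * max 1 a ^ k" by (simp add: power_mult_distrib)
  also have "max 1 a ^ k \<le> 1 + a ^ k" using assms by (auto simp: max_def)
  finally show ?thesis by (simp add: mult_left_mono)
qed

lemma wt_le_1_plus_pow: "wt k x \<le> 2 ^ k * (1 + \<bar>x\<bar> ^ k)"
  using wt_le_pow[of k x] one_plus_pow_le[of "\<bar>x\<bar>" k] by simp

lemma pow_le_wt: "\<bar>x\<bar> ^ k \<le> wt k x"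
  unfolding wt_def by (intro power_mono) (auto simp: real_le_rsqrt)

lemma wt_add_le: "wt k (x + y) \<le> 2 ^ k * (wt k x * wt k y)"
proof -
  have "1 + (x + y)\<^sup>2 \<le> 2\<^sup>2 * ((1 + x\<^sup>2) * (1 + y\<^sup>2))"
  proof -
    have "2\<^sup>2 * ((1 + x\<^sup>2) * (1 + y\<^sup>2)) - (1 + (x + y)\<^sup>2)
        = 3 + 2 * x\<^sup>2 + 2 * y\<^sup>2 + 4 * (x * y)\<^sup>2 + (x - y)\<^sup>2"
      by (simp add: power2_eq_square algebra_simps)
    also have "\<dots> \<ge> 0" by simp
    finally show ?thesis by linarith
  qed
  hence "sqrt (1 + (x + y)\<^sup>2) \<le> sqrt (2\<^sup>2 * ((1 + x\<^sup>2) * (1 + y\<^sup>2)))" by (rule real_sqrt_le_mono)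
  also have "\<dots> = 2 * (sqrt (1 + x\<^sup>2) * sqrt (1 + y\<^sup>2))" by (simp add: real_sqrt_mult)
  finally show ?thesis
    unfolding wt_def power_mult_distrib[symmetric] by (intro power_mono) auto
qed

lemma wt_mult_le: "wt k (x * y) \<le> wt k x * wt k y"
proof -
  have "1 + (x * y)\<^sup>2 \<le> (1 + x\<^sup>2) * (1 + y\<^sup>2)" by (simp add: algebra_simps power_mult_distrib)
  hence "sqrt (1 + (x * y)\<^sup>2) \<le> sqrt (1 + x\<^sup>2) * sqrt (1 + y\<^sup>2)"
    by (metis real_sqrt_le_mono real_sqrt_mult)
  thus ?thesis
    unfolding wt_def power_mult_distrib[symmetric] by (intro power_mono) auto
qed

section \<open>Derivatives and increments of the weight\<close>

definition wt' :: "nat \<Rightarrow> real \<Rightarrow> real" where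
  "wt' k x = k * x * wt k x / (1 + x\<^sup>2)"

definition wt'' :: "nat \<Rightarrow> real \<Rightarrow> real" where
  "wt'' k x = k * wt k x / (1 + x\<^sup>2) + (real k * real k - 2 * k) * x\<^sup>2 * wt k x / (1 + x\<^sup>2)\<^sup>2"

lemma one_plus_sq_pos: "0 < 1 + (x::real)\<^sup>2"
  by (simp add: add_pos_nonneg)

lemma wt_has_derivative: "(wt k has_real_derivative wt' k x) (at x)"
proof -
  have r: "0 < sqrt (1 + x\<^sup>2)" using one_plus_sq_pos by simp
  have "((\<lambda>x. sqrt (1 + x\<^sup>2) ^ k) has_real_derivative
      k * (x / sqrt (1 + x\<^sup>2)) * sqrt (1 + x\<^sup>2) ^ (k - 1)) (at x)"
    using one_plus_sq_pos[of x]
    by (auto intro!: derivative_eq_intros simp: divide_simps)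
  moreover have "k * (x / sqrt (1 + x\<^sup>2)) * sqrt (1 + x\<^sup>2) ^ (k - 1) = wt' k x"
  proof (cases k)
    case (Suc m)
    have "sqrt (1 + x\<^sup>2) * sqrt (1 + x\<^sup>2) = 1 + x\<^sup>2" by simp
    thus ?thesis using r one_plus_sq_pos[of x] unfolding wt'_def wt_def Suc
      by (simp add: divide_simps)
  qed (simp add: wt'_def)
  ultimately show ?thesis unfolding wt_def by simp
qed

lemma wt'_has_derivative: "(wt' k has_real_derivative wt'' k x) (at x)"
proof -
  have "((\<lambda>x. k * x * wt k x / (1 + x\<^sup>2)) has_real_derivative
     ((k * wt k x + k * x * wt' k x) * (1 + x\<^sup>2) - k * x * wt k x * (2 * x)) / (1 + x\<^sup>2)\<^sup>2) (at x)"
    using one_plus_sq_pos[of x] 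
    by (auto intro!: derivative_eq_intros wt_has_derivative simp: power2_eq_square)
  moreover have "((k * wt k x + k * x * wt' k x) * (1 + x\<^sup>2) - k * x * wt k x * (2 * x)) / (1 + x\<^sup>2)\<^sup>2
     = wt'' k x"
  proof -
    have d: "1 + x\<^sup>2 \<noteq> 0" using one_plus_sq_pos[of x] by simp
    have e: "wt' k x * (1 + x\<^sup>2) = k * x * wt k x" using d by (simp add: wt'_def)
    have "(k * wt k x + k * x * wt' k x) * (1 + x\<^sup>2) - k * x * wt k x * (2 * x)
      = k * wt k x * (1 + x\<^sup>2) + k * x * (wt' k x * (1 + x\<^sup>2)) - k * x * wt k x * (2 * x)"
      by (simp add: algebra_simps)
    also have "\<dots> = k * wt k x * (1 + x\<^sup>2) + (real k * real k - 2 * k) * x\<^sup>2 * wt k x"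
      unfolding e by (simp add: algebra_simps power2_eq_square)
    finally show ?thesis using d unfolding wt''_def
      by (simp add: add_divide_distrib power2_eq_square)
  qed
  ultimately show ?thesis unfolding wt'_def by simp
qed

lemma abs_wt''_le: "\<bar>wt'' k x\<bar> \<le> (real k + 1)\<^sup>2 * 2 * wt k x"
proof -
  have a: "0 \<le> 1 / (1 + x\<^sup>2)" "1 / (1 + x\<^sup>2) \<le> 1" using one_plus_sq_pos[of x] by auto
  have b: "0 \<le> x\<^sup>2 / (1 + x\<^sup>2)\<^sup>2" "x\<^sup>2 / (1 + x\<^sup>2)\<^sup>2 \<le> 1"
  proof -
    show "0 \<le> x\<^sup>2 / (1 + x\<^sup>2)\<^sup>2" by simp
    have "x\<^sup>2 \<le> (1 + x\<^sup>2)\<^sup>2" using zero_le_power2[of "x\<^sup>2"] zero_le_power2[of x] unfolding power2_sum by simp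
    thus "x\<^sup>2 / (1 + x\<^sup>2)\<^sup>2 \<le> 1" using one_plus_sq_pos[of x] by simp
  qed
  have "\<bar>wt'' k x\<bar> = \<bar>k * (1 / (1 + x\<^sup>2)) + (real k * real k - 2 * k) * (x\<^sup>2 / (1 + x\<^sup>2)\<^sup>2)\<bar> * wt k x"
  proof -
    have "wt'' k x = (k * (1 / (1 + x\<^sup>2)) + (real k * real k - 2 * k) * (x\<^sup>2 / (1 + x\<^sup>2)\<^sup>2)) * wt k x"
      unfolding wt''_def by (simp add: distrib_right)
    thus ?thesis by (simp add: abs_mult)
  qed
  also have "\<dots> \<le> (k * 1 + (real k * real k + 2 * k) * 1) * wt k x"
  proof (intro mult_right_mono order_trans[OF abs_triangle_ineq] add_mono)
    show "\<bar>real k * (1 / (1 + x\<^sup>2))\<bar> \<le> k * 1" 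
      using mult_left_mono[OF a(2), of "real k"] a(1) by (simp add: abs_mult)
    show "\<bar>(real k * real k - 2 * k) * (x\<^sup>2 / (1 + x\<^sup>2)\<^sup>2)\<bar> \<le> (real k * real k + 2 * k) * 1"
      unfolding abs_mult using b by (intro mult_mono) (auto simp: abs_le_iff)
  qed auto
  also have "\<dots> \<le> (real k + 1)\<^sup>2 * 2 * wt k x"
    by (intro mult_right_mono) (auto simp: power2_eq_square algebra_simps)
  finally show ?thesis .
qed

lemma continuous_on_wt'' [continuous_intros]:
  "continuous_on S f \<Longrightarrow> continuous_on S (\<lambda>x. wt'' k (f x))"
  unfolding wt''_def using one_plus_sq_pos by (intro continuous_intros) (auto simp: less_imp_neq[symmetric])

lemma continuous_on_wt' [continuous_intros]:
  "continuous_on S f \<Longrightarrow> continuous_on S (\<lambda>x. wt' k (f x))"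
  unfolding wt'_def using one_plus_sq_pos by (intro continuous_intros) (auto simp: less_imp_neq[symmetric])

text \<open>By induction on the exponent: the second-order remainders satisfy
  \<open>R (Suc k) = (1 + r) * R k + k * r\<^sup>2\<close>.\<close>

lemma abs_one_plus_pow_remainder:
  fixes r :: real
  shows "\<bar>(1 + r) ^ k - 1 - k * r\<bar> \<le> 2 ^ k * r\<^sup>2 * (1 + \<bar>r\<bar>) ^ k"
proof (induction k)
  case (Suc k)
  have kk: "real k \<le> 2 ^ k" by (metis less_imp_le of_nat_le_iff of_nat_numeral of_nat_power less_exp)
  have "(1 + r) ^ Suc k - 1 - Suc k * r = (1 + r) * ((1 + r) ^ k - 1 - k * r) + k * r\<^sup>2"
    by (simp add: algebra_simps power2_eq_square)
  also have "\<bar>\<dots>\<bar> \<le> (1 + \<bar>r\<bar>) * (2 ^ k * r\<^sup>2 * (1 + \<bar>r\<bar>) ^ k) + 2 ^ k * r\<^sup>2 * (1 + \<bar>r\<bar>) ^ Suc k"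
  proof (intro order_trans[OF abs_triangle_ineq] add_mono)
    show "\<bar>(1 + r) * ((1 + r) ^ k - 1 - k * r)\<bar> \<le> (1 + \<bar>r\<bar>) * (2 ^ k * r\<^sup>2 * (1 + \<bar>r\<bar>) ^ k)"
      unfolding abs_mult using Suc.IH by (intro mult_mono) auto
    have "k * r\<^sup>2 * 1 \<le> 2 ^ k * r\<^sup>2 * (1 + \<bar>r\<bar>) ^ Suc k"
      using kk by (intro mult_mono one_le_power) auto
    thus "\<bar>k * r\<^sup>2\<bar> \<le> 2 ^ k * r\<^sup>2 * (1 + \<bar>r\<bar>) ^ Suc k" by simp
  qed
  also have "\<dots> = 2 ^ Suc k * r\<^sup>2 * (1 + \<bar>r\<bar>) ^ Suc k" by simp
  finally show ?case .
qed simp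

text \<open>The first-order term in \<open>y\<close> is explicit, so that it vanishes when \<open>y\<close> is a centred normal.\<close>

lemma wt_add_expansion:
  "wt k (x + y) \<le> wt k x * (1 + (k * x / (1 + x\<^sup>2)) * y
      + y\<^sup>2 * (k + 2 ^ k * (1 + \<bar>y\<bar>)\<^sup>2 * (1 + \<bar>y\<bar> + y\<^sup>2) ^ k))"
proof -
  \<comment> \<open>The relative increment of \<open>1 + x\<^sup>2\<close>; because it is relative,
    it can be bounded in terms of \<open>y\<close> alone.\<close>
  define r where "r = (2 * x * y + y\<^sup>2) / (1 + x\<^sup>2)"
  note pos = one_plus_sq_pos[of x]
  have e: "1 + (x + y)\<^sup>2 = (1 + x\<^sup>2) * (1 + r)"
  proof -
    have "(1 + x\<^sup>2) * r = 2 * x * y + y\<^sup>2" using pos unfolding r_def by simp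
    thus ?thesis by (simp add: power2_sum ring_distribs)
  qed
  have r1: "0 \<le> 1 + r" using e pos one_plus_sq_pos[of "x + y"] by (simp add: zero_less_mult_iff)
  have x2: "2 * \<bar>x\<bar> \<le> 1 + x\<^sup>2"
    using zero_le_power2[of "\<bar>x\<bar> - 1"] by (simp add: power2_diff)
  have "\<bar>2 * x * y + y\<^sup>2\<bar> \<le> (1 + x\<^sup>2) * \<bar>y\<bar> + (1 + x\<^sup>2) * y\<^sup>2"
  proof (intro order_trans[OF abs_triangle_ineq] add_mono)
    show "\<bar>2 * x * y\<bar> \<le> (1 + x\<^sup>2) * \<bar>y\<bar>"
      unfolding abs_mult using x2 by (intro mult_right_mono) auto
    show "\<bar>y\<^sup>2\<bar> \<le> (1 + x\<^sup>2) * y\<^sup>2" by (simp add: algebra_simps)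
  qed
  hence ra: "\<bar>r\<bar> \<le> \<bar>y\<bar> + y\<^sup>2"
    unfolding r_def abs_divide using pos by (simp add: field_simps)
  have r2: "r\<^sup>2 \<le> y\<^sup>2 * (1 + \<bar>y\<bar>)\<^sup>2"
  proof -
    have "\<bar>r\<bar>\<^sup>2 \<le> (\<bar>y\<bar> * (1 + \<bar>y\<bar>))\<^sup>2"
      using ra by (intro power_mono) (auto simp: algebra_simps power2_eq_square)
    thus ?thesis by (simp add: power_mult_distrib)
  qed
  have "wt k (x + y) = wt k x * sqrt ((1 + r) ^ k)"
    unfolding wt_def e by (simp add: real_sqrt_mult power_mult_distrib real_sqrt_power)
  \<comment> \<open>The inequality of the arithmetic and geometric mean removes the square root and
    keeps the correct first-order term \<open>k * r / 2\<close>.\<close>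
  also have "sqrt ((1 + r) ^ k) \<le> (1 + (1 + r) ^ k) / 2"
    using arith_geo_mean_sqrt[of 1 "(1 + r) ^ k"] r1 by simp
  also have "(1 + r) ^ k \<le> 1 + k * r + 2 ^ k * r\<^sup>2 * (1 + \<bar>r\<bar>) ^ k"
    using abs_one_plus_pow_remainder[of r k] by linarith
  also have "k * r \<le> 2 * (k * x / (1 + x\<^sup>2)) * y + k * y\<^sup>2"
  proof -
    have "y\<^sup>2 / (1 + x\<^sup>2) \<le> y\<^sup>2 / 1" using pos by (intro divide_left_mono) auto
    hence "k * (y\<^sup>2 / (1 + x\<^sup>2)) \<le> k * y\<^sup>2" by (intro mult_left_mono) auto
    thus ?thesis by (simp add: r_def add_divide_distrib algebra_simps)
  qed
  also have "2 ^ k * r\<^sup>2 * (1 + \<bar>r\<bar>) ^ k \<le> 2 ^ k * (y\<^sup>2 * (1 + \<bar>y\<bar>)\<^sup>2) * (1 + \<bar>y\<bar> + y\<^sup>2) ^ k"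
    using ra r2 by (intro mult_mono power_mono) auto
  finally have "wt k (x + y) \<le> wt k x * ((1 + (1 + (2 * (k * x / (1 + x\<^sup>2)) * y + k * y\<^sup>2)
       + 2 ^ k * (y\<^sup>2 * (1 + \<bar>y\<bar>)\<^sup>2) * (1 + \<bar>y\<bar> + y\<^sup>2) ^ k)) / 2)"
    by (simp add: mult_left_mono)
  also have "\<dots> \<le> wt k x * (1 + (k * x / (1 + x\<^sup>2)) * y
      + y\<^sup>2 * (k + 2 ^ k * (1 + \<bar>y\<bar>)\<^sup>2 * (1 + \<bar>y\<bar> + y\<^sup>2) ^ k))"
  proof (intro mult_left_mono)
    have "0 \<le> 2 ^ k * (y\<^sup>2 * (1 + \<bar>y\<bar>)\<^sup>2) * (1 + \<bar>y\<bar> + y\<^sup>2) ^ k" "0 \<le> k * y\<^sup>2" by auto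
    thus "(1 + (1 + (2 * (k * x / (1 + x\<^sup>2)) * y + k * y\<^sup>2)
       + 2 ^ k * (y\<^sup>2 * (1 + \<bar>y\<bar>)\<^sup>2) * (1 + \<bar>y\<bar> + y\<^sup>2) ^ k)) / 2 \<le> 1 + (k * x / (1 + x\<^sup>2)) * y
      + y\<^sup>2 * (k + 2 ^ k * (1 + \<bar>y\<bar>)\<^sup>2 * (1 + \<bar>y\<bar> + y\<^sup>2) ^ k)"
      by (simp add: algebra_simps)
  qed auto
  finally show ?thesis .
qed

section \<open>Measurable functions of polynomial growth\<close>

definition poly_growth :: "(real \<Rightarrow> real) \<Rightarrow> bool" where
  "poly_growth g \<longleftrightarrow> g \<in> borel_measurable borel \<and> (\<exists>A m. \<forall>z. \<bar>g z\<bar> \<le> A * (1 + \<bar>z\<bar>) ^ m)"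

named_theorems poly_growth_intros

lemma poly_growthI:
  "g \<in> borel_measurable borel \<Longrightarrow> (\<And>z. \<bar>g z\<bar> \<le> A * (1 + \<bar>z\<bar>) ^ m) \<Longrightarrow> poly_growth g"
  unfolding poly_growth_def by blast

lemma poly_growthE:
  assumes "poly_growth g"
  obtains A m where "g \<in> borel_measurable borel" "0 \<le> A" "\<And>z. \<bar>g z\<bar> \<le> A * (1 + \<bar>z\<bar>) ^ m"
proof -
  from assms obtain A m where *: "g \<in> borel_measurable borel" "\<And>z. \<bar>g z\<bar> \<le> A * (1 + \<bar>z\<bar>) ^ m"
    unfolding poly_growth_def by blast
  have "0 \<le> A" using *(2)[of 0] by simp
  with * that show ?thesis by blast
qed

lemma poly_growth_measurable: "poly_growth g \<Longrightarrow> g \<in> borel_measurable borel"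
  unfolding poly_growth_def by blast

lemma poly_growth_bound:
  assumes "poly_growth g" "f \<in> borel_measurable borel" "\<And>z. \<bar>f z\<bar> \<le> g z"
  shows "poly_growth f"
proof -
  obtain A m where "\<And>z. \<bar>g z\<bar> \<le> A * (1 + \<bar>z\<bar>) ^ m" using poly_growthE[OF assms(1)] by blast
  thus ?thesis using assms(3)
    by (intro poly_growthI[OF assms(2), of A m]) (metis abs_le_D1 order_trans)
qed

lemma poly_growth_const [poly_growth_intros]: "poly_growth (\<lambda>_. c)"
  by (rule poly_growthI[of _ "\<bar>c\<bar>" 0]) auto

lemma poly_growth_id [poly_growth_intros]: "poly_growth (\<lambda>z. z)"
  by (rule poly_growthI[of _ 1 1]) auto

lemma poly_growth_abs [poly_growth_intros]: "poly_growth f \<Longrightarrow> poly_growth (\<lambda>z. \<bar>f z\<bar>)"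
  unfolding poly_growth_def by (auto intro: borel_measurable_abs)

lemma poly_growth_mult [poly_growth_intros]:
  assumes "poly_growth f" "poly_growth g" shows "poly_growth (\<lambda>z. f z * g z)"
proof -
  obtain A m where f: "f \<in> borel_measurable borel" "0 \<le> A" "\<And>z. \<bar>f z\<bar> \<le> A * (1 + \<bar>z\<bar>) ^ m"
    using poly_growthE[OF assms(1)] by blast
  obtain B l where g: "g \<in> borel_measurable borel" "0 \<le> B" "\<And>z. \<bar>g z\<bar> \<le> B * (1 + \<bar>z\<bar>) ^ l"
    using poly_growthE[OF assms(2)] by blast
  show ?thesis
  proof (rule poly_growthI)
    show "(\<lambda>z. f z * g z) \<in> borel_measurable borel" using f g by simp
    fix z
    have "\<bar>f z * g z\<bar> \<le> (A * (1 + \<bar>z\<bar>) ^ m) * (B * (1 + \<bar>z\<bar>) ^ l)"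
      unfolding abs_mult using f g by (intro mult_mono) auto
    thus "\<bar>f z * g z\<bar> \<le> (A * B) * (1 + \<bar>z\<bar>) ^ (m + l)" by (simp add: power_add mult_ac)
  qed
qed

lemma poly_growth_add [poly_growth_intros]:
  assumes "poly_growth f" "poly_growth g" shows "poly_growth (\<lambda>z. f z + g z)"
proof -
  obtain A m where f: "f \<in> borel_measurable borel" "0 \<le> A" "\<And>z. \<bar>f z\<bar> \<le> A * (1 + \<bar>z\<bar>) ^ m"
    using poly_growthE[OF assms(1)] by blast
  obtain B l where g: "g \<in> borel_measurable borel" "0 \<le> B" "\<And>z. \<bar>g z\<bar> \<le> B * (1 + \<bar>z\<bar>) ^ l"
    using poly_growthE[OF assms(2)] by blast
  show ?thesis
  proof (rule poly_growthI)
    show "(\<lambda>z. f z + g z) \<in> borel_measurable borel" using f g by simp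
    fix z
    have "A * (1 + \<bar>z\<bar>) ^ m \<le> A * (1 + \<bar>z\<bar>) ^ (m + l)" 
      using f by (intro mult_left_mono power_increasing) auto
    moreover have "B * (1 + \<bar>z\<bar>) ^ l \<le> B * (1 + \<bar>z\<bar>) ^ (m + l)" 
      using g by (intro mult_left_mono power_increasing) auto
    ultimately show "\<bar>f z + g z\<bar> \<le> (A + B) * (1 + \<bar>z\<bar>) ^ (m + l)" 
      using f(3)[of z] g(3)[of z] unfolding distrib_right by linarith
  qed
qed

lemma poly_growth_minus [poly_growth_intros]: "poly_growth f \<Longrightarrow> poly_growth (\<lambda>z. - f z)"
  using poly_growth_mult[OF poly_growth_const[of "-1"]] by simp

lemma poly_growth_diff [poly_growth_intros]:
  "poly_growth f \<Longrightarrow> poly_growth g \<Longrightarrow> poly_growth (\<lambda>z. f z - g z)"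
  using poly_growth_add[OF _ poly_growth_minus] by simp

lemma poly_growth_power [poly_growth_intros]: "poly_growth f \<Longrightarrow> poly_growth (\<lambda>z. f z ^ k)"
  by (induction k) (simp_all add: poly_growth_const poly_growth_mult)

lemma poly_growth_compose:
  assumes "poly_growth f" "poly_growth g" shows "poly_growth (\<lambda>z. f (g z))"
proof -
  obtain A m where f: "f \<in> borel_measurable borel" "0 \<le> A" "\<And>z. \<bar>f z\<bar> \<le> A * (1 + \<bar>z\<bar>) ^ m"
    using poly_growthE[OF assms(1)] by blast
  have "poly_growth (\<lambda>z. A * (1 + \<bar>g z\<bar>) ^ m)" by (intro poly_growth_intros assms)
  thus ?thesis
    using f poly_growth_measurable[OF assms(2)] by (rule_tac poly_growth_bound) auto
qed

lemma poly_growth_wt: "poly_growth (wt k)"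
  using wt_le_pow[of k]
  by (intro poly_growthI[of _ 1 k] borel_measurable_continuous_onI) (auto intro!: continuous_intros)

lemma poly_growth_wt_compose [poly_growth_intros]: "poly_growth f \<Longrightarrow> poly_growth (\<lambda>z. wt k (f z))"
  by (rule poly_growth_compose[OF poly_growth_wt])

section \<open>Gaussian averages\<close>

definition gauss :: "real measure" where
  "gauss = density lborel std_normal_density"

lemma prob_space_gauss: "prob_space gauss"
  unfolding gauss_def by (rule prob_space_normal_density) simp

interpretation gauss: prob_space gauss
  by (rule prob_space_gauss)

lemma sets_gauss [simp, measurable_cong]: "sets gauss = sets borel"
  by (simp add: gauss_def)

lemma space_gauss [simp]: "space gauss = UNIV"
  by (simp add: gauss_def)

lemma integral_gauss:
  assumes "g \<in> borel_measurable borel"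
  shows "(\<integral>z. g z \<partial>gauss) = (\<integral>z. std_normal_density z * g z \<partial>lborel)"
  using assms unfolding gauss_def by (subst integral_real_density) (auto simp: normal_density_nonneg)

lemma integrable_gauss_pow: "integrable gauss (\<lambda>z. \<bar>z\<bar> ^ k)"
  unfolding gauss_def using integrable_std_normal_moment_abs[of k]
  by (subst integrable_real_density) (auto simp: normal_density_nonneg)

lemma integrable_poly_growth:
  assumes "poly_growth g" shows "integrable gauss g"
proof -
  obtain A m where f: "g \<in> borel_measurable borel" "0 \<le> A" "\<And>z. \<bar>g z\<bar> \<le> A * (1 + \<bar>z\<bar>) ^ m"
    using poly_growthE[OF assms(1)] by blast
  have "integrable gauss (\<lambda>z. A * (2 ^ m * (1 + \<bar>z\<bar> ^ m)))"
    by (intro integrable_mult_right Bochner_Integration.integrable_add integrable_gauss_pow) auto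
  thus ?thesis
  proof (rule Bochner_Integration.integrable_bound)
    show "g \<in> borel_measurable gauss" using f by simp
    have "\<bar>g z\<bar> \<le> A * (2 ^ m * (1 + \<bar>z\<bar> ^ m))" for z
      using f(3)[of z] mult_left_mono[OF one_plus_pow_le[of "\<bar>z\<bar>" m] f(2)] by simp
    thus "AE z in gauss. norm (g z) \<le> norm (A * (2 ^ m * (1 + \<bar>z\<bar> ^ m)))"
      by (intro AE_I2) (metis abs_ge_self order_trans real_norm_def)
  qed
qed

lemma integral_gauss_id: "(\<integral>z. z \<partial>gauss) = 0"
  using integral_std_normal_moment_odd[of 0] by (simp add: integral_gauss)

lemma integral_gauss_mono:
  assumes "poly_growth f" "poly_growth g" "\<And>z. f z \<le> g z"
  shows "(\<integral>z. f z \<partial>gauss) \<le> (\<integral>z. g z \<partial>gauss)"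
  using assms by (intro integral_mono integrable_poly_growth) auto

lemma abs_integral_gauss_le:
  assumes "poly_growth f" "poly_growth g" "\<And>z. \<bar>f z\<bar> \<le> g z"
  shows "\<bar>\<integral>z. f z \<partial>gauss\<bar> \<le> (\<integral>z. g z \<partial>gauss)"
proof -
  have "\<bar>\<integral>z. f z \<partial>gauss\<bar> \<le> (\<integral>z. \<bar>f z\<bar> \<partial>gauss)"
    by (rule integral_abs_bound)
  also have "\<dots> \<le> (\<integral>z. g z \<partial>gauss)"
    by (intro integral_gauss_mono poly_growth_intros assms)
  finally show ?thesis .
qed

definition wt_moment :: "nat \<Rightarrow> real" where
  "wt_moment k = (\<integral>z. wt k z \<partial>gauss)"

lemma wt_moment_nonneg: "0 \<le> wt_moment k"
  unfolding wt_moment_def by (simp add: integral_nonneg_AE)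

text \<open>The linear term of \<open>wt_add_expansion\<close> has mean zero, so the weight grows by
  a factor \<open>1 + c * s\<^sup>2\<close>, hence at most \<open>exp (c * s\<^sup>2)\<close>. The
  order two in \<open>s\<close> is essential: n steps with \<open>s\<close> of order n^(-1/2) then
  contribute a bounded factor in total.\<close>

lemma wt_average_le:
  assumes "0 \<le> S"
  obtains c where "0 \<le> c" "\<And>s x. 0 \<le> s \<Longrightarrow> s \<le> S \<Longrightarrow>
    (\<integral>z. wt k (x + s * z) \<partial>gauss) \<le> exp (c * s\<^sup>2) * wt k x"
proof -
  \<comment> \<open>The remainder of \<open>wt_add_expansion\<close> with \<open>s\<close> replaced
    by its upper bound \<open>S\<close> inside the powers, so that its mean does not depend on
    \<open>s\<close>.\<close>
  define R where "R = (\<lambda>z::real. z\<^sup>2 * (k + 2 ^ k * (1 + S * \<bar>z\<bar>)\<^sup>2 * (1 + S * \<bar>z\<bar> + (S * z)\<^sup>2) ^ k))"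
  define c where "c = (\<integral>z. R z \<partial>gauss)"
  have R: "poly_growth R" unfolding R_def by (intro poly_growth_intros)
  have "0 \<le> c" unfolding c_def R_def using assms by (intro integral_nonneg_AE AE_I2) auto
  moreover have "(\<integral>z. wt k (x + s * z) \<partial>gauss) \<le> exp (c * s\<^sup>2) * wt k x" if s: "0 \<le> s" "s \<le> S" for s x
  proof -
    let ?a = "(k * x / (1 + x\<^sup>2)) * s"
    have "(\<integral>z. wt k (x + s * z) \<partial>gauss) \<le> (\<integral>z. wt k x * (1 + ?a * z + s\<^sup>2 * R z) \<partial>gauss)"
    proof (rule integral_gauss_mono)
      fix z
      have sz: "s * \<bar>z\<bar> \<le> S * \<bar>z\<bar>" "(s * z)\<^sup>2 \<le> (S * z)\<^sup>2"
        using s by (auto simp: power_mult_distrib intro!: mult_right_mono)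
      have "wt k (x + s * z) \<le> wt k x * (1 + (k * x / (1 + x\<^sup>2)) * (s * z)
         + (s * z)\<^sup>2 * (k + 2 ^ k * (1 + \<bar>s * z\<bar>)\<^sup>2 * (1 + \<bar>s * z\<bar> + (s * z)\<^sup>2) ^ k))"
        by (rule wt_add_expansion)
      also have "\<dots> \<le> wt k x * (1 + (k * x / (1 + x\<^sup>2)) * (s * z)
         + (s * z)\<^sup>2 * (k + 2 ^ k * (1 + S * \<bar>z\<bar>)\<^sup>2 * (1 + S * \<bar>z\<bar> + (S * z)\<^sup>2) ^ k))"
        using s sz by (intro mult_left_mono add_left_mono mult_mono power_mono)
          (auto simp: abs_mult)
      finally show "wt k (x + s * z) \<le> wt k x * (1 + ?a * z + s\<^sup>2 * R z)"
        by (simp add: R_def power_mult_distrib mult_ac)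
    qed (intro poly_growth_intros R)+
    also have "\<dots> = wt k x * (1 + s\<^sup>2 * c)"
      using integrable_poly_growth[OF R] integrable_poly_growth[OF poly_growth_id]
        by (simp add: integral_gauss_id c_def gauss.prob_space[simplified])
    also have "\<dots> \<le> wt k x * exp (c * s\<^sup>2)"
      by (intro mult_left_mono) (auto simp: mult.commute)
    finally show ?thesis by (simp add: mult.commute)
  qed
  ultimately show ?thesis using that by blast
qed

text \<open>The mean of \<open>f\<close> under the normal law with mean \<open>x\<close> and
  standard deviation \<open>s\<close>. Keeping the measure fixed and moving the parameters into the
  argument includes the point mass \<open>s = 0\<close> and reduces regularity in \<open>s\<close>
  and \<open>x\<close> to that of \<open>f\<close>.\<close>

definition gavg :: "real \<Rightarrow> (real \<Rightarrow> real) \<Rightarrow> real \<Rightarrow> real" where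
  "gavg s f x = (\<integral>z. f (x + s * z) \<partial>gauss)"

text \<open>Up to constants depending on \<open>k\<close> this is the class of
  \<open>lLip_bound\<close>. The smooth weight matters under averaging: for \<open>k = 1\<close>,
  the average of \<open>1 + \<bar>x\<bar>\<close> at the origin already grows to first order in
  \<open>s\<close>, which would be too much over n steps.\<close>

definition wlip :: "real \<Rightarrow> nat \<Rightarrow> (real \<Rightarrow> real) \<Rightarrow> bool" where
  "wlip C k f \<longleftrightarrow> 0 \<le> C \<and> (\<forall>x y. \<bar>f x - f y\<bar> \<le> C * (wt k x + wt k y) * \<bar>x - y\<bar>)"

lemma wlip_nonneg: "wlip C k f \<Longrightarrow> 0 \<le> C"
  by (simp add: wlip_def)

lemma wlipD: "wlip C k f \<Longrightarrow> \<bar>f x - f y\<bar> \<le> C * (wt k x + wt k y) * \<bar>x - y\<bar>"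
  by (simp add: wlip_def)

lemma wlip_mono: assumes "wlip C k f" "C \<le> D" shows "wlip D k f"
  unfolding wlip_def
proof (intro conjI allI)
  show "0 \<le> D" using assms by (simp add: wlip_def)
  fix x y
  have "C * (wt k x + wt k y) * \<bar>x - y\<bar> \<le> D * (wt k x + wt k y) * \<bar>x - y\<bar>"
    by (intro mult_right_mono assms add_nonneg_nonneg) auto
  thus "\<bar>f x - f y\<bar> \<le> D * (wt k x + wt k y) * \<bar>x - y\<bar>"
    using wlipD[OF assms(1), of x y] by linarith
qed

lemma lLip_bound_imp_wlip: 
  assumes "lLip_bound C k f" shows "wlip (2 * C) k f"
  unfolding wlip_def
proof (intro conjI allI)
  show "0 \<le> 2 * C" using assms by (simp add: lLip_bound_def)
  fix x y :: real
  have "1 + \<bar>x\<bar> ^ k + \<bar>y\<bar> ^ k \<le> 2 * (wt k x + wt k y)"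
  proof -
    have "1 + \<bar>x\<bar> ^ k + \<bar>y\<bar> ^ k \<le> wt k x + wt k x + wt k y"
      by (intro add_mono pow_le_wt wt_ge_1)
    also have "\<dots> \<le> 2 * (wt k x + wt k y)" by simp
    finally show ?thesis .
  qed
  hence le: "C * (1 + \<bar>x\<bar> ^ k + \<bar>y\<bar> ^ k) * \<bar>x - y\<bar> \<le> C * (2 * (wt k x + wt k y)) * \<bar>x - y\<bar>"
    using assms by (intro mult_right_mono mult_left_mono) (auto simp: lLip_bound_def)
  have "\<bar>f x - f y\<bar> \<le> C * (1 + \<bar>x\<bar> ^ k + \<bar>y\<bar> ^ k) * \<bar>x - y\<bar>"
    using assms by (simp add: lLip_bound_def)
  also note le
  also have "C * (2 * (wt k x + wt k y)) = 2 * C * (wt k x + wt k y)" by simp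
  finally show "\<bar>f x - f y\<bar> \<le> 2 * C * (wt k x + wt k y) * \<bar>x - y\<bar>" .
qed

lemma wlip_imp_lLip_bound:
  assumes "wlip C k f" shows "lLip_bound ((C + 1) * (2 * 2 ^ k)) k f"
  unfolding lLip_bound_def
proof (intro conjI allI)
  have C: "0 \<le> C" using assms by (rule wlip_nonneg)
  show "0 < (C + 1) * (2 * 2 ^ k)" using C by simp
  fix x y :: real
  have "wt k x + wt k y \<le> 2 ^ k * (1 + \<bar>x\<bar> ^ k) + 2 ^ k * (1 + \<bar>y\<bar> ^ k)"
    by (intro add_mono wt_le_1_plus_pow)
  also have "\<dots> = 2 ^ k * (2 + \<bar>x\<bar> ^ k + \<bar>y\<bar> ^ k)" by (simp add: algebra_simps)
  also have "\<dots> \<le> 2 ^ k * (2 * (1 + \<bar>x\<bar> ^ k + \<bar>y\<bar> ^ k))" by (intro mult_left_mono) auto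
  also have "\<dots> = (2 * 2 ^ k) * (1 + \<bar>x\<bar> ^ k + \<bar>y\<bar> ^ k)" by (simp only: mult_ac)
  finally have "wt k x + wt k y \<le> (2 * 2 ^ k) * (1 + \<bar>x\<bar> ^ k + \<bar>y\<bar> ^ k)" .
  hence "C * (wt k x + wt k y) * \<bar>x - y\<bar> \<le> (C + 1) * ((2 * 2 ^ k) * (1 + \<bar>x\<bar> ^ k + \<bar>y\<bar> ^ k)) * \<bar>x - y\<bar>"
    using C by (intro mult_right_mono mult_mono) auto
  thus "\<bar>f x - f y\<bar> \<le> (C + 1) * (2 * 2 ^ k) * (1 + \<bar>x\<bar> ^ k + \<bar>y\<bar> ^ k) * \<bar>x - y\<bar>"
    using wlipD[OF assms, of x y] by (simp add: mult.assoc)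
qed

lemma wlip_in_C_lLip: "wlip C k f \<Longrightarrow> f \<in> C_lLip"
  unfolding C_lLip_def using wlip_imp_lLip_bound by blast

lemma wlip_isCont:
  assumes "wlip C k f" shows "isCont f x"
  unfolding isCont_def
proof (rule LIM_zero_cancel, rule Lim_null_comparison)
  show "\<forall>\<^sub>F y in at x. norm (f y - f x) \<le> C * (wt k y + wt k x) * \<bar>y - x\<bar>"
    using wlipD[OF assms] by (intro always_eventually) simp
  have "isCont (\<lambda>y. C * (wt k y + wt k x) * \<bar>y - x\<bar>) x"
    using continuous_on_wt[of UNIV "\<lambda>x. x" k]
    by (intro continuous_intros) (auto simp: continuous_on_eq_continuous_at)
  thus "((\<lambda>y. C * (wt k y + wt k x) * \<bar>y - x\<bar>) \<longlongrightarrow> 0) (at x)"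
    unfolding isCont_def by simp
qed

lemma wlip_continuous_on: "wlip C k f \<Longrightarrow> continuous_on S f"
  using wlip_isCont continuous_at_imp_continuous_on by blast

lemma wlip_growth:
  assumes "wlip C k f" shows "\<bar>f x\<bar> \<le> (\<bar>f 0\<bar> + 2 * C) * wt (k + 1) x"
proof -
  have C: "0 \<le> C" using assms by (rule wlip_nonneg)
  have "\<bar>f x\<bar> \<le> \<bar>f 0\<bar> + C * (wt k x + wt k 0) * \<bar>x\<bar>"
    using wlipD[OF assms, of x 0] by simp
  also have "C * (wt k x + wt k 0) * \<bar>x\<bar> \<le> C * (wt k x + wt k x) * wt 1 x"
    using C abs_le_wt_1[of x] wt_abs_mono[of 0 x k] by (intro mult_mono) auto
  also have "\<dots> = 2 * C * wt (k + 1) x" unfolding wt_add by simp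
  finally have "\<bar>f x\<bar> \<le> \<bar>f 0\<bar> + 2 * C * wt (k + 1) x" by simp
  moreover have "\<bar>f 0\<bar> * 1 \<le> \<bar>f 0\<bar> * wt (k + 1) x" by (intro mult_left_mono wt_ge_1) auto
  ultimately show ?thesis unfolding distrib_right by linarith
qed

lemma wlip_poly_growth: assumes "wlip C k f" shows "poly_growth f"
proof (rule poly_growth_bound)
  show "poly_growth (\<lambda>x. (\<bar>f 0\<bar> + 2 * C) * wt (k + 1) x)" by (intro poly_growth_intros)
  show "f \<in> borel_measurable borel"
    by (rule borel_measurable_continuous_onI[OF wlip_continuous_on[OF assms]])
qed (rule wlip_growth[OF assms])

lemma wlip_poly_growth_compose:
  "wlip C k f \<Longrightarrow> poly_growth g \<Longrightarrow> poly_growth (\<lambda>z. f (g z))"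
  by (rule poly_growth_compose[OF wlip_poly_growth])

lemma gavg_0 [simp]: "gavg 0 f x = f x"
  using gauss.prob_space by (simp add: gavg_def)

lemma gavg_mono:
  assumes "poly_growth f" "poly_growth g" "\<And>x. f x \<le> g x"
  shows "gavg s f x \<le> gavg s g x"
  unfolding gavg_def
  by (intro integral_gauss_mono poly_growth_compose[OF assms(1)] poly_growth_compose[OF assms(2)] assms)
     (intro poly_growth_intros)+

text \<open>Both normal variables are built from the same \<open>z\<close>, so that their difference
  is \<open>(s - t) * z\<close> and the local Lipschitz bound applies pointwise.\<close>

lemma gavg_diff_le:
  assumes f: "wlip C k f"
  shows "\<bar>gavg s f x - gavg t f x\<bar> \<le> C * 2 ^ k * wt k x * (wt k s + wt k t) * \<bar>s - t\<bar> * wt_moment (k + 1)"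
proof -
  have C: "0 \<le> C" using f by (rule wlip_nonneg)
  let ?A = "C * 2 ^ k * wt k x * (wt k s + wt k t) * \<bar>s - t\<bar>"
  have "gavg s f x - gavg t f x = (\<integral>z. f (x + s * z) - f (x + t * z) \<partial>gauss)"
    unfolding gavg_def
    by (intro Bochner_Integration.integral_diff[symmetric] integrable_poly_growth poly_growth_intros wlip_poly_growth_compose[OF f])
  also have "\<bar>\<dots>\<bar> \<le> (\<integral>z. ?A * wt (k + 1) z \<partial>gauss)"
  proof (rule abs_integral_gauss_le)
    fix z
    have w: "wt k (x + r * z) \<le> 2 ^ k * (wt k x * (wt k r * wt k z))" for r
      by (rule order_trans[OF wt_add_le]) (intro mult_left_mono wt_mult_le; simp)
    have "\<bar>f (x + s * z) - f (x + t * z)\<bar> \<le> C * (wt k (x + s * z) + wt k (x + t * z)) * \<bar>(x + s * z) - (x + t * z)\<bar>"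
      by (rule wlipD[OF f])
    also have "\<bar>(x + s * z) - (x + t * z)\<bar> = \<bar>s - t\<bar> * \<bar>z\<bar>" by (simp add: left_diff_distrib[symmetric] abs_mult)
    also have "C * (wt k (x + s * z) + wt k (x + t * z)) * (\<bar>s - t\<bar> * \<bar>z\<bar>) \<le>
       C * (2 ^ k * (wt k x * (wt k s * wt k z)) + 2 ^ k * (wt k x * (wt k t * wt k z))) * (\<bar>s - t\<bar> * wt 1 z)"
      using C by (intro mult_mono add_mono w abs_le_wt_1) auto
    also have "\<dots> = ?A * wt (k + 1) z" unfolding wt_add by (simp add: algebra_simps)
    finally show "\<bar>f (x + s * z) - f (x + t * z)\<bar> \<le> ?A * wt (k + 1) z" .
  qed (intro poly_growth_intros wlip_poly_growth_compose[OF f])+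
  also have "\<dots> = ?A * wt_moment (k + 1)" by (simp add: wt_moment_def)
  finally show ?thesis .
qed

lemma gavg_approx:
  assumes f: "wlip C k f" and s: "0 \<le> s" "s \<le> S"
  shows "\<bar>gavg s f x - f x\<bar> \<le> C * (2 ^ k * (wt k S + 1) * wt_moment (k + 1)) * s * wt k x"
proof -
  have C: "0 \<le> C" using f by (rule wlip_nonneg)
  have "\<bar>gavg s f x - f x\<bar> \<le> C * 2 ^ k * wt k x * (wt k s + wt k 0) * \<bar>s - 0\<bar> * wt_moment (k + 1)"
    using gavg_diff_le[OF f, of s x 0] by simp
  also have "\<dots> \<le> C * 2 ^ k * wt k x * (wt k S + 1) * s * wt_moment (k + 1)"
  proof -
    have "wt k s + wt k 0 \<le> wt k S + 1" using s wt_abs_mono[of s S k] by (simp add: wt_def)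
    thus ?thesis using C s
      by (simp only: diff_0_right abs_of_nonneg)
         (intro mult_right_mono mult_left_mono wt_moment_nonneg mult_nonneg_nonneg; simp)
  qed
  finally show ?thesis by (simp add: mult_ac)
qed

lemma gavg_continuous:
  assumes f: "wlip C k f" shows "isCont (\<lambda>s. gavg s f x) t"
  unfolding isCont_def
proof (rule LIM_zero_cancel, rule Lim_null_comparison)
  let ?B = "\<lambda>s. C * 2 ^ k * wt k x * (wt k s + wt k t) * \<bar>s - t\<bar> * wt_moment (k + 1)"
  show "\<forall>\<^sub>F s in at t. norm (gavg s f x - gavg t f x) \<le> ?B s"
    using gavg_diff_le[OF f] by (intro always_eventually) simp
  have "isCont ?B t"
    using continuous_on_wt[of UNIV "\<lambda>x. x" k]
    by (intro continuous_intros) (auto simp: continuous_on_eq_continuous_at)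
  thus "(?B \<longlongrightarrow> 0) (at t)"
    unfolding isCont_def by simp
qed

lemma gavg_continuous_on: "wlip C k f \<Longrightarrow> continuous_on A g \<Longrightarrow> continuous_on A (\<lambda>v. gavg (g v) f x)"
  using continuous_on_compose2[OF continuous_at_imp_continuous_on, of UNIV "\<lambda>s. gavg s f x" A g] gavg_continuous
  by blast

text \<open>The constant of \<open>wt_average_le\<close> is known only to exist; carrying it as a
  predicate allows one \<open>c\<close> to be fixed for all steps of the scheme.\<close>

definition wt_rate :: "nat \<Rightarrow> real \<Rightarrow> real \<Rightarrow> bool" where
  "wt_rate k S c \<longleftrightarrow> 0 \<le> c \<and> (\<forall>s x. 0 \<le> s \<longrightarrow> s \<le> S \<longrightarrow> gavg s (wt k) x \<le> exp (c * s\<^sup>2) * wt k x)"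

lemma wt_rate_exists: "0 \<le> S \<Longrightarrow> \<exists>c. wt_rate k S c"
  unfolding wt_rate_def gavg_def using wt_average_le[of S k] by metis

lemma wlip_gavg:
  assumes f: "wlip C k f" and c: "wt_rate k S c" and s: "0 \<le> s" "s \<le> S"
  shows "wlip (C * exp (c * s\<^sup>2)) k (gavg s f)"
  unfolding wlip_def
proof (intro conjI allI)
  have C: "0 \<le> C" using f by (rule wlip_nonneg)
  thus "0 \<le> C * exp (c * s\<^sup>2)" by simp
  fix x y
  have "gavg s f x - gavg s f y = (\<integral>z. f (x + s * z) - f (y + s * z) \<partial>gauss)"
    unfolding gavg_def
    by (intro Bochner_Integration.integral_diff[symmetric] integrable_poly_growth poly_growth_intros wlip_poly_growth_compose[OF f])
  also have "\<bar>\<dots>\<bar> \<le> (\<integral>z. C * (wt k (x + s * z) + wt k (y + s * z)) * \<bar>x - y\<bar> \<partial>gauss)"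
  proof (rule abs_integral_gauss_le)
    show "\<bar>f (x + s * z) - f (y + s * z)\<bar> \<le> C * (wt k (x + s * z) + wt k (y + s * z)) * \<bar>x - y\<bar>" for z
      using wlipD[OF f, of "x + s * z" "y + s * z"] by simp
  qed (intro poly_growth_intros wlip_poly_growth_compose[OF f])+
  also have "\<dots> = C * (gavg s (wt k) x + gavg s (wt k) y) * \<bar>x - y\<bar>"
    unfolding gavg_def
    by (simp, subst Bochner_Integration.integral_add) (auto intro!: integrable_poly_growth poly_growth_intros)
  also have "\<dots> \<le> C * (exp (c * s\<^sup>2) * wt k x + exp (c * s\<^sup>2) * wt k y) * \<bar>x - y\<bar>"
    using C c s unfolding wt_rate_def by (intro mult_right_mono mult_left_mono add_mono) auto
  also have "\<dots> = C * exp (c * s\<^sup>2) * (wt k x + wt k y) * \<bar>x - y\<bar>" by (simp add: algebra_simps)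
  finally show "\<bar>gavg s f x - gavg s f y\<bar> \<le> C * exp (c * s\<^sup>2) * (wt k x + wt k y) * \<bar>x - y\<bar>" .
qed

lemma distributed_gauss_affine:
  assumes "0 < s"
  shows "distr gauss lborel (\<lambda>z. x + s * z) = density lborel (normal_density x s)"
proof -
  have "distributed gauss lborel (\<lambda>z. z) std_normal_density"
    unfolding distributed_def gauss_def
    by (auto intro!: measurable_ident_sets distr_id2)
  from gauss.normal_density_affine[OF this, of s x] assms
  have "distributed gauss lborel (\<lambda>z. x + s * z) (normal_density x s)" by simp
  thus ?thesis by (rule distributed_distr_eq_density)
qed

lemma integral_normal_density:
  assumes "0 < s" "g \<in> borel_measurable borel"
  shows "(\<integral>y. g y \<partial>density lborel (normal_density x s)) = gavg s g x"
  unfolding distributed_gauss_affine[OF assms(1), symmetric] gavg_def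
  using assms by (subst integral_distr) auto

lemma gavg_eq_lborel:
  assumes "0 < s" "g \<in> borel_measurable borel"
  shows "gavg s g x = (\<integral>y. normal_density x s y * g y \<partial>lborel)"
  unfolding integral_normal_density[OF assms, symmetric]
  using assms by (subst integral_real_density) (auto simp: normal_density_nonneg)

lemma integrable_normal_density_poly:
  assumes "0 < s" "poly_growth g"
  shows "integrable (density lborel (normal_density x s)) g"
  unfolding distributed_gauss_affine[OF assms(1), symmetric]
  using poly_growth_measurable[OF assms(2)]
  by (subst integrable_distr_eq) (auto intro!: integrable_poly_growth poly_growth_compose[OF assms(2)] poly_growth_intros)

lemma integral_normal_law:
  assumes "0 \<le> v" "g \<in> borel_measurable borel" "n \<ge> 1"
  shows "(\<integral>y. g y \<partial>normal_law x (v\<^sup>2 / real n)) = gavg (v * (1 / sqrt n)) g x"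
proof (cases "v = 0")
  case True
  thus ?thesis using assms by (simp add: normal_law_def integral_return)
next
  case False
  hence "sqrt (v\<^sup>2 / real n) = v * (1 / sqrt n)" "0 < v * (1 / sqrt n)"
    using assms by (auto simp: real_sqrt_divide)
  thus ?thesis using assms False integral_normal_density[of "v * (1 / sqrt n)" g x]
    by (simp add: normal_law_def)
qed

text \<open>Convolution of centred normal laws adds variances. This is what lets a mollification be
  exchanged with a heat step. Zero variance is treated apart, since a point mass has no
  density.\<close>

lemma gavg_semigroup:
  assumes f: "poly_growth f" and ab: "0 \<le> a" "0 \<le> b"
  shows "gavg a (gavg b f) x = gavg (sqrt (a\<^sup>2 + b\<^sup>2)) f x"
proof (cases "a = 0 \<or> b = 0")
  case True
  have [simp]: "gavg 0 g = g" for g by (rule ext) simp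
  show ?thesis using True ab by auto
next
  case False
  hence a: "0 < a" and b: "0 < b" using ab by auto
  let ?s = "sqrt (a\<^sup>2 + b\<^sup>2)"
  have s: "0 < ?s" using a b by (simp add: add_pos_pos)
  let ?A = "density lborel (normal_density 0 a)" and ?B = "density lborel (normal_density 0 b)"
  interpret A: prob_space ?A using a by (rule prob_space_normal_density)
  interpret B: prob_space ?B using b by (rule prob_space_normal_density)
  interpret AB: pair_prob_space ?A ?B ..
  have m [measurable]: "f \<in> borel_measurable borel" by (rule poly_growth_measurable[OF f])
  have fx: "poly_growth (\<lambda>w. f (x + w))" by (intro poly_growth_compose[OF f] poly_growth_intros)
  have conv: "?A \<star> ?B = density lborel (normal_density 0 ?s)"
  proof -
    have "?A \<star> ?B = density lborel (\<lambda>x. \<integral>\<^sup>+y. ennreal (normal_density 0 a (x - y)) * ennreal (normal_density 0 b y) \<partial>lborel)"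
      using A.finite_measure_axioms B.finite_measure_axioms by (intro convolution_density) auto
    also have "(\<lambda>x. \<integral>\<^sup>+y. ennreal (normal_density 0 a (x - y)) * ennreal (normal_density 0 b y) \<partial>lborel)
        = normal_density 0 ?s"
      using conv_normal_density_zero_mean[OF a b] by (simp add: ennreal_mult normal_density_nonneg)
    finally show ?thesis .
  qed
  have "gavg ?s f x = gavg ?s (\<lambda>w. f (x + w)) 0" by (simp add: gavg_def)
  also have "\<dots> = (\<integral>w. f (x + w) \<partial>(?A \<star> ?B))"
    unfolding conv using s by (subst integral_normal_density) auto
  also have "\<dots> = (\<integral>p. f (x + (fst p + snd p)) \<partial>(?A \<Otimes>\<^sub>M ?B))"
    unfolding convolution_def by (subst integral_distr) (auto simp: case_prod_beta)
  also have "\<dots> = (\<integral>u. (\<integral>v. f (x + (u + v)) \<partial>?B) \<partial>?A)"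
  proof -
    have "integrable (?A \<star> ?B) (\<lambda>w. f (x + w))"
      unfolding conv by (rule integrable_normal_density_poly[OF s fx])
    hence "integrable (?A \<Otimes>\<^sub>M ?B) (\<lambda>p. f (x + (fst p + snd p)))"
      unfolding convolution_def by (subst (asm) integrable_distr_eq) (auto simp: case_prod_beta)
    from AB.integral_fst'[OF this] show ?thesis by simp
  qed
  also have "(\<lambda>u. (\<integral>v. f (x + (u + v)) \<partial>?B)) = (\<lambda>u. gavg b f (x + u))"
  proof
    fix u
    have "(\<integral>v. f (x + (u + v)) \<partial>?B) = gavg b (\<lambda>v. f (x + (u + v))) 0"
      using b by (subst integral_normal_density) auto
    thus "(\<integral>v. f (x + (u + v)) \<partial>?B) = gavg b f (x + u)" by (simp add: gavg_def add.assoc)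
  qed
  also have "(\<integral>u. gavg b f (x + u) \<partial>?A) = gavg a (\<lambda>u. gavg b f (x + u)) 0"
  proof (rule integral_normal_density[OF a])
    show "(\<lambda>u. gavg b f (x + u)) \<in> borel_measurable borel"
      unfolding gavg_def by (rule gauss.borel_measurable_lebesgue_integral) simp
  qed
  also have "\<dots> = gavg a (gavg b f) x" by (simp add: gavg_def)
  finally show ?thesis by simp
qed

section \<open>The one-step operator of the scheme\<close>

lemma max_over_attained:
  assumes "a \<le> b" "continuous_on {a..b} f"
  obtains v where "v \<in> {a..b}" "max_over a b f = f v" "\<And>w. w \<in> {a..b} \<Longrightarrow> f w \<le> f v"
proof -
  obtain v where v: "v \<in> {a..b}" "\<And>w. w \<in> {a..b} \<Longrightarrow> f w \<le> f v"
    using continuous_attains_sup[of "{a..b}" f] assms by auto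
  have "max_over a b f = f v"
    unfolding max_over_def using v by (intro Greatest_equality) auto
  with v that show ?thesis by blast
qed

definition one_step :: "real \<Rightarrow> real \<Rightarrow> real \<Rightarrow> (real \<Rightarrow> real) \<Rightarrow> real \<Rightarrow> real" where
  "one_step sl su r f x = max_over sl su (\<lambda>v. gavg (v * r) f x)"

lemma one_step_attained:
  assumes "sl \<le> su" "wlip C k f"
  obtains v where "v \<in> {sl..su}" "one_step sl su r f x = gavg (v * r) f x"
    "\<And>w. w \<in> {sl..su} \<Longrightarrow> gavg (w * r) f x \<le> one_step sl su r f x"
proof -
  have "continuous_on {sl..su} (\<lambda>v. gavg (v * r) f x)"
    by (intro gavg_continuous_on[OF assms(2)] continuous_intros)
  from max_over_attained[OF assms(1) this] that show ?thesis unfolding one_step_def by metis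
qed

lemma gavg_le_one_step:
  "sl \<le> su \<Longrightarrow> wlip C k f \<Longrightarrow> v \<in> {sl..su} \<Longrightarrow> gavg (v * r) f x \<le> one_step sl su r f x"
  using one_step_attained by metis

text \<open>A maximum over functions with a common modulus has the same modulus: the maximiser at
  one point is a competitor at the other. The common constant is the one of the largest volatility
  \<open>su\<close>.\<close>

lemma wlip_one_step:
  assumes sl: "0 \<le> sl" "sl \<le> su" and f: "wlip C k f" and c: "wt_rate k S c" and r: "0 \<le> r" "su * r \<le> S"
  shows "wlip (C * exp (c * (su * r)\<^sup>2)) k (one_step sl su r f)"
proof -
  let ?D = "C * exp (c * (su * r)\<^sup>2)"
  have C: "0 \<le> C" using f by (rule wlip_nonneg)
  have *: "one_step sl su r f x - one_step sl su r f y \<le> ?D * (wt k x + wt k y) * \<bar>x - y\<bar>" for x y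
  proof -
    obtain v where v: "v \<in> {sl..su}" "one_step sl su r f x = gavg (v * r) f x"
      using one_step_attained[OF sl(2) f] by metis
    have vr: "0 \<le> v * r" "v * r \<le> su * r" using v sl r by (auto intro: mult_right_mono)
    have "wlip (C * exp (c * (v * r)\<^sup>2)) k (gavg (v * r) f)"
      using vr r by (intro wlip_gavg[OF f c]) auto
    hence "wlip ?D k (gavg (v * r) f)"
      using C c vr by (elim wlip_mono) (auto simp: wt_rate_def intro!: mult_left_mono power_mono)
    moreover have "gavg (v * r) f y \<le> one_step sl su r f y"
      using v by (intro gavg_le_one_step[OF sl(2) f])
    ultimately show ?thesis using wlipD[of ?D k "gavg (v * r) f" x y] v by linarith
  qed
  show ?thesis unfolding wlip_def
  proof (intro conjI allI)
    fix x y show "\<bar>one_step sl su r f x - one_step sl su r f y\<bar> \<le> ?D * (wt k x + wt k y) * \<bar>x - y\<bar>"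
      using *[of x y] *[of y x] by (simp add: abs_le_iff abs_minus_commute add.commute)
  qed (use C in simp)
qed

lemma one_step_approx:
  assumes sl: "0 \<le> sl" "sl \<le> su" and f: "wlip C k f" and r: "0 \<le> r" "su * r \<le> S"
  shows "\<bar>one_step sl su r f x - f x\<bar> \<le> C * (2 ^ k * (wt k S + 1) * wt_moment (k + 1)) * (su * r) * wt k x"
proof -
  have C: "0 \<le> C" using f by (rule wlip_nonneg)
  obtain v where v: "v \<in> {sl..su}" "one_step sl su r f x = gavg (v * r) f x"
    using one_step_attained[OF sl(2) f] by metis
  have vr: "0 \<le> v * r" "v * r \<le> su * r" using v sl r by (auto intro: mult_right_mono)
  have "\<bar>gavg (v * r) f x - f x\<bar> \<le> C * (2 ^ k * (wt k S + 1) * wt_moment (k + 1)) * (v * r) * wt k x"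
    using vr r by (intro gavg_approx[OF f]) auto
  also have "\<dots> \<le> C * (2 ^ k * (wt k S + 1) * wt_moment (k + 1)) * (su * r) * wt k x"
    using C vr by (intro mult_right_mono[of _ _ "wt k x"] mult_left_mono[of "v * r"] mult_nonneg_nonneg wt_moment_nonneg) auto
  finally show ?thesis using v by simp
qed

text \<open>The two claims belong together: rewriting a step as \<open>one_step\<close> requires
  measurability of the previous stage, which comes from its Lipschitz bound, and the bound is
  carried on through \<open>one_step\<close>. The exponents add up to
  \<open>c * su\<^sup>2 * (i / n)\<close>, which is bounded for \<open>i \<le> n\<close>.\<close>

lemma scheme_wlip_and_Suc:
  assumes sl: "0 \<le> sl" "sl \<le> su" and f: "wlip C k \<phi>" and n: "n \<ge> 1" and c: "wt_rate k su c"
  shows "wlip (C * exp (c * su\<^sup>2 * (i / n))) k (scheme sl su \<phi> n i)"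
    and "scheme sl su \<phi> n (Suc i) = one_step sl su (1 / sqrt n) (scheme sl su \<phi> n i)"
proof -
  have step: "scheme sl su \<phi> n (Suc i) = one_step sl su (1 / sqrt n) (scheme sl su \<phi> n i)"
    if "wlip D k (scheme sl su \<phi> n i)" for D i
  proof
    fix x
    have m: "scheme sl su \<phi> n i \<in> borel_measurable borel"
      by (rule poly_growth_measurable[OF wlip_poly_growth[OF that]])
    \<comment> \<open>\<open>max_over\<close> sees only the image of the interval, so agreement on
      \<open>{sl..su}\<close> suffices, where \<open>0 \<le> v\<close> is available.\<close>
    have "(\<lambda>v. \<integral>y. scheme sl su \<phi> n i y \<partial>normal_law x (v\<^sup>2 / real n)) ` {sl..su}
        = (\<lambda>v. gavg (v * (1 / sqrt n)) (scheme sl su \<phi> n i) x) ` {sl..su}"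
      using sl by (intro image_cong integral_normal_law m n) auto
    thus "scheme sl su \<phi> n (Suc i) x = one_step sl su (1 / sqrt n) (scheme sl su \<phi> n i) x"
      by (simp add: one_step_def max_over_def)
  qed
  have *: "wlip (C * exp (c * su\<^sup>2 * (i / n))) k (scheme sl su \<phi> n i)" for i
  proof (induction i)
    case (Suc i)
    have r: "su * (1 / sqrt n) \<le> su" using sl n by (intro mult_left_le) auto
    have e: "C * exp (c * su\<^sup>2 * (i / n)) * exp (c * (su * (1 / sqrt n))\<^sup>2) = C * exp (c * su\<^sup>2 * (Suc i / n))"
      using n by (simp add: power_mult_distrib power_divide exp_add[symmetric] algebra_simps add_divide_distrib)
    show ?case unfolding step[OF Suc.IH] e[symmetric]
      by (rule wlip_one_step[OF sl Suc.IH c _ r]) simp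
  qed (use f in simp)
  show "scheme sl su \<phi> n (Suc i) = one_step sl su (1 / sqrt n) (scheme sl su \<phi> n i)"
    by (rule step[OF *])
  show "wlip (C * exp (c * su\<^sup>2 * (i / n))) k (scheme sl su \<phi> n i)" by (rule *)
qed

section \<open>The heat semigroup\<close>

lemma has_derivative_integral_dominated:
  fixes f f' :: "real \<Rightarrow> real \<Rightarrow> real"
  assumes d: "0 < d"
    and int: "\<And>t. \<bar>t - t0\<bar> < d \<Longrightarrow> integrable lborel (f t)"
    and der: "\<And>t y. \<bar>t - t0\<bar> < d \<Longrightarrow> ((\<lambda>t. f t y) has_real_derivative f' t y) (at t)"
    and g: "integrable lborel g" "\<And>t y. \<bar>t - t0\<bar> < d \<Longrightarrow> \<bar>f' t y\<bar> \<le> g y"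
    and m: "f' t0 \<in> borel_measurable borel"
  shows "((\<lambda>t. \<integral>y. f t y \<partial>lborel) has_real_derivative (\<integral>y. f' t0 y \<partial>lborel)) (at t0)"
  unfolding has_field_derivative_iff tendsto_at_iff_sequentially
proof (intro allI impI)
  fix X :: "nat \<Rightarrow> real"
  assume X: "\<forall>i. X i \<in> UNIV - {t0}" "X \<longlonglongrightarrow> t0"
  \<comment> \<open>The bounds hold only near \<open>t0\<close>, so dominated convergence is applied
    to a tail of the sequence.\<close>
  from LIMSEQ_D[OF X(2) d] obtain N where N: "\<And>n. n \<ge> N \<Longrightarrow> \<bar>X n - t0\<bar> < d" by auto
  define Y where "Y = (\<lambda>n. X (n + N))"
  have Y: "\<bar>Y n - t0\<bar> < d" "Y n \<noteq> t0" for n using X(1) N[of "n + N"] by (auto simp: Y_def)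
  have Yl: "Y \<longlonglongrightarrow> t0" unfolding Y_def by (rule LIMSEQ_ignore_initial_segment[OF X(2)])
  have "(\<lambda>n. \<integral>y. (f (Y n) y - f t0 y) / (Y n - t0) \<partial>lborel) \<longlonglongrightarrow> (\<integral>y. f' t0 y \<partial>lborel)"
  proof (rule integral_dominated_convergence[OF _ _ g(1)])
    show "(\<lambda>y. (f (Y n) y - f t0 y) / (Y n - t0)) \<in> borel_measurable lborel" for n
      using int[OF Y(1)[of n]] int[of t0] d by (auto dest!: borel_measurable_integrable)
    show "AE y in lborel. (\<lambda>n. (f (Y n) y - f t0 y) / (Y n - t0)) \<longlonglongrightarrow> f' t0 y"
    proof (intro AE_I2)
      fix y
      have "((\<lambda>t. (f t y - f t0 y) / (t - t0)) \<longlongrightarrow> f' t0 y) (at t0)"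
        using der[of t0 y] d unfolding has_field_derivative_iff by simp
      thus "(\<lambda>n. (f (Y n) y - f t0 y) / (Y n - t0)) \<longlonglongrightarrow> f' t0 y"
        using Yl Y(2) unfolding tendsto_at_iff_sequentially o_def by auto
    qed
    fix n
    show "AE y in lborel. norm ((f (Y n) y - f t0 y) / (Y n - t0)) \<le> g y"
    proof (intro AE_I2)
      fix y
      \<comment> \<open>The mean value inequality turns the bound on the derivative into a bound on
        the difference quotient.\<close>
      have "norm (f (Y n) y - f t0 y) \<le> g y * norm (Y n - t0)"
      proof (rule field_differentiable_bound[of "ball t0 d"])
        fix z assume "z \<in> ball t0 d"
        hence z: "\<bar>z - t0\<bar> < d" by (simp add: dist_real_def abs_minus_commute)
        show "((\<lambda>t. f t y) has_field_derivative f' z y) (at z within ball t0 d)"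
          by (rule has_field_derivative_at_within[OF der[OF z]])
        show "norm (f' z y) \<le> g y" using g(2)[OF z] by simp
      qed (use Y(1)[of n] d in \<open>auto simp: dist_real_def abs_minus_commute\<close>)
      thus "norm ((f (Y n) y - f t0 y) / (Y n - t0)) \<le> g y"
        using Y(2)[of n] by (simp add: abs_divide divide_le_eq)
    qed
  qed (use m in simp)
  also have "(\<lambda>n. \<integral>y. (f (Y n) y - f t0 y) / (Y n - t0) \<partial>lborel)
      = (\<lambda>n. ((\<integral>y. f (Y n) y \<partial>lborel) - (\<integral>y. f t0 y \<partial>lborel)) / (Y n - t0))"
  proof
    fix n
    show "(\<integral>y. (f (Y n) y - f t0 y) / (Y n - t0) \<partial>lborel)
      = ((\<integral>y. f (Y n) y \<partial>lborel) - (\<integral>y. f t0 y \<partial>lborel)) / (Y n - t0)"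
      using int[OF Y(1)[of n]] int[of t0] d by simp
  qed
  finally show "((\<lambda>t. ((\<integral>y. f t y \<partial>lborel) - (\<integral>y. f t0 y \<partial>lborel)) / (t - t0)) \<circ> X) 
     \<longlonglongrightarrow> (\<integral>y. f' t0 y \<partial>lborel)"
    unfolding Y_def o_def by (rule LIMSEQ_offset)
qed

lemma isCont_integral_dominated:
  fixes f :: "'a::metric_space \<Rightarrow> real \<Rightarrow> real"
  assumes ev: "eventually P (nhds p)"
    and m: "\<And>q. f q \<in> borel_measurable borel"
    and g: "integrable lborel g" "\<And>q y. P q \<Longrightarrow> \<bar>f q y\<bar> \<le> g y"
    and cont: "\<And>y. isCont (\<lambda>q. f q y) p"
  shows "isCont (\<lambda>q. \<integral>y. f q y \<partial>lborel) p"
  unfolding continuous_at_sequentially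
proof (intro allI impI)
  fix X assume X: "X \<longlonglongrightarrow> p"
  have "eventually (\<lambda>n. P (X n)) sequentially" 
    using X ev by (simp add: filterlim_iff)
  then obtain N where N: "\<And>n. n \<ge> N \<Longrightarrow> P (X n)" unfolding eventually_sequentially by blast
  have "(\<lambda>n. \<integral>y. f (X (n + N)) y \<partial>lborel) \<longlonglongrightarrow> (\<integral>y. f p y \<partial>lborel)"
  proof (rule integral_dominated_convergence[OF _ _ g(1)])
    show "AE y in lborel. (\<lambda>n. f (X (n + N)) y) \<longlonglongrightarrow> f p y"
    proof (intro AE_I2)
      fix y show "(\<lambda>n. f (X (n + N)) y) \<longlonglongrightarrow> f p y"
        by (rule isCont_tendsto_compose[OF cont LIMSEQ_ignore_initial_segment[OF X]])
    qed
    show "AE y in lborel. norm (f (X (n + N)) y) \<le> g y" for n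
      using g(2)[OF N[of "n + N"]] by simp
  qed (use m in simp_all)
  thus "((\<lambda>q. \<integral>y. f q y \<partial>lborel) \<circ> X) \<longlonglongrightarrow> (\<integral>y. f p y \<partial>lborel)"
    unfolding o_def by (rule LIMSEQ_offset)
qed

section \<open>The heat kernel and the derivatives of the heat flow\<close>

definition heat_kernel :: "real \<Rightarrow> real \<Rightarrow> real" where
  "heat_kernel \<tau> d = exp (- d\<^sup>2 / (2 * \<tau>)) / sqrt (2 * pi * \<tau>)"

text \<open>Since \<open>f\<close> need not be differentiable, all derivatives have to fall on the
  kernel. The factor \<open>p\<close> collects the polynomials that they produce, so that domination
  and continuity are proved once for the flow and its two space derivatives. The time parameter
  \<open>\<tau>\<close> is the variance.\<close>

definition heat_int :: "(real \<Rightarrow> real \<Rightarrow> real) \<Rightarrow> (real \<Rightarrow> real) \<Rightarrow> real \<Rightarrow> real \<Rightarrow> real" where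
  "heat_int p f \<tau> x = (\<integral>y. f y * (heat_kernel \<tau> (y - x) * p \<tau> (y - x)) \<partial>lborel)"

abbreviation "heat0 \<equiv> heat_int (\<lambda>\<tau> d. 1)"
abbreviation "heat1 \<equiv> heat_int (\<lambda>\<tau> d. d / \<tau>)"
abbreviation "heat2 \<equiv> heat_int (\<lambda>\<tau> d. d\<^sup>2 / \<tau>\<^sup>2 - 1 / \<tau>)"

lemma normal_density_eq_heat_kernel: "0 < \<tau> \<Longrightarrow> normal_density x (sqrt \<tau>) y = heat_kernel \<tau> (y - x)"
  unfolding normal_density_def heat_kernel_def by simp

lemma heat_kernel_nonneg: "0 < \<tau> \<Longrightarrow> 0 \<le> heat_kernel \<tau> d"
  unfolding heat_kernel_def by simp

lemma heat_int_eq_gavg: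
  assumes "0 < \<tau>" "f \<in> borel_measurable borel" "p \<tau> \<in> borel_measurable borel"
  shows "heat_int p f \<tau> x = (\<integral>z. f (x + sqrt \<tau> * z) * p \<tau> (sqrt \<tau> * z) \<partial>gauss)"
proof -
  have m: "(\<lambda>y. f y * p \<tau> (y - x)) \<in> borel_measurable borel"
    using assms(2) measurable_compose[OF _ assms(3), of "\<lambda>y. y - x" borel] by simp
  have "heat_int p f \<tau> x = (\<integral>y. normal_density x (sqrt \<tau>) y * (f y * p \<tau> (y - x)) \<partial>lborel)"
    unfolding heat_int_def normal_density_eq_heat_kernel[OF assms(1)] by (simp add: mult_ac)
  also have "\<dots> = gavg (sqrt \<tau>) (\<lambda>y. f y * p \<tau> (y - x)) x"
    using assms m by (subst gavg_eq_lborel) auto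
  finally show ?thesis by (simp add: gavg_def)
qed

lemma heat0_eq_gavg: "0 < \<tau> \<Longrightarrow> f \<in> borel_measurable borel \<Longrightarrow> heat0 f \<tau> x = gavg (sqrt \<tau>) f x"
  by (subst heat_int_eq_gavg) (auto simp: gavg_def)

text \<open>The inequality \<open>(y - x)\<^sup>2 \<ge> y\<^sup>2 / 2 - x\<^sup>2\<close> trades the
  shift for the factor \<open>exp (R\<^sup>2 / (4 * \<tau>0))\<close> and the larger variance
  \<open>4 * \<tau>0\<close>. The result is a single Gaussian majorant for all nearby variances and
  positions; the factor 4 compares the normalising constants.\<close>

lemma heat_kernel_bound:
  assumes t: "0 < \<tau>0" "\<tau>0 / 2 \<le> \<tau>" "\<tau> \<le> 2 * \<tau>0" and x: "\<bar>x\<bar> \<le> R"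
  shows "heat_kernel \<tau> (y - x) \<le> exp (R\<^sup>2 / (4 * \<tau>0)) * 4 * normal_density 0 (2 * sqrt \<tau>0) y"
proof -
  have pos: "0 < \<tau>" using t by simp
  have "x\<^sup>2 \<le> R\<^sup>2" using x by (simp add: abs_le_square_iff[symmetric])
  moreover have "y\<^sup>2 / 2 - x\<^sup>2 \<le> (y - x)\<^sup>2"
    using zero_le_power2[of "y - 2 * x"] by (simp add: power2_eq_square algebra_simps)
  ultimately have a: "y\<^sup>2 / 2 - R\<^sup>2 \<le> (y - x)\<^sup>2" by simp
  have "(y - x)\<^sup>2 / (4 * \<tau>0) \<le> (y - x)\<^sup>2 / (2 * \<tau>)"
    using t pos by (intro divide_left_mono) auto
  moreover have "(y\<^sup>2 / 2 - R\<^sup>2) / (4 * \<tau>0) \<le> (y - x)\<^sup>2 / (4 * \<tau>0)"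
    using a t by (intro divide_right_mono) auto
  ultimately have "- (y - x)\<^sup>2 / (2 * \<tau>) \<le> R\<^sup>2 / (4 * \<tau>0) - y\<^sup>2 / (8 * \<tau>0)"
    by (simp add: diff_divide_distrib)
  hence e: "exp (- (y - x)\<^sup>2 / (2 * \<tau>)) \<le> exp (R\<^sup>2 / (4 * \<tau>0)) * exp (- y\<^sup>2 / (8 * \<tau>0))"
    unfolding exp_add[symmetric] by simp
  have "sqrt (2 * pi * (2 * sqrt \<tau>0)\<^sup>2) / 4 \<le> sqrt (2 * pi * \<tau>)"
  proof -
    have "sqrt (2 * pi * (2 * sqrt \<tau>0)\<^sup>2) / 4 = sqrt (2 * pi * (2 * sqrt \<tau>0)\<^sup>2) / sqrt 16" by simp
    also have "\<dots> = sqrt (2 * pi * (2 * sqrt \<tau>0)\<^sup>2 / 16)" by (simp only: real_sqrt_divide)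
    also have "\<dots> \<le> sqrt (2 * pi * \<tau>)"
      using t by (intro real_sqrt_le_mono) (simp add: power_mult_distrib)
    finally show ?thesis .
  qed
  hence "heat_kernel \<tau> (y - x) \<le> (exp (R\<^sup>2 / (4 * \<tau>0)) * exp (- y\<^sup>2 / (8 * \<tau>0))) / (sqrt (2 * pi * (2 * sqrt \<tau>0)\<^sup>2) / 4)"
    unfolding heat_kernel_def using e t by (intro frac_le) auto
  also have "\<dots> = exp (R\<^sup>2 / (4 * \<tau>0)) * 4 * normal_density 0 (2 * sqrt \<tau>0) y"
    using t unfolding normal_density_def by (simp add: power_mult_distrib)
  finally show ?thesis .
qed

lemma heat_int_dominated:
  assumes f: "poly_growth f" and t: "0 < \<tau>0"
    and p: "\<And>\<tau> d. \<tau>0 / 2 \<le> \<tau> \<Longrightarrow> \<tau> \<le> 2 * \<tau>0 \<Longrightarrow> \<bar>p \<tau> d\<bar> \<le> B * (1 + \<bar>d\<bar>)\<^sup>2"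
  obtains g where "integrable lborel g"
    "\<And>\<tau> x y. \<tau>0 / 2 \<le> \<tau> \<Longrightarrow> \<tau> \<le> 2 * \<tau>0 \<Longrightarrow> \<bar>x - x0\<bar> \<le> 1 \<Longrightarrow>
       \<bar>f y * (heat_kernel \<tau> (y - x) * p \<tau> (y - x))\<bar> \<le> g y"
proof -
  define R where "R = \<bar>x0\<bar> + 1"
  define E where "E = exp (R\<^sup>2 / (4 * \<tau>0)) * 4"
  define h where "h = (\<lambda>y. \<bar>f y\<bar> * (E * (B * (1 + (\<bar>y\<bar> + R))\<^sup>2)))"
  have B: "0 \<le> B" using p[of \<tau>0 0] t by simp
  have h: "poly_growth h" unfolding h_def by (intro poly_growth_intros f)
  have "integrable lborel (\<lambda>y. normal_density 0 (2 * sqrt \<tau>0) y * h y)"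
  proof -
    have "integrable (density lborel (normal_density 0 (2 * sqrt \<tau>0))) h"
      using t by (intro integrable_normal_density_poly h) simp
    thus ?thesis using poly_growth_measurable[OF h]
      by (subst (asm) integrable_real_density) (auto simp: normal_density_nonneg)
  qed
  moreover have "\<bar>f y * (heat_kernel \<tau> (y - x) * p \<tau> (y - x))\<bar> \<le> normal_density 0 (2 * sqrt \<tau>0) y * h y"
    if tau: "\<tau>0 / 2 \<le> \<tau>" "\<tau> \<le> 2 * \<tau>0" and x: "\<bar>x - x0\<bar> \<le> 1" for \<tau> x y
  proof -
    have xR: "\<bar>x\<bar> \<le> R" using x by (simp add: R_def)
    have k0: "0 \<le> heat_kernel \<tau> (y - x)" using t tau by (intro heat_kernel_nonneg) simp
    have "\<bar>f y * (heat_kernel \<tau> (y - x) * p \<tau> (y - x))\<bar> = \<bar>f y\<bar> * (heat_kernel \<tau> (y - x) * \<bar>p \<tau> (y - x)\<bar>)"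
      using k0 by (simp add: abs_mult)
    also have "\<dots> \<le> \<bar>f y\<bar> * ((E * normal_density 0 (2 * sqrt \<tau>0) y) * (B * (1 + (\<bar>y\<bar> + R))\<^sup>2))"
    proof (intro mult_left_mono mult_mono)
      show "heat_kernel \<tau> (y - x) \<le> E * normal_density 0 (2 * sqrt \<tau>0) y"
        unfolding E_def by (rule heat_kernel_bound[OF t tau xR])
      have "\<bar>p \<tau> (y - x)\<bar> \<le> B * (1 + \<bar>y - x\<bar>)\<^sup>2" by (rule p[OF tau])
      also have "\<dots> \<le> B * (1 + (\<bar>y\<bar> + R))\<^sup>2"
        using xR B by (intro mult_left_mono power_mono) auto
      finally show "\<bar>p \<tau> (y - x)\<bar> \<le> B * (1 + (\<bar>y\<bar> + R))\<^sup>2" .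
    qed (auto simp: E_def normal_density_nonneg)
    finally show ?thesis by (simp add: h_def mult_ac)
  qed
  ultimately show ?thesis using that by blast
qed

lemma heat_weight_bounds:
  assumes t: "0 < \<tau>0" "\<tau>0 / 2 \<le> \<tau>"
  shows "\<bar>1\<bar> \<le> (1 + 2 / \<tau>0)\<^sup>2 * (1 + \<bar>d::real\<bar>)\<^sup>2"
    and "\<bar>d / \<tau>\<bar> \<le> (1 + 2 / \<tau>0)\<^sup>2 * (1 + \<bar>d\<bar>)\<^sup>2"
    and "\<bar>d\<^sup>2 / \<tau>\<^sup>2 - 1 / \<tau>\<bar> \<le> (1 + 2 / \<tau>0)\<^sup>2 * (1 + \<bar>d\<bar>)\<^sup>2"
proof -
  have pos: "0 < \<tau>" using t by simp
  define a where "a = 2 / \<tau>0"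
  have a: "0 \<le> a" "1 / \<tau> \<le> a" "0 \<le> 1 / \<tau>" using t pos by (auto simp: a_def field_simps)
  have one: "1 \<le> (1 + a)\<^sup>2" "1 \<le> (1 + \<bar>d\<bar>)\<^sup>2" using a(1) by (intro one_le_power; simp)+
  thus "\<bar>1\<bar> \<le> (1 + 2 / \<tau>0)\<^sup>2 * (1 + \<bar>d::real\<bar>)\<^sup>2"
    using mult_mono[OF one] unfolding a_def by simp
  have a2: "a \<le> (1 + a)\<^sup>2" "\<bar>d\<bar> \<le> (1 + \<bar>d\<bar>)\<^sup>2" using a(1) zero_le_power2[of a] zero_le_power2[of d] by (auto simp: power2_sum)
  have "\<bar>d / \<tau>\<bar> = (1 / \<tau>) * \<bar>d\<bar>" using pos by (simp add: abs_divide)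
  also have "\<dots> \<le> (1 + a)\<^sup>2 * (1 + \<bar>d\<bar>)\<^sup>2" using a a2 by (intro mult_mono) auto
  finally show "\<bar>d / \<tau>\<bar> \<le> (1 + 2 / \<tau>0)\<^sup>2 * (1 + \<bar>d\<bar>)\<^sup>2" unfolding a_def .
  have "\<bar>d\<^sup>2 / \<tau>\<^sup>2 - 1 / \<tau>\<bar> \<le> d\<^sup>2 * (1 / \<tau>)\<^sup>2 + 1 / \<tau>"
    using a(3) abs_triangle_ineq4[of "d\<^sup>2 / \<tau>\<^sup>2" "1 / \<tau>"] by (simp add: power_divide)
  also have "\<dots> \<le> d\<^sup>2 * a\<^sup>2 + a" using a by (intro add_mono mult_left_mono power_mono) auto
  also have "\<dots> \<le> (1 + a)\<^sup>2 * (1 + \<bar>d\<bar>)\<^sup>2"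
  proof -
    have "(1 + a)\<^sup>2 * (1 + \<bar>d\<bar>)\<^sup>2 = d\<^sup>2 * a\<^sup>2 + a + (1 + a + 2 * \<bar>d\<bar> + 4 * a * \<bar>d\<bar> + d\<^sup>2 + 2 * a * d\<^sup>2 + a\<^sup>2 + 2 * a\<^sup>2 * \<bar>d\<bar>)"
      by (simp add: power2_eq_square algebra_simps)
    thus ?thesis using a(1) by simp
  qed
  finally show "\<bar>d\<^sup>2 / \<tau>\<^sup>2 - 1 / \<tau>\<bar> \<le> (1 + 2 / \<tau>0)\<^sup>2 * (1 + \<bar>d\<bar>)\<^sup>2" unfolding a_def .
qed

lemma heat_kernel_measurable [measurable]: "heat_kernel \<tau> \<in> borel_measurable borel"
  unfolding heat_kernel_def by simp

lemma heat_integrable: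
  assumes f: "poly_growth f" and t: "0 < \<tau>"
    and p: "\<And>t d. \<tau> / 2 \<le> t \<Longrightarrow> t \<le> 2 * \<tau> \<Longrightarrow> \<bar>p t d\<bar> \<le> B * (1 + \<bar>d\<bar>)\<^sup>2"
    and m: "p \<tau> \<in> borel_measurable borel"
  shows "integrable lborel (\<lambda>y. f y * (heat_kernel \<tau> (y - x) * p \<tau> (y - x)))"
proof -
  obtain g where g: "integrable lborel g" "\<And>s z y. \<tau> / 2 \<le> s \<Longrightarrow> s \<le> 2 * \<tau> \<Longrightarrow> \<bar>z - x\<bar> \<le> 1 \<Longrightarrow>
       \<bar>f y * (heat_kernel s (y - z) * p s (y - z))\<bar> \<le> g y"
    using heat_int_dominated[where p = p and B = B, OF f t p] by metis
  show ?thesis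
  proof (rule Bochner_Integration.integrable_bound[OF g(1)])
    show "(\<lambda>y. f y * (heat_kernel \<tau> (y - x) * p \<tau> (y - x))) \<in> borel_measurable lborel"
      using poly_growth_measurable[OF f] measurable_compose[OF _ m, of "\<lambda>y. y - x" borel] by simp
    show "AE y in lborel. norm (f y * (heat_kernel \<tau> (y - x) * p \<tau> (y - x))) \<le> norm (g y)"
    proof (intro AE_I2)
      fix y
      have "\<bar>f y * (heat_kernel \<tau> (y - x) * p \<tau> (y - x))\<bar> \<le> g y" using t by (intro g(2)) auto
      thus "norm (f y * (heat_kernel \<tau> (y - x) * p \<tau> (y - x))) \<le> norm (g y)" unfolding real_norm_def by linarith
    qed
  qed
qed

lemma heat_kernel_deriv_x:
  assumes "0 < \<tau>"
  shows "((\<lambda>x. heat_kernel \<tau> (y - x)) has_real_derivative heat_kernel \<tau> (y - x) * ((y - x) / \<tau>)) (at x)"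
proof -
  have "((\<lambda>x. - (y - x)\<^sup>2) has_real_derivative 2 * (y - x)) (at x)"
    by (auto intro!: derivative_eq_intros)
  from DERIV_cdivide[OF this, of "2 * \<tau>"]
  have "((\<lambda>x. - (y - x)\<^sup>2 / (2 * \<tau>)) has_real_derivative (y - x) / \<tau>) (at x)"
    by (simp only: mult_divide_mult_cancel_left_if) simp
  hence "((\<lambda>x. exp (- (y - x)\<^sup>2 / (2 * \<tau>))) has_real_derivative exp (- (y - x)\<^sup>2 / (2 * \<tau>)) * ((y - x) / \<tau>)) (at x)"
    by (rule DERIV_chain2[OF DERIV_exp])
  from DERIV_cdivide[OF this, of "sqrt (2 * pi * \<tau>)"] show ?thesis
    unfolding heat_kernel_def by (simp add: mult.commute)
qed

lemma heat_kernel_deriv_time: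
  assumes "0 < \<tau>"
  shows "((\<lambda>\<tau>. heat_kernel \<tau> d) has_real_derivative heat_kernel \<tau> d * ((d\<^sup>2 / \<tau>\<^sup>2 - 1 / \<tau>) / 2)) (at \<tau>)"
proof -
  have e: "sqrt (2 * pi * \<tau>) * sqrt (2 * pi * \<tau>) = 2 * pi * \<tau>" using assms by simp
  have sq: "((\<lambda>\<tau>. sqrt (2 * pi * \<tau>)) has_real_derivative 2 * pi / (2 * sqrt (2 * pi * \<tau>))) (at \<tau>)"
  proof -
    have "((\<lambda>\<tau>. sqrt (2 * pi * \<tau>)) has_real_derivative inverse (sqrt (2 * pi * \<tau>)) / 2 * (2 * pi)) (at \<tau>)"
      by (rule DERIV_chain2[OF DERIV_real_sqrt DERIV_cmult_Id]) (use assms in simp)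
    moreover have "inverse r / 2 * (2 * pi) = 2 * pi / (2 * r)" for r :: real
      by (simp add: inverse_eq_divide)
    ultimately show ?thesis by metis
  qed
  have "((\<lambda>\<tau>. - d\<^sup>2 / (2 * \<tau>)) has_real_derivative d\<^sup>2 / (2 * \<tau>\<^sup>2)) (at \<tau>)"
  proof -
    have "((\<lambda>\<tau>. (- d\<^sup>2 / 2) * inverse \<tau>) has_real_derivative (- d\<^sup>2 / 2) * - (inverse \<tau> ^ Suc (Suc 0))) (at \<tau>)"
      using assms by (intro DERIV_cmult DERIV_inverse) simp
    moreover have "(- d\<^sup>2 / 2) * - (inverse \<tau> ^ Suc (Suc 0)) = d\<^sup>2 / (2 * \<tau>\<^sup>2)"
      using assms by (simp add: power2_eq_square field_simps)
    moreover have "(\<lambda>\<tau>. (- d\<^sup>2 / 2) * inverse \<tau>) = (\<lambda>\<tau>. - d\<^sup>2 / (2 * \<tau>))"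
      by (simp add: inverse_eq_divide)
    ultimately show ?thesis by (simp only:)
  qed
  hence ex: "((\<lambda>\<tau>. exp (- d\<^sup>2 / (2 * \<tau>))) has_real_derivative exp (- d\<^sup>2 / (2 * \<tau>)) * (d\<^sup>2 / (2 * \<tau>\<^sup>2))) (at \<tau>)"
    by (rule DERIV_chain2[OF DERIV_exp])
  have "((\<lambda>\<tau>. exp (- d\<^sup>2 / (2 * \<tau>)) / sqrt (2 * pi * \<tau>)) has_real_derivative
     (exp (- d\<^sup>2 / (2 * \<tau>)) * (d\<^sup>2 / (2 * \<tau>\<^sup>2)) * sqrt (2 * pi * \<tau>) - exp (- d\<^sup>2 / (2 * \<tau>)) * (2 * pi / (2 * sqrt (2 * pi * \<tau>))))
       / (sqrt (2 * pi * \<tau>) * sqrt (2 * pi * \<tau>))) (at \<tau>)"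
    by (rule DERIV_divide[OF ex sq]) (use assms in simp)
  moreover have "(exp (- d\<^sup>2 / (2 * \<tau>)) * (d\<^sup>2 / (2 * \<tau>\<^sup>2)) * sqrt (2 * pi * \<tau>) - exp (- d\<^sup>2 / (2 * \<tau>)) * (2 * pi / (2 * sqrt (2 * pi * \<tau>))))
       / (sqrt (2 * pi * \<tau>) * sqrt (2 * pi * \<tau>)) = heat_kernel \<tau> d * ((d\<^sup>2 / \<tau>\<^sup>2 - 1 / \<tau>) / 2)"
  proof -
    \<comment> \<open>Expressing \<open>2 * pi\<close> through \<open>S\<close> turns the identity
      into one between rational functions of \<open>S\<close> and \<open>\<tau>\<close>.\<close>
    define S where "S = sqrt (2 * pi * \<tau>)"
    have S: "0 < S" "2 * pi = S * S / \<tau>" using e assms by (auto simp: S_def)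
    show ?thesis unfolding heat_kernel_def S_def[symmetric] S(2)
      using S(1) assms by (simp add: field_simps power2_eq_square)
  qed
  ultimately show ?thesis unfolding heat_kernel_def by simp
qed

lemma heat0_deriv_x:
  assumes f: "poly_growth f" and t: "0 < \<tau>"
  shows "((\<lambda>x. heat0 f \<tau> x) has_real_derivative heat1 f \<tau> x) (at x)"
proof -
  obtain g where g: "integrable lborel g" "\<And>s z y. \<tau> / 2 \<le> s \<Longrightarrow> s \<le> 2 * \<tau> \<Longrightarrow> \<bar>z - x\<bar> \<le> 1 \<Longrightarrow>
       \<bar>f y * (heat_kernel s (y - z) * ((y - z) / s))\<bar> \<le> g y"
    using heat_int_dominated[where p = "\<lambda>\<tau> d. d / \<tau>", OF f t heat_weight_bounds(2)[OF t]] by metis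
  show ?thesis unfolding heat_int_def
  proof (rule has_derivative_integral_dominated[where d = 1 and g = g])
    fix z y
    show "integrable lborel (\<lambda>y. f y * (heat_kernel \<tau> (y - z) * 1))"
      by (rule heat_integrable[where p = "\<lambda>\<tau> d. 1", OF f t heat_weight_bounds(1)[OF t]]) auto
    show "((\<lambda>x. f y * (heat_kernel \<tau> (y - x) * 1)) has_real_derivative f y * (heat_kernel \<tau> (y - z) * ((y - z) / \<tau>))) (at z)"
      using DERIV_cmult[OF heat_kernel_deriv_x[OF t, of y z], of "f y"] by simp
  qed (use g t poly_growth_measurable[OF f] in auto)
qed

lemma heat1_deriv_x:
  assumes f: "poly_growth f" and t: "0 < \<tau>"
  shows "((\<lambda>x. heat1 f \<tau> x) has_real_derivative heat2 f \<tau> x) (at x)"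
proof -
  obtain g where g: "integrable lborel g" "\<And>s z y. \<tau> / 2 \<le> s \<Longrightarrow> s \<le> 2 * \<tau> \<Longrightarrow> \<bar>z - x\<bar> \<le> 1 \<Longrightarrow>
       \<bar>f y * (heat_kernel s (y - z) * ((y - z)\<^sup>2 / s\<^sup>2 - 1 / s))\<bar> \<le> g y"
    using heat_int_dominated[where p = "\<lambda>\<tau> d. d\<^sup>2 / \<tau>\<^sup>2 - 1 / \<tau>", OF f t heat_weight_bounds(3)[OF t]] by metis
  show ?thesis unfolding heat_int_def
  proof (rule has_derivative_integral_dominated[where d = 1 and g = g])
    fix z y
    show "integrable lborel (\<lambda>y. f y * (heat_kernel \<tau> (y - z) * ((y - z) / \<tau>)))"
      by (rule heat_integrable[where p = "\<lambda>\<tau> d. d / \<tau>", OF f t heat_weight_bounds(2)[OF t]]) auto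
    have "((\<lambda>x. heat_kernel \<tau> (y - x) * ((y - x) / \<tau>)) has_real_derivative
      heat_kernel \<tau> (y - z) * ((y - z) / \<tau>) * ((y - z) / \<tau>) + heat_kernel \<tau> (y - z) * (- 1 / \<tau>)) (at z)"
      using t by (auto intro!: derivative_eq_intros heat_kernel_deriv_x simp: diff_divide_distrib)
    moreover have "h * ((y - z) / \<tau>) * ((y - z) / \<tau>) + h * (- 1 / \<tau>) = h * ((y - z)\<^sup>2 / \<tau>\<^sup>2 - 1 / \<tau>)" for h
    proof -
      have "h * (a / \<tau>) * (a / \<tau>) + h * (- 1 / \<tau>) = h * (a\<^sup>2 / \<tau>\<^sup>2 - 1 / \<tau>)" for a
        by (simp add: power2_eq_square right_diff_distrib)
      thus ?thesis .
    qed
    ultimately have "((\<lambda>x. heat_kernel \<tau> (y - x) * ((y - x) / \<tau>)) has_real_derivative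
       heat_kernel \<tau> (y - z) * ((y - z)\<^sup>2 / \<tau>\<^sup>2 - 1 / \<tau>)) (at z)" by metis
    from DERIV_cmult[OF this, of "f y"] 
    show "((\<lambda>x. f y * (heat_kernel \<tau> (y - x) * ((y - x) / \<tau>))) has_real_derivative
       f y * (heat_kernel \<tau> (y - z) * ((y - z)\<^sup>2 / \<tau>\<^sup>2 - 1 / \<tau>))) (at z)"
      by simp
  qed (use g t poly_growth_measurable[OF f] in auto)
qed

text \<open>The heat equation: the derivative of the kernel in the variance is half its second space
  derivative.\<close>

lemma heat0_deriv_time:
  assumes f: "poly_growth f" and t: "0 < \<tau>"
  shows "((\<lambda>\<tau>. heat0 f \<tau> x) has_real_derivative heat2 f \<tau> x / 2) (at \<tau>)"
proof -
  obtain g where g: "integrable lborel g" "\<And>s z y. \<tau> / 2 \<le> s \<Longrightarrow> s \<le> 2 * \<tau> \<Longrightarrow> \<bar>z - x\<bar> \<le> 1 \<Longrightarrow>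
       \<bar>f y * (heat_kernel s (y - z) * ((y - z)\<^sup>2 / s\<^sup>2 - 1 / s))\<bar> \<le> g y"
    using heat_int_dominated[where p = "\<lambda>\<tau> d. d\<^sup>2 / \<tau>\<^sup>2 - 1 / \<tau>", OF f t heat_weight_bounds(3)[OF t]] by metis
  have "((\<lambda>\<tau>. heat0 f \<tau> x) has_real_derivative
      (\<integral>y. f y * (heat_kernel \<tau> (y - x) * (((y - x)\<^sup>2 / \<tau>\<^sup>2 - 1 / \<tau>) / 2)) \<partial>lborel)) (at \<tau>)"
    unfolding heat_int_def
  proof (rule has_derivative_integral_dominated[where d = "\<tau> / 2" and g = g])
    fix s y assume s: "\<bar>s - \<tau>\<bar> < \<tau> / 2"
    hence s': "0 < s" "\<tau> / 2 \<le> s" "s \<le> 2 * \<tau>" by linarith+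
    show "integrable lborel (\<lambda>y. f y * (heat_kernel s (y - x) * 1))"
      by (rule heat_integrable[where p = "\<lambda>\<tau> d. 1", OF f s'(1) heat_weight_bounds(1)[OF s'(1)]]) auto
    show "((\<lambda>s. f y * (heat_kernel s (y - x) * 1)) has_real_derivative
       f y * (heat_kernel s (y - x) * (((y - x)\<^sup>2 / s\<^sup>2 - 1 / s) / 2))) (at s)"
      using DERIV_cmult[OF heat_kernel_deriv_time[OF s'(1), of "y - x"], of "f y"] by simp
    have "\<bar>f y * (heat_kernel s (y - x) * (((y - x)\<^sup>2 / s\<^sup>2 - 1 / s) / 2))\<bar> 
        = \<bar>f y * (heat_kernel s (y - x) * ((y - x)\<^sup>2 / s\<^sup>2 - 1 / s))\<bar> / 2"
      by (simp add: abs_mult)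
    also have "\<dots> \<le> g y" using g(2)[OF s'(2,3), of x y] by simp
    finally show "\<bar>f y * (heat_kernel s (y - x) * (((y - x)\<^sup>2 / s\<^sup>2 - 1 / s) / 2))\<bar> \<le> g y" .
  qed (use g t poly_growth_measurable[OF f] in auto)
  also have "(\<lambda>y. f y * (heat_kernel \<tau> (y - x) * (((y - x)\<^sup>2 / \<tau>\<^sup>2 - 1 / \<tau>) / 2)))
     = (\<lambda>y. f y * (heat_kernel \<tau> (y - x) * ((y - x)\<^sup>2 / \<tau>\<^sup>2 - 1 / \<tau>)) / 2)" by simp
  finally show ?thesis unfolding heat_int_def by simp
qed

section \<open>Joint continuity in variance and position\<close>

lemma heat_int_isCont:
  assumes f: "poly_growth f" and t: "0 < \<tau>0"
    and p: "\<And>t d. \<tau>0 / 2 \<le> t \<Longrightarrow> t \<le> 2 * \<tau>0 \<Longrightarrow> \<bar>p t d\<bar> \<le> B * (1 + \<bar>d\<bar>)\<^sup>2"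
    and m: "\<And>\<tau>. p \<tau> \<in> borel_measurable borel"
    and c: "\<And>y. isCont (\<lambda>q. p (fst q) (y - snd q)) (\<tau>0, x0)"
  shows "isCont (\<lambda>q. heat_int p f (fst q) (snd q)) (\<tau>0, x0)"
proof -
  obtain g where g: "integrable lborel g" "\<And>s z y. \<tau>0 / 2 \<le> s \<Longrightarrow> s \<le> 2 * \<tau>0 \<Longrightarrow> \<bar>z - x0\<bar> \<le> 1 \<Longrightarrow>
       \<bar>f y * (heat_kernel s (y - z) * p s (y - z))\<bar> \<le> g y"
    using heat_int_dominated[where p = p and B = B, OF f t p] by metis
  have open1: "open ({\<tau>0 / 2 <..< 2 * \<tau>0} \<times> {x0 - 1 <..< x0 + 1})" by (intro open_Times) auto
  show ?thesis unfolding heat_int_def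
  proof (rule isCont_integral_dominated[where g = g and P = "\<lambda>q. q \<in> {\<tau>0 / 2 <..< 2 * \<tau>0} \<times> {x0 - 1 <..< x0 + 1}"])
    show "\<forall>\<^sub>F q in nhds (\<tau>0, x0). q \<in> {\<tau>0 / 2 <..< 2 * \<tau>0} \<times> {x0 - 1 <..< x0 + 1}"
      using t by (intro eventually_nhds_in_open open1) auto
    show "(\<lambda>y. f y * (heat_kernel (fst q) (y - snd q) * p (fst q) (y - snd q))) \<in> borel_measurable borel" for q
      using poly_growth_measurable[OF f] measurable_compose[OF _ m, of "\<lambda>y. y - snd q" borel "fst q"] by simp
    show "isCont (\<lambda>q. f y * (heat_kernel (fst q) (y - snd q) * p (fst q) (y - snd q))) (\<tau>0, x0)" for y
      unfolding heat_kernel_def using t by (intro continuous_intros c) auto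
  qed (use g in auto)
qed

lemma heat_continuous_on:
  assumes f: "poly_growth f"
  shows "continuous_on ({0<..} \<times> UNIV) (\<lambda>q. heat0 f (fst q) (snd q))"
    and "continuous_on ({0<..} \<times> UNIV) (\<lambda>q. heat1 f (fst q) (snd q))"
    and "continuous_on ({0<..} \<times> UNIV) (\<lambda>q. heat2 f (fst q) (snd q))"
proof -
  have "isCont (\<lambda>q. heat0 f (fst q) (snd q)) q \<and> isCont (\<lambda>q. heat1 f (fst q) (snd q)) q
      \<and> isCont (\<lambda>q. heat2 f (fst q) (snd q)) q" if "q \<in> {0<..} \<times> UNIV" for q
  proof (cases q)
    case (Pair \<tau> x)
    with that have t: "0 < \<tau>" by simp
    show ?thesis unfolding Pair
    proof (intro conjI)
      show "isCont (\<lambda>q. heat0 f (fst q) (snd q)) (\<tau>, x)"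
        by (rule heat_int_isCont[where p = "\<lambda>\<tau> d. 1", OF f t heat_weight_bounds(1)[OF t]]) auto
      show "isCont (\<lambda>q. heat1 f (fst q) (snd q)) (\<tau>, x)"
      proof (rule heat_int_isCont[where p = "\<lambda>\<tau> d. d / \<tau>", OF f t heat_weight_bounds(2)[OF t]])
        show "isCont (\<lambda>q. (y - snd q) / fst q) (\<tau>, x)" for y
          using t by (intro continuous_intros) auto
      qed auto
      show "isCont (\<lambda>q. heat2 f (fst q) (snd q)) (\<tau>, x)"
      proof (rule heat_int_isCont[where p = "\<lambda>\<tau> d. d\<^sup>2 / \<tau>\<^sup>2 - 1 / \<tau>", OF f t heat_weight_bounds(3)[OF t]])
        show "isCont (\<lambda>q. (y - snd q)\<^sup>2 / (fst q)\<^sup>2 - 1 / fst q) (\<tau>, x)" for y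
          using t by (intro continuous_intros) auto
      qed auto
    qed
  qed
  thus "continuous_on ({0<..} \<times> UNIV) (\<lambda>q. heat0 f (fst q) (snd q))"
    and "continuous_on ({0<..} \<times> UNIV) (\<lambda>q. heat1 f (fst q) (snd q))"
    and "continuous_on ({0<..} \<times> UNIV) (\<lambda>q. heat2 f (fst q) (snd q))"
    by (auto intro!: continuous_at_imp_continuous_on)
qed

section \<open>Size of the second derivative and consistency of a heat step\<close>

lemma heat2_eq:
  assumes "poly_growth f" "0 < \<tau>"
  shows "heat2 f \<tau> x = (\<integral>z. f (x + sqrt \<tau> * z) * (z\<^sup>2 - 1) \<partial>gauss) / \<tau>"
proof -
  have "heat2 f \<tau> x = (\<integral>z. f (x + sqrt \<tau> * z) * ((sqrt \<tau> * z)\<^sup>2 / \<tau>\<^sup>2 - 1 / \<tau>) \<partial>gauss)"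
    using assms(2) poly_growth_measurable[OF assms(1)] by (intro heat_int_eq_gavg) auto
  also have "(\<lambda>z. f (x + sqrt \<tau> * z) * ((sqrt \<tau> * z)\<^sup>2 / \<tau>\<^sup>2 - 1 / \<tau>)) = (\<lambda>z. f (x + sqrt \<tau> * z) * (z\<^sup>2 - 1) / \<tau>)"
    using assms by (intro ext) (simp add: power_mult_distrib power2_eq_square field_simps)
  finally show ?thesis by simp
qed

lemma heat2_diff:
  assumes f: "poly_growth f" and g: "poly_growth g" and t: "0 < \<tau>"
  shows "heat2 (\<lambda>y. f y - g y) \<tau> x = heat2 f \<tau> x - heat2 g \<tau> x"
proof -
  have "(\<integral>z. (f (x + sqrt \<tau> * z) - g (x + sqrt \<tau> * z)) * (z\<^sup>2 - 1) \<partial>gauss)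
     = (\<integral>z. f (x + sqrt \<tau> * z) * (z\<^sup>2 - 1) \<partial>gauss) - (\<integral>z. g (x + sqrt \<tau> * z) * (z\<^sup>2 - 1) \<partial>gauss)"
    unfolding left_diff_distrib[of "f _"]
    by (intro Bochner_Integration.integral_diff integrable_poly_growth poly_growth_mult
        poly_growth_compose[OF f] poly_growth_compose[OF g]) (intro poly_growth_intros)+
  thus ?thesis using t poly_growth_diff[OF f g] f g by (simp add: heat2_eq diff_divide_distrib)
qed

definition hess_const :: "nat \<Rightarrow> real" where
  "hess_const k = 2 ^ k * wt k 1 * wt_moment (k + 2)"

lemma hess_const_nonneg: "0 \<le> hess_const k"
  by (simp add: hess_const_def wt_moment_nonneg)

text \<open>After rescaling, the second derivative is the mean of \<open>f\<close> against the
  Hermite polynomial \<open>z\<^sup>2 - 1\<close>, divided by \<open>\<tau>\<close>. Only the size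
  of \<open>f\<close> enters, which later allows the estimate to be applied to small differences;
  the polynomial raises the required moment from \<open>k\<close> to \<open>k + 2\<close>.\<close>

lemma abs_heat2_le:
  assumes f: "poly_growth f" "\<And>y. \<bar>f y\<bar> \<le> A * wt k y" and t: "0 < \<tau>" "\<tau> \<le> 1"
  shows "\<bar>heat2 f \<tau> x\<bar> \<le> A * hess_const k / \<tau> * wt k x"
proof -
  have A: "0 \<le> A" using f(2)[of 0] by (simp add: wt_def)
  have "\<bar>\<integral>z. f (x + sqrt \<tau> * z) * (z\<^sup>2 - 1) \<partial>gauss\<bar> \<le> (\<integral>z. A * (2 ^ k * (wt k x * wt k 1)) * wt (k + 2) z \<partial>gauss)"
  proof (rule abs_integral_gauss_le)
    fix z
    have "wt k (x + sqrt \<tau> * z) \<le> 2 ^ k * (wt k x * wt k (sqrt \<tau> * z))" by (rule wt_add_le)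
    also have "\<dots> \<le> 2 ^ k * (wt k x * (wt k 1 * wt k z))"
    proof (intro mult_left_mono)
      have "wt k (sqrt \<tau> * z) \<le> wt k z"
        using t by (intro wt_abs_mono) (auto simp: abs_mult intro!: mult_left_le_one_le)
      also have "\<dots> \<le> wt k 1 * wt k z" using mult_right_mono[OF wt_ge_1[of k 1], of "wt k z"] by simp
      finally show "wt k (sqrt \<tau> * z) \<le> wt k 1 * wt k z" .
    qed auto
    finally have w: "wt k (x + sqrt \<tau> * z) \<le> 2 ^ k * (wt k x * (wt k 1 * wt k z))" .
    have "\<bar>f (x + sqrt \<tau> * z)\<bar> \<le> A * (2 ^ k * (wt k x * (wt k 1 * wt k z)))"
      by (rule order_trans[OF f(2)]) (intro mult_left_mono w A)
    moreover have "\<bar>z\<^sup>2 - 1\<bar> \<le> wt 2 z" by (simp add: wt_2 abs_le_iff)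
    ultimately have "\<bar>f (x + sqrt \<tau> * z) * (z\<^sup>2 - 1)\<bar> \<le> A * (2 ^ k * (wt k x * (wt k 1 * wt k z))) * wt 2 z"
      unfolding abs_mult using A by (intro mult_mono) auto
    thus "\<bar>f (x + sqrt \<tau> * z) * (z\<^sup>2 - 1)\<bar> \<le> A * (2 ^ k * (wt k x * wt k 1)) * wt (k + 2) z"
      unfolding wt_add by (simp add: mult_ac)
  next
    show "poly_growth (\<lambda>z. f (x + sqrt \<tau> * z) * (z\<^sup>2 - 1))"
      by (intro poly_growth_mult poly_growth_compose[OF f(1)]) (intro poly_growth_intros)+
  qed (intro poly_growth_intros)
  also have "\<dots> = A * hess_const k * wt k x"
    by (simp add: hess_const_def wt_moment_def)
  finally show ?thesis using t f by (simp add: heat2_eq abs_divide divide_right_mono)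
qed

lemma poly_growth_gavg:
  assumes "wlip C k f" "0 \<le> s" shows "poly_growth (gavg s f)"
proof -
  obtain c where c: "wt_rate k s c" using wt_rate_exists assms(2) by blast
  show ?thesis by (rule wlip_poly_growth[OF wlip_gavg[OF assms(1) c assms(2) order_refl]])
qed

lemma heat0_shift:
  assumes f: "wlip C k f" and t: "0 < \<tau>" "0 \<le> \<xi>"
  shows "heat0 f (\<tau> + \<xi>) x = heat0 (gavg (sqrt \<xi>) f) \<tau> x"
proof -
  have pf: "poly_growth f" by (rule wlip_poly_growth[OF f])
  have pg: "poly_growth (gavg (sqrt \<xi>) f)" using t by (intro poly_growth_gavg[OF f]) simp
  show ?thesis using t pf pg gavg_semigroup[OF pf, of "sqrt \<tau>" "sqrt \<xi>" x]
    by (simp add: heat0_eq_gavg poly_growth_measurable)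
qed

text \<open>Differentiating the semigroup identity twice in space, with uniqueness of derivatives.
  Second derivatives at two different variances thereby become second derivatives at the same
  variance of two different functions.\<close>

lemma heat2_shift:
  assumes f: "wlip C k f" and t: "0 < \<tau>" "0 \<le> \<xi>"
  shows "heat2 f (\<tau> + \<xi>) x = heat2 (gavg (sqrt \<xi>) f) \<tau> x"
proof -
  have pf: "poly_growth f" by (rule wlip_poly_growth[OF f])
  have pg: "poly_growth (gavg (sqrt \<xi>) f)" using t by (intro poly_growth_gavg[OF f]) simp
  have t': "0 < \<tau> + \<xi>" using t by simp
  have 0: "heat0 f (\<tau> + \<xi>) = heat0 (gavg (sqrt \<xi>) f) \<tau>"
    by (rule ext, rule heat0_shift[OF f t])
  have "heat1 f (\<tau> + \<xi>) y = heat1 (gavg (sqrt \<xi>) f) \<tau> y" for y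
    using heat0_deriv_x[OF pf t', of y] heat0_deriv_x[OF pg t(1), of y] unfolding 0 by (rule DERIV_unique)
  hence 1: "heat1 f (\<tau> + \<xi>) = heat1 (gavg (sqrt \<xi>) f) \<tau>" by (rule ext)
  show ?thesis
    using heat1_deriv_x[OF pf t', of x] heat1_deriv_x[OF pg t(1), of x] unfolding 1 by (rule DERIV_unique)
qed

definition approx_const :: "nat \<Rightarrow> real \<Rightarrow> real" where
  "approx_const k S = 2 ^ k * (wt k S + 1) * wt_moment (k + 1)"

lemma approx_const_nonneg: "0 \<le> approx_const k S"
  by (simp add: approx_const_def wt_moment_nonneg add_nonneg_nonneg)

text \<open>The mean value theorem gives the exact second derivative at an intermediate variance
  \<open>\<tau> + \<xi>\<close>. By \<open>heat2_shift\<close> its deviation from the one at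
  \<open>\<tau>\<close> is the second derivative of the flow of
  \<open>gavg (sqrt \<xi>) f - f\<close>, a function of order \<open>r\<close>, and
  \<open>abs_heat2_le\<close> bounds it by order \<open>r / \<tau>\<close>.\<close>

lemma heat_consistency:
  assumes f: "wlip C k f" and t: "0 < \<tau>" "\<tau> \<le> 1" and r: "0 \<le> r" "r \<le> S"
  shows "\<bar>gavg (sqrt (\<tau> + r\<^sup>2)) f x - gavg (sqrt \<tau>) f x - r\<^sup>2 / 2 * heat2 f \<tau> x\<bar>
     \<le> r\<^sup>2 / 2 * (C * approx_const k S * r * hess_const k / \<tau> * wt k x)"
proof (cases "r = 0")
  case False
  have r0: "0 < r\<^sup>2" using False by simp
  have C: "0 \<le> C" by (rule wlip_nonneg[OF f])
  have pf: "poly_growth f" by (rule wlip_poly_growth[OF f])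
  have "\<exists>z>\<tau>. z < \<tau> + r\<^sup>2 \<and> heat0 f (\<tau> + r\<^sup>2) x - heat0 f \<tau> x = (\<tau> + r\<^sup>2 - \<tau>) * (heat2 f z x / 2)"
    using r0 t by (intro MVT2 heat0_deriv_time pf) auto
  then obtain z where z: "\<tau> < z" "z < \<tau> + r\<^sup>2" 
    "heat0 f (\<tau> + r\<^sup>2) x - heat0 f \<tau> x = r\<^sup>2 / 2 * heat2 f z x" by auto
  define \<xi> where "\<xi> = z - \<tau>"
  have \<xi>: "0 \<le> \<xi>" "\<xi> \<le> r\<^sup>2" "z = \<tau> + \<xi>" using z by (auto simp: \<xi>_def)
  have s\<xi>: "0 \<le> sqrt \<xi>" "sqrt \<xi> \<le> r" using \<xi> r real_sqrt_le_mono[OF \<xi>(2)] by auto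
  have pg: "poly_growth (gavg (sqrt \<xi>) f)" by (rule poly_growth_gavg[OF f s\<xi>(1)])
  have "heat2 f z x - heat2 f \<tau> x = heat2 (\<lambda>y. gavg (sqrt \<xi>) f y - f y) \<tau> x"
    unfolding \<xi>(3) heat2_shift[OF f t(1) \<xi>(1)] by (rule heat2_diff[OF pg pf t(1), symmetric])
  also have "\<bar>\<dots>\<bar> \<le> C * approx_const k S * r * hess_const k / \<tau> * wt k x"
  proof (rule abs_heat2_le[OF poly_growth_diff[OF pg pf] _ t])
    fix y
    have "\<bar>gavg (sqrt \<xi>) f y - f y\<bar> \<le> C * approx_const k S * sqrt \<xi> * wt k y"
      unfolding approx_const_def using s\<xi> r by (intro gavg_approx[OF f]) auto
    also have "\<dots> \<le> C * approx_const k S * r * wt k y"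
      using C s\<xi> approx_const_nonneg by (intro mult_right_mono mult_left_mono mult_nonneg_nonneg) auto
    finally show "\<bar>gavg (sqrt \<xi>) f y - f y\<bar> \<le> C * approx_const k S * r * wt k y" .
  qed
  finally have "r\<^sup>2 / 2 * \<bar>heat2 f z x - heat2 f \<tau> x\<bar> \<le> r\<^sup>2 / 2 * (C * approx_const k S * r * hess_const k / \<tau> * wt k x)"
    by (intro mult_left_mono) auto
  moreover have "gavg (sqrt (\<tau> + r\<^sup>2)) f x - gavg (sqrt \<tau>) f x - r\<^sup>2 / 2 * heat2 f \<tau> x
     = r\<^sup>2 / 2 * (heat2 f z x - heat2 f \<tau> x)"
    using z(3) t r0 poly_growth_measurable[OF pf] by (simp add: heat0_eq_gavg right_diff_distrib)
  ultimately show ?thesis by (simp only: abs_mult) simp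
qed simp

section \<open>Comparison with smooth supersolutions\<close>

lemma C12_stripI:
  assumes "\<And>t x. 0 < t \<Longrightarrow> t < 1 \<Longrightarrow> ((\<lambda>s. \<psi> s x) has_real_derivative \<psi>t t x) (at t)"
    and "\<And>t x. 0 < t \<Longrightarrow> t < 1 \<Longrightarrow> (\<psi> t has_real_derivative \<psi>x t x) (at x)"
    and "\<And>t x. 0 < t \<Longrightarrow> t < 1 \<Longrightarrow> (\<psi>x t has_real_derivative \<psi>xx t x) (at x)"
    and "continuous_on ({0<..<1} \<times> UNIV) (\<lambda>q. \<psi> (fst q) (snd q))"
    and "continuous_on ({0<..<1} \<times> UNIV) (\<lambda>q. \<psi>t (fst q) (snd q))"
    and "continuous_on ({0<..<1} \<times> UNIV) (\<lambda>q. \<psi>x (fst q) (snd q))"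
    and "continuous_on ({0<..<1} \<times> UNIV) (\<lambda>q. \<psi>xx (fst q) (snd q))"
  shows "C12_strip \<psi> \<psi>t \<psi>x \<psi>xx"
  using assms unfolding C12_strip_def by (simp add: case_prod_beta)

lemma C12_stripD:
  assumes "C12_strip \<psi> \<psi>t \<psi>x \<psi>xx"
  shows "\<And>t x. 0 < t \<Longrightarrow> t < 1 \<Longrightarrow> ((\<lambda>s. \<psi> s x) has_real_derivative \<psi>t t x) (at t)"
    and "\<And>t x. 0 < t \<Longrightarrow> t < 1 \<Longrightarrow> (\<psi> t has_real_derivative \<psi>x t x) (at x)"
    and "\<And>t x. 0 < t \<Longrightarrow> t < 1 \<Longrightarrow> (\<psi>x t has_real_derivative \<psi>xx t x) (at x)"
    and "continuous_on ({0<..<1} \<times> UNIV) (\<lambda>q. \<psi> (fst q) (snd q))"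
    and "continuous_on ({0<..<1} \<times> UNIV) (\<lambda>q. \<psi>t (fst q) (snd q))"
    and "continuous_on ({0<..<1} \<times> UNIV) (\<lambda>q. \<psi>x (fst q) (snd q))"
    and "continuous_on ({0<..<1} \<times> UNIV) (\<lambda>q. \<psi>xx (fst q) (snd q))"
  using assms unfolding C12_strip_def by (simp_all add: case_prod_beta)

lemma C12_strip_add:
  assumes "C12_strip \<psi> \<psi>t \<psi>x \<psi>xx" "C12_strip \<xi> \<xi>t \<xi>x \<xi>xx"
  shows "C12_strip (\<lambda>t x. \<psi> t x + \<xi> t x) (\<lambda>t x. \<psi>t t x + \<xi>t t x) (\<lambda>t x. \<psi>x t x + \<xi>x t x) (\<lambda>t x. \<psi>xx t x + \<xi>xx t x)"
  by (intro C12_stripI DERIV_add continuous_on_add C12_stripD[OF assms(1)] C12_stripD[OF assms(2)])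

lemma C12_strip_minus:
  assumes "C12_strip \<psi> \<psi>t \<psi>x \<psi>xx"
  shows "C12_strip (\<lambda>t x. - \<psi> t x) (\<lambda>t x. - \<psi>t t x) (\<lambda>t x. - \<psi>x t x) (\<lambda>t x. - \<psi>xx t x)"
  by (intro C12_stripI DERIV_minus continuous_on_minus C12_stripD[OF assms(1)])

lemma C12_strip_prod:
  fixes \<alpha> g :: "real \<Rightarrow> real"
  assumes "\<And>t. (\<alpha> has_real_derivative \<alpha>' t) (at t)" "continuous_on UNIV \<alpha>'"
    and "\<And>x. (g has_real_derivative g' x) (at x)" "\<And>x. (g' has_real_derivative g'' x) (at x)" "continuous_on UNIV g''"
  shows "C12_strip (\<lambda>t x. \<alpha> t * g x) (\<lambda>t x. \<alpha>' t * g x) (\<lambda>t x. \<alpha> t * g' x) (\<lambda>t x. \<alpha> t * g'' x)"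
proof -
  have c: "continuous_on UNIV \<alpha>" "continuous_on UNIV g" "continuous_on UNIV g'"
    using assms(1,3,4) by (auto intro!: continuous_at_imp_continuous_on DERIV_isCont)
  show ?thesis
    by (intro C12_stripI DERIV_cmult_right DERIV_cmult continuous_on_mult assms
        continuous_on_compose2[OF c(1)] continuous_on_compose2[OF c(2)] continuous_on_compose2[OF c(3)]
        continuous_on_compose2[OF assms(2)] continuous_on_compose2[OF assms(5)]
        continuous_on_fst continuous_on_snd continuous_on_id) auto
qed

text \<open>It serves two purposes. With a small factor and a higher exponent it confines maxima to
  a compact set; with the exponent of the estimate it absorbs the errors of approximate
  supersolutions, since it grows backwards in time.\<close>

definition barrier :: "real \<Rightarrow> nat \<Rightarrow> real \<Rightarrow> real \<Rightarrow> real" where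
  "barrier l k t x = exp (l * (1 - t)) * wt k x"

lemma exp_backward_deriv: "((\<lambda>t. exp (l * (c - t))) has_real_derivative - l * exp (l * (c - t))) (at t)"
  by (auto intro!: derivative_eq_intros)

lemma C12_strip_barrier:
  "C12_strip (\<lambda>t x. \<delta> * barrier l k t x) (\<lambda>t x. \<delta> * (- l * barrier l k t x))
     (\<lambda>t x. \<delta> * exp (l * (1 - t)) * wt' k x) (\<lambda>t x. \<delta> * exp (l * (1 - t)) * wt'' k x)"
proof -
  have "C12_strip (\<lambda>t x. (\<delta> * exp (l * (1 - t))) * wt k x) (\<lambda>t x. (\<delta> * (- l * exp (l * (1 - t)))) * wt k x)
     (\<lambda>t x. (\<delta> * exp (l * (1 - t))) * wt' k x) (\<lambda>t x. (\<delta> * exp (l * (1 - t))) * wt'' k x)"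
    by (intro C12_strip_prod DERIV_cmult exp_backward_deriv wt_has_derivative wt'_has_derivative
        continuous_intros)
  thus ?thesis by (simp add: barrier_def mult.assoc)
qed

lemma barrier_ge: "0 \<le> l \<Longrightarrow> t \<le> 1 \<Longrightarrow> wt k x \<le> barrier l k t x"
  using mult_right_mono[of 1 "exp (l * (1 - t))" "wt k x"] by (simp add: barrier_def)

lemma barrier_le: "0 \<le> l \<Longrightarrow> 0 \<le> t \<Longrightarrow> barrier l k t x \<le> exp l * wt k x"
  unfolding barrier_def by (intro mult_right_mono) (auto simp: algebra_simps)

definition barrier_rate :: "nat \<Rightarrow> real \<Rightarrow> real" where
  "barrier_rate k L = 1 + L * ((real k + 1)\<^sup>2 * 2)"

lemma barrier_rate_nonneg: "0 \<le> L \<Longrightarrow> 0 \<le> barrier_rate k L"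
  by (simp add: barrier_rate_def)

text \<open>In the rate, the multiple of \<open>L\<close> pays for the second derivative of the
  weight, and the summand 1 leaves a strictly negative remainder. This strictness produces the
  contradiction in the comparison argument and the room for error terms elsewhere.\<close>

lemma barrier_supersolution:
  assumes "0 \<le> L"
  shows "- barrier_rate k L * barrier (barrier_rate k L) k t x + L * \<bar>exp (barrier_rate k L * (1 - t)) * wt'' k x\<bar>
     \<le> - barrier (barrier_rate k L) k t x"
proof -
  let ?e = "exp (barrier_rate k L * (1 - t))"
  have "L * \<bar>?e * wt'' k x\<bar> = L * ?e * \<bar>wt'' k x\<bar>" by (simp add: abs_mult)
  also have "\<dots> \<le> L * ?e * ((real k + 1)\<^sup>2 * 2 * wt k x)"
    using assms by (intro mult_left_mono abs_wt''_le) auto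
  also have "\<dots> = (barrier_rate k L - 1) * barrier (barrier_rate k L) k t x"
    by (simp add: barrier_rate_def barrier_def)
  finally show ?thesis by (simp add: algebra_simps)
qed

text \<open>As \<open>W\<close> is smooth, it can be used as a test function itself, and no doubling
  of variables is required. If \<open>u\<close> exceeded \<open>W\<close> at an interior point, then
  \<open>u\<close> minus a perturbed \<open>W\<close> would have a positive maximum at an interior
  time, where the perturbed \<open>W\<close> is a strict supersolution, contrary to the subsolution
  property. The perturbation has a barrier, which handles infinity, and a penalty in time, which
  keeps the maximum away from the initial time \<open>a\<close>, where no inequality between
  \<open>u\<close> and \<open>W\<close> is given.\<close>

lemma viscosity_comparison:
  fixes u W :: "real \<Rightarrow> real \<Rightarrow> real"
  assumes L: "0 \<le> L" and F: "\<And>p q. F (p + q) \<le> F p + L * \<bar>q\<bar>"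
    and sub: "viscosity_subsolution F u"
    and cu: "continuous_on ({0..1} \<times> UNIV) (\<lambda>(t, x). u t x)"
    and gu: "\<And>t x. 0 \<le> t \<Longrightarrow> t \<le> 1 \<Longrightarrow> u t x \<le> B * wt m x"
    and W: "C12_strip W Wt Wx Wxx"
    and cW: "continuous_on ({a..b} \<times> UNIV) (\<lambda>q. W (fst q) (snd q))"
    and gW: "\<And>t x. a \<le> t \<Longrightarrow> t \<le> b \<Longrightarrow> - (B' * wt m' x) \<le> W t x"
    and super: "\<And>t x. a < t \<Longrightarrow> t < b \<Longrightarrow> Wt t x + F (Wxx t x) \<le> 0"
    and ab: "0 \<le> a" "a < b" "b \<le> 1"
    and bd: "\<And>x. u b x \<le> W b x"
    and s: "a \<le> s" "s \<le> b"
  shows "u s x \<le> W s x"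
proof -
  have cu': "continuous_on ({a..b} \<times> UNIV) (\<lambda>q. u (fst q) (snd q))"
    using cu ab unfolding case_prod_beta by (elim continuous_on_subset) auto
  have inner: "u s1 x1 \<le> W s1 x1" if s1: "a < s1" "s1 < b" for s1 x1
  proof (rule ccontr)
    assume "\<not> u s1 x1 \<le> W s1 x1"
    define \<eta> where "\<eta> = u s1 x1 - W s1 x1"
    have \<eta>: "0 < \<eta>" using \<open>\<not> u s1 x1 \<le> W s1 x1\<close> by (simp add: \<eta>_def)
    define k where "k = max m m'"
    define A where "A = \<bar>B\<bar> + \<bar>B'\<bar>"
    define l where "l = barrier_rate (k + 1) L"
    have l: "0 \<le> l" unfolding l_def by (rule barrier_rate_nonneg[OF L])
    have b1: "0 < barrier l (k + 1) s1 x1 + 1" by (simp add: barrier_def add_nonneg_pos)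
    \<comment> \<open>At time \<open>s1\<close> the penalty equals \<open>\<delta>\<close>, so
      barrier and penalty together take away only half of the excess \<open>\<eta>\<close> at
      \<open>(s1, x1)\<close>.\<close>
    define \<delta> where "\<delta> = \<eta> / (2 * (barrier l (k + 1) s1 x1 + 1))"
    have \<delta>: "0 < \<delta>" using \<eta> b1 by (simp add: \<delta>_def)
    have \<delta>': "\<delta> * barrier l (k + 1) s1 x1 + \<delta> < \<eta>"
    proof -
      have "\<delta> * barrier l (k + 1) s1 x1 + \<delta> = \<delta> * (barrier l (k + 1) s1 x1 + 1)" by (simp add: algebra_simps)
      also have "\<dots> = \<eta> / 2"
      proof -
        have "\<eta> / (2 * c) * c = \<eta> / 2" if "0 < c" for c using that by simp
        thus ?thesis unfolding \<delta>_def using b1 .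
      qed
      finally show ?thesis using \<eta> by simp
    qed
    define D where "D = (\<lambda>t y. u t y - W t y - \<delta> * barrier l (k + 1) t y)"
    have Dc: "continuous_on ({a..b} \<times> UNIV) (\<lambda>q. D (fst q) (snd q))"
      unfolding D_def barrier_def by (intro continuous_intros cu' cW)
    have Dle: "D t y \<le> wt k y * (A - \<delta> * wt 1 y)" if "a \<le> t" "t \<le> b" for t y
    proof -
      have "u t y \<le> B * wt m y" using that ab by (intro gu) auto
      also have "\<dots> \<le> \<bar>B\<bar> * wt k y" by (intro mult_mono wt_mono) (auto simp: k_def)
      finally have 1: "u t y \<le> \<bar>B\<bar> * wt k y" .
      have "- W t y \<le> B' * wt m' y" using gW[OF that, of y] by simp
      also have "\<dots> \<le> \<bar>B'\<bar> * wt k y" by (intro mult_mono wt_mono) (auto simp: k_def)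
      finally have 2: "- W t y \<le> \<bar>B'\<bar> * wt k y" .
      have "\<delta> * (wt k y * wt 1 y) \<le> \<delta> * barrier l (k + 1) t y"
        unfolding wt_add[symmetric] using l \<delta> that ab by (intro mult_left_mono barrier_ge) auto
      with 1 2 show ?thesis unfolding D_def A_def by (simp add: algebra_simps)
    qed
    \<comment> \<open>Beyond \<open>A / \<delta>\<close> the additional power in the barrier
      outweighs the growth of \<open>u\<close> and \<open>W\<close>; the second term keeps
      \<open>x1\<close> inside.\<close>
    define R where "R = max (A / \<delta>) \<bar>x1\<bar>"
    have Dneg: "D t y \<le> 0" if "a \<le> t" "t \<le> b" "R < \<bar>y\<bar>" for t y
    proof -
      have "A / \<delta> < wt 1 y" using that(3) abs_le_wt_1[of y] by (simp add: R_def)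
      hence "A - \<delta> * wt 1 y \<le> 0" using \<delta> by (simp add: field_simps)
      thus ?thesis using Dle[OF that(1,2), of y] wt_nonneg[of k y]
        by (meson mult_nonneg_nonpos order_trans)
    qed
    define K where "K = {a..b} \<times> {-R..R}"
    have K: "compact K" "(s1, x1) \<in> K" unfolding K_def using s1 by (auto intro: compact_Times simp: R_def)
    have DK: "continuous_on K (\<lambda>q. D (fst q) (snd q))" by (rule continuous_on_subset[OF Dc]) (auto simp: K_def)
    obtain qM where qM: "qM \<in> K" "\<And>q. q \<in> K \<Longrightarrow> D (fst q) (snd q) \<le> D (fst qM) (snd qM)"
      using continuous_attains_sup[OF K(1) _ DK] K(2) by (metis empty_iff)
    define M where "M = max (D (fst qM) (snd qM)) 0"
    have DM: "D t y \<le> M" if "a \<le> t" "t \<le> b" for t y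
    proof (cases "\<bar>y\<bar> \<le> R")
      case True
      hence "(t, y) \<in> K" using that by (auto simp: K_def)
      from qM(2)[OF this] show ?thesis by (simp add: M_def max.coboundedI1)
    next
      case False
      with Dneg[OF that, of y] show ?thesis by (simp add: M_def)
    qed
    \<comment> \<open>Chosen so that \<open>exp (N * (s1 - a)) = exp (M / \<delta>)\<close>, which
      exceeds \<open>M / \<delta>\<close>: at time \<open>a\<close> the penalty is larger than every
      value of \<open>D\<close>.\<close>
    define N where "N = M / \<delta> / (s1 - a)"
    have N: "0 \<le> N" using \<delta> s1 by (simp add: N_def M_def)
    have NM: "M < \<delta> * exp (N * (s1 - a))"
    proof -
      have e: "N * (s1 - a) = M / \<delta>" using s1 by (simp add: N_def)
      have "M / \<delta> < exp (M / \<delta>)" using exp_ge_add_one_self[of "M / \<delta>"] by linarith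
      thus ?thesis unfolding e using \<delta> by (simp add: field_simps)
    qed
    define \<Theta> where "\<Theta> = (\<lambda>t y. D t y - \<delta> * exp (N * (s1 - t)))"
    have \<Theta>K: "continuous_on K (\<lambda>q. \<Theta> (fst q) (snd q))"
      unfolding \<Theta>_def by (intro continuous_intros DK)
    obtain q0 where q0: "q0 \<in> K" "\<And>q. q \<in> K \<Longrightarrow> \<Theta> (fst q) (snd q) \<le> \<Theta> (fst q0) (snd q0)"
      using continuous_attains_sup[OF K(1) _ \<Theta>K] K(2) by (metis empty_iff)
    obtain s0 x0 where q0': "q0 = (s0, x0)" by (cases q0)
    have s0ab: "a \<le> s0" "s0 \<le> b" using q0(1) unfolding q0' K_def by auto
    have "0 < \<Theta> s1 x1" using \<delta>' by (simp add: \<Theta>_def D_def \<eta>_def)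
    also have "\<Theta> s1 x1 \<le> \<Theta> s0 x0" using q0(2)[OF K(2)] by (simp add: q0')
    finally have pos: "0 < \<Theta> s0 x0" .
    have max: "\<Theta> t y \<le> \<Theta> s0 x0" if "a \<le> t" "t \<le> b" for t y
    proof (cases "\<bar>y\<bar> \<le> R")
      case True
      hence "(t, y) \<in> K" using that by (auto simp: K_def)
      from q0(2)[OF this] show ?thesis by (simp add: q0')
    next
      case False
      have "0 < \<delta> * exp (N * (s1 - t))" using \<delta> by simp
      with False Dneg[OF that, of y] pos show ?thesis by (simp add: \<Theta>_def)
    qed
    have "s0 \<noteq> a"
    proof
      assume "s0 = a"
      hence "\<Theta> s0 x0 < 0" using DM[OF s0ab, of x0] NM by (simp add: \<Theta>_def)
      thus False using pos by simp
    qed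
    moreover have "s0 \<noteq> b"
    proof
      assume "s0 = b"
      moreover have "0 \<le> \<delta> * barrier l (k + 1) s0 x0" using \<delta> by (simp add: barrier_def)
      ultimately have "D s0 x0 \<le> 0" using bd[of x0] unfolding D_def by simp
      moreover have "0 < \<delta> * exp (N * (s1 - s0))" using \<delta> by simp
      ultimately have "\<Theta> s0 x0 < 0" unfolding \<Theta>_def by linarith
      thus False using pos by simp
    qed
    ultimately have s0: "a < s0" "s0 < b" using s0ab by auto
    \<comment> \<open>The factor \<open>1\<close> presents the penalty as a product of a function of
      time and a function of space, as \<open>C12_strip_prod\<close> expects.\<close>
    define \<Psi> where "\<Psi> = (\<lambda>t y. W t y + (\<delta> * barrier l (k + 1) t y + \<delta> * exp (N * (s1 - t)) * 1))"
    define \<Psi>t where "\<Psi>t = (\<lambda>t y. Wt t y + (\<delta> * (- l * barrier l (k + 1) t y) + \<delta> * (- N * exp (N * (s1 - t))) * 1))"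
    define \<Psi>xx where "\<Psi>xx = (\<lambda>t y. Wxx t y + (\<delta> * exp (l * (1 - t)) * wt'' (k + 1) y + \<delta> * exp (N * (s1 - t)) * 0))"
    have C12: "C12_strip \<Psi> \<Psi>t (\<lambda>t y. Wx t y + (\<delta> * exp (l * (1 - t)) * wt' (k + 1) y + \<delta> * exp (N * (s1 - t)) * 0)) \<Psi>xx"
      unfolding \<Psi>_def \<Psi>t_def \<Psi>xx_def
      by (intro C12_strip_add[OF W] C12_strip_add[OF C12_strip_barrier] C12_strip_prod DERIV_cmult
          exp_backward_deriv DERIV_const continuous_intros)
    have ev: "\<forall>\<^sub>F q in nhds (s0, x0). q \<in> {a<..<b} \<times> UNIV"
      using s0 by (intro eventually_nhds_in_open open_Times) auto
    have lmax: "\<forall>\<^sub>F (t, y) in nhds (s0, x0). u t y - \<Psi> t y \<le> u s0 x0 - \<Psi> s0 x0"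
      using ev
    proof eventually_elim
      case (elim q)
      thus ?case using max[of "fst q" "snd q"]
        by (auto simp: \<Theta>_def D_def \<Psi>_def case_prod_beta mem_Times_iff)
    qed
    have "s0 \<in> {0<..<1}" using s0 ab by simp
    from sub[unfolded viscosity_subsolution_def, rule_format, OF this conjI[OF C12 lmax]]
    have "0 \<le> \<Psi>t s0 x0 + F (\<Psi>xx s0 x0)" .
    also have "F (\<Psi>xx s0 x0) \<le> F (Wxx s0 x0) + L * \<bar>\<delta> * exp (l * (1 - s0)) * wt'' (k + 1) x0\<bar>"
      unfolding \<Psi>xx_def using F[of "Wxx s0 x0" "\<delta> * exp (l * (1 - s0)) * wt'' (k + 1) x0"] by simp
    also have "\<bar>\<delta> * exp (l * (1 - s0)) * wt'' (k + 1) x0\<bar> = \<delta> * \<bar>exp (l * (1 - s0)) * wt'' (k + 1) x0\<bar>"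
      using \<delta> by (simp add: abs_mult)
    finally have "0 \<le> (Wt s0 x0 + F (Wxx s0 x0)) - \<delta> * N * exp (N * (s1 - s0))
        + \<delta> * (- l * barrier l (k + 1) s0 x0 + L * \<bar>exp (l * (1 - s0)) * wt'' (k + 1) x0\<bar>)"
      unfolding \<Psi>t_def by (simp add: algebra_simps)
    also have "\<dots> \<le> 0 - 0 + \<delta> * (- barrier l (k + 1) s0 x0)"
      using \<delta> N super[OF s0, of x0] barrier_supersolution[OF L, of "k + 1" s0 x0]
      by (intro add_mono diff_mono mult_left_mono) (auto simp: l_def)
    also have "\<dots> < 0" using \<delta> wt_pos[of "k + 1" x0] by (simp add: barrier_def)
    finally show False by simp
  qed
  have "0 \<le> W s x - u s x"
  proof (cases "s = b")
    case True
    thus ?thesis using bd by simp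
  next
    case False
    have "continuous_on {a..b} (\<lambda>t. W t x - u t x)"
    proof -
      have "continuous_on {a..b} (\<lambda>t. (t, x))" "(\<lambda>t. (t, x)) ` {a..b} \<subseteq> {a..b} \<times> UNIV"
        by (auto intro!: continuous_intros)
      from continuous_on_diff[OF continuous_on_compose2[OF cW this] continuous_on_compose2[OF cu' this]]
      show ?thesis by simp
    qed
    thus ?thesis
      using s ab inner continuous_ge_on_closure[of "{a<..<b}" "\<lambda>t. W t x - u t x" s 0]
      by (simp add: closure_greaterThanLessThan)
  qed
  thus ?thesis by simp
qed

section \<open>The nonlinearity as a maximum over volatilities\<close>

lemma G_fun_ge:
  assumes "0 \<le> sl" "v \<in> {sl..su}" shows "v\<^sup>2 / 2 * p \<le> G_fun sl su p"
proof (cases "0 \<le> p")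
  case True
  have "v\<^sup>2 * p \<le> su\<^sup>2 * p" using assms True by (intro mult_right_mono power_mono) auto
  thus ?thesis using True by (simp add: G_fun_def)
next
  case False
  have "v\<^sup>2 * p \<le> sl\<^sup>2 * p" using assms False by (intro mult_right_mono_neg power_mono) auto
  thus ?thesis using False by (simp add: G_fun_def)
qed

lemma G_fun_attained:
  assumes "sl \<le> su" obtains v where "v \<in> {sl..su}" "G_fun sl su p = v\<^sup>2 / 2 * p"
proof (cases "0 \<le> p")
  case True
  thus ?thesis using assms by (intro that[of su]) (auto simp: G_fun_def)
next
  case False
  thus ?thesis using assms by (intro that[of sl]) (auto simp: G_fun_def)
qed

lemma G_fun_add_le:
  assumes "0 \<le> sl" "sl \<le> su" shows "G_fun sl su (p + q) \<le> G_fun sl su p + su\<^sup>2 / 2 * \<bar>q\<bar>"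
proof -
  obtain v where v: "v \<in> {sl..su}" "G_fun sl su (p + q) = v\<^sup>2 / 2 * (p + q)"
    using G_fun_attained[OF assms(2)] by blast
  have "v\<^sup>2 / 2 * q \<le> v\<^sup>2 / 2 * \<bar>q\<bar>" by (intro mult_left_mono) auto
  also have "\<dots> \<le> su\<^sup>2 / 2 * \<bar>q\<bar>" using v assms by (intro mult_right_mono divide_right_mono power_mono) auto
  finally show ?thesis using v G_fun_ge[OF assms(1) v(1), of p] by (simp add: distrib_left)
qed

text \<open>A change of sign exchanges touching from below with touching from above. As
  \<open>G\<close> dominates the linear operator with volatility \<open>v\<close>, the inequality
  for \<open>G\<close> implies the one for that operator.\<close>

lemma supersolution_minus:
  assumes "0 \<le> sl" "v \<in> {sl..su}" "viscosity_supersolution (G_fun sl su) u"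
  shows "viscosity_subsolution (\<lambda>p. v\<^sup>2 / 2 * p) (\<lambda>t x. - u t x)"
  unfolding viscosity_subsolution_def
proof (intro allI ballI impI, elim conjE)
  fix \<psi> \<psi>t \<psi>x \<psi>xx :: "real \<Rightarrow> real \<Rightarrow> real" and t x :: real
  assume t: "t \<in> {0<..<1}" and C: "C12_strip \<psi> \<psi>t \<psi>x \<psi>xx"
    and max: "\<forall>\<^sub>F (s, y) in nhds (t, x). - u s y - \<psi> s y \<le> - u t x - \<psi> t x"
  have "\<forall>\<^sub>F (s, y) in nhds (t, x). u s y - (- \<psi> s y) \<ge> u t x - (- \<psi> t x)"
    using max by (rule eventually_mono) auto
  with assms(3) t C12_strip_minus[OF C] have "- \<psi>t t x + G_fun sl su (- \<psi>xx t x) \<le> 0"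
    unfolding viscosity_supersolution_def by blast
  thus "0 \<le> \<psi>t t x + v\<^sup>2 / 2 * \<psi>xx t x"
    using G_fun_ge[OF assms(1,2), of "- \<psi>xx t x"] by simp
qed

section \<open>The value of the scheme bounds the solution from below\<close>

lemma DERIV_max_0_square: "((\<lambda>y. (max y 0)\<^sup>2) has_real_derivative 2 * max y 0) (at (y::real))"
proof -
  consider "0 < y" | "y < 0" | "y = 0" by linarith
  thus ?thesis
  proof cases
    case 1
    have "((\<lambda>y. y\<^sup>2) has_real_derivative 2 * y) (at y)" by (auto intro!: derivative_eq_intros)
    hence "((\<lambda>y. (max y 0)\<^sup>2) has_real_derivative 2 * y) (at y)"
      using 1 by (rule_tac has_field_derivative_transform_within_open[of _ _ _ "{0<..}"]) auto
    thus ?thesis using 1 by simp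
  next
    case 2
    have "((\<lambda>y. (max y 0)\<^sup>2) has_real_derivative 0) (at y)"
      using 2 by (rule_tac has_field_derivative_transform_within_open[of "\<lambda>_. 0" _ _ "{..<0}"]) auto
    thus ?thesis using 2 by simp
  next
    case 3
    have "((\<lambda>z. ((max z 0)\<^sup>2 - (max 0 0)\<^sup>2) / (z - 0)) \<longlongrightarrow> 0) (at (0::real))"
    proof (rule Lim_null_comparison)
      show "\<forall>\<^sub>F z in at 0. norm (((max z 0)\<^sup>2 - (max 0 0)\<^sup>2) / (z - 0)) \<le> \<bar>z::real\<bar>"
        by (intro always_eventually) (auto simp: max_def power2_eq_square)
      show "((\<lambda>z. \<bar>z\<bar>) \<longlongrightarrow> 0) (at (0::real))" by (rule tendsto_rabs_zero) (rule tendsto_ident_at)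
    qed
    thus ?thesis using 3 unfolding has_field_derivative_iff by simp
  qed
qed

text \<open>
  For \<open>s \<le> b\<close> this is the variance \<open>\<epsilon>\<^sup>2 + v\<^sup>2 (b - s)\<close> of the heat flow; the quadratic term keeps it
  positive and of class \<open>C\<^sup>1\<close> beyond \<open>b\<close>, as test functions live on the whole strip.
\<close>

definition heat_clock :: "real \<Rightarrow> real \<Rightarrow> real \<Rightarrow> real \<Rightarrow> real" where
  "heat_clock \<epsilon> v b s = \<epsilon>\<^sup>2 + v\<^sup>2 * (b - s) + v ^ 4 / (2 * \<epsilon>\<^sup>2) * (max (s - b) 0)\<^sup>2"

definition heat_clock' :: "real \<Rightarrow> real \<Rightarrow> real \<Rightarrow> real \<Rightarrow> real" where
  "heat_clock' \<epsilon> v b s = - v\<^sup>2 + v ^ 4 / (2 * \<epsilon>\<^sup>2) * (2 * max (s - b) 0)"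

lemma heat_clock_deriv: "(heat_clock \<epsilon> v b has_real_derivative heat_clock' \<epsilon> v b s) (at s)"
proof -
  have "((\<lambda>s. (max (s - b) 0)\<^sup>2) has_real_derivative 2 * max (s - b) 0 * 1) (at s)"
    by (rule DERIV_chain2[OF DERIV_max_0_square]) (auto intro!: derivative_eq_intros)
  from DERIV_cmult[OF this, of "v ^ 4 / (2 * \<epsilon>\<^sup>2)"]
  have 1: "((\<lambda>s. v ^ 4 / (2 * \<epsilon>\<^sup>2) * (max (s - b) 0)\<^sup>2) has_real_derivative v ^ 4 / (2 * \<epsilon>\<^sup>2) * (2 * max (s - b) 0)) (at s)"
    by simp
  have 2: "((\<lambda>s. \<epsilon>\<^sup>2 + v\<^sup>2 * (b - s)) has_real_derivative - v\<^sup>2) (at s)"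
    by (auto intro!: derivative_eq_intros)
  show ?thesis using DERIV_add[OF 2 1] unfolding heat_clock_def heat_clock'_def .
qed

lemma heat_clock_before: "s \<le> b \<Longrightarrow> heat_clock \<epsilon> v b s = \<epsilon>\<^sup>2 + v\<^sup>2 * (b - s)" "s \<le> b \<Longrightarrow> heat_clock' \<epsilon> v b s = - v\<^sup>2"
  by (simp_all add: heat_clock_def heat_clock'_def max_def)

lemma heat_clock_pos:
  assumes "0 < \<epsilon>" shows "0 < heat_clock \<epsilon> v b s"
proof (cases "s \<le> b")
  case True
  thus ?thesis using assms by (simp add: heat_clock_before add_pos_nonneg)
next
  case False
  \<comment> \<open>In this variable the clock is \<open>\<epsilon>\<^sup>2 - y + y\<^sup>2 / (2 *
    \<epsilon>\<^sup>2)\<close>. Completing the square shows that its minimum is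
    \<open>\<epsilon>\<^sup>2 / 2\<close>, which is the origin of the coefficient
    \<open>v ^ 4 / (2 * \<epsilon>\<^sup>2)\<close>.\<close>
  define y where "y = v\<^sup>2 * (s - b)"
  have "heat_clock \<epsilon> v b s = \<epsilon>\<^sup>2 - y + y\<^sup>2 / (2 * \<epsilon>\<^sup>2)"
  proof -
    have "v ^ 4 * (s - b)\<^sup>2 = y\<^sup>2" by (simp add: y_def power_mult_distrib)
    moreover have "v\<^sup>2 * (b - s) = - y" by (simp add: y_def algebra_simps)
    ultimately show ?thesis using False unfolding heat_clock_def by (simp add: max_def)
  qed
  also have "\<dots> = (\<epsilon>\<^sup>2 + (y - \<epsilon>\<^sup>2)\<^sup>2 / \<epsilon>\<^sup>2) / 2"
    using assms by (simp add: power2_diff field_simps)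
  also have "\<dots> > 0" using assms by (simp add: add_pos_nonneg)
  finally show ?thesis .
qed

lemma C12_strip_heat:
  assumes f: "poly_growth f" and pos: "\<And>t. 0 < \<rho> t"
    and der: "\<And>t. (\<rho> has_real_derivative \<rho>' t) (at t)" and cont: "continuous_on UNIV \<rho>'"
  shows "C12_strip (\<lambda>t x. heat0 f (\<rho> t) x) (\<lambda>t x. heat2 f (\<rho> t) x / 2 * \<rho>' t)
      (\<lambda>t x. heat1 f (\<rho> t) x) (\<lambda>t x. heat2 f (\<rho> t) x)"
    and "continuous_on S (\<lambda>q. heat0 f (\<rho> (fst q)) (snd q))"
proof -
  have cr: "continuous_on UNIV \<rho>" using der by (auto intro!: continuous_at_imp_continuous_on DERIV_isCont)
  have cq: "continuous_on S (\<lambda>q. (\<rho> (fst q), snd q :: real))" for S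
    by (intro continuous_on_Pair continuous_on_compose2[OF cr] continuous_on_fst continuous_on_snd continuous_on_id) auto
  have c: "continuous_on S (\<lambda>q. heat0 f (\<rho> (fst q)) (snd q))"
    "continuous_on S (\<lambda>q. heat1 f (\<rho> (fst q)) (snd q))"
    "continuous_on S (\<lambda>q. heat2 f (\<rho> (fst q)) (snd q))" for S
    using continuous_on_compose2[OF heat_continuous_on(1)[OF f] cq[of S]]
      continuous_on_compose2[OF heat_continuous_on(2)[OF f] cq[of S]]
      continuous_on_compose2[OF heat_continuous_on(3)[OF f] cq[of S]] pos
    by (simp_all add: image_subset_iff)
  show "continuous_on S (\<lambda>q. heat0 f (\<rho> (fst q)) (snd q))" by (rule c)
  show "C12_strip (\<lambda>t x. heat0 f (\<rho> t) x) (\<lambda>t x. heat2 f (\<rho> t) x / 2 * \<rho>' t)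
      (\<lambda>t x. heat1 f (\<rho> t) x) (\<lambda>t x. heat2 f (\<rho> t) x)"
  proof (rule C12_stripI)
    fix t x
    show "((\<lambda>s. heat0 f (\<rho> s) x) has_real_derivative heat2 f (\<rho> t) x / 2 * \<rho>' t) (at t)"
      by (rule DERIV_chain2[OF heat0_deriv_time[OF f pos] der])
    show "(heat0 f (\<rho> t) has_real_derivative heat1 f (\<rho> t) x) (at x)"
      by (rule heat0_deriv_x[OF f pos])
    show "(heat1 f (\<rho> t) has_real_derivative heat2 f (\<rho> t) x) (at x)"
      by (rule heat1_deriv_x[OF f pos])
  next
    show "continuous_on ({0<..<1} \<times> UNIV) (\<lambda>q. heat2 f (\<rho> (fst q)) (snd q) / 2 * \<rho>' (fst q))"
      by (intro continuous_on_mult continuous_on_divide c continuous_on_compose2[OF cont]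
          continuous_on_fst continuous_on_id continuous_on_const) auto
  qed (rule c)+
qed

lemma gavg_growth:
  assumes f: "wlip C k f" and s: "0 \<le> s" "s \<le> S"
  shows "\<bar>gavg s f x\<bar> \<le> (\<bar>f 0\<bar> + 2 * C + C * approx_const k S * S) * wt (k + 1) x"
proof -
  have C: "0 \<le> C" by (rule wlip_nonneg[OF f])
  have "\<bar>gavg s f x - f x\<bar> \<le> C * approx_const k S * s * wt k x"
    unfolding approx_const_def by (rule gavg_approx[OF f s])
  also have "\<dots> \<le> C * approx_const k S * S * wt (k + 1) x"
    using C s approx_const_nonneg[of k S] by (intro mult_mono wt_mono mult_nonneg_nonneg) auto
  finally show ?thesis using wlip_growth[OF f, of x] by (simp add: distrib_right)
qed

lemma heat_solutionE:
  assumes "heat_solution G \<phi> u"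
  obtains B m where "\<And>t x. 0 \<le> t \<Longrightarrow> t \<le> 1 \<Longrightarrow> \<bar>u t x\<bar> \<le> B * wt m x"
proof -
  from assms obtain B m where *: "\<forall>t\<in>{0..1}. \<forall>x. \<bar>u t x\<bar> \<le> B * (1 + \<bar>x\<bar> ^ m)"
    unfolding heat_solution_def by blast
  have B: "0 \<le> B" using *[rule_format, of 0 0] by (cases m) auto
  have "\<bar>u t x\<bar> \<le> (2 * B) * wt m x" if "0 \<le> t" "t \<le> 1" for t x
  proof -
    have "\<bar>u t x\<bar> \<le> B * (1 + \<bar>x\<bar> ^ m)" using * that by simp
    also have "\<dots> \<le> B * (wt m x + wt m x)" using B by (intro mult_left_mono add_mono wt_ge_1 pow_le_wt)
    finally show ?thesis by simp
  qed
  thus ?thesis by (rule that)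
qed

text \<open>By \<open>supersolution_minus\<close> it suffices to compare \<open>- u\<close> with the
  negative of the flow, a solution of the linear equation. The flow is started with variance
  \<open>\<epsilon>\<^sup>2\<close> in order to be smooth up to time \<open>b\<close>; the resulting
  error at time \<open>b\<close> is covered by a barrier of size \<open>A * \<epsilon>\<close>, and
  \<epsilon> then tends to zero.\<close>

lemma heat_flow_le_solution:
  assumes sl: "0 \<le> sl" and v: "v \<in> {sl..su}" and u: "heat_solution (G_fun sl su) \<phi> u"
    and g: "wlip C k g" and ab: "0 \<le> a" "a < b" "b \<le> 1" and le: "\<And>x. g x \<le> u b x"
    and s: "a \<le> s" "s \<le> b"
  shows "gavg (v * sqrt (b - s)) g x \<le> u s x"
proof -
  obtain B m where B: "\<And>t x. 0 \<le> t \<Longrightarrow> t \<le> 1 \<Longrightarrow> \<bar>u t x\<bar> \<le> B * wt m x"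
    using heat_solutionE[OF u] by blast
  have v0: "0 \<le> v" using sl v by simp
  have C: "0 \<le> C" by (rule wlip_nonneg[OF g])
  have pg: "poly_growth g" by (rule wlip_poly_growth[OF g])
  define l where "l = barrier_rate k (v\<^sup>2 / 2)"
  have l: "0 \<le> l" unfolding l_def by (rule barrier_rate_nonneg) simp
  define A where "A = C * approx_const k 1"
  have A: "0 \<le> A" unfolding A_def using C approx_const_nonneg by simp
  have main: "gavg (sqrt (\<epsilon>\<^sup>2 + v\<^sup>2 * (b - s))) g x - A * \<epsilon> * barrier l k s x \<le> u s x" if e: "0 < \<epsilon>" "\<epsilon> \<le> 1" for \<epsilon>
  proof -
    let ?\<rho> = "heat_clock \<epsilon> v b"
    note pos = heat_clock_pos[OF e(1), of v b]
    have cont': "continuous_on UNIV (heat_clock' \<epsilon> v b)"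
      unfolding heat_clock'_def by (intro continuous_intros)
    note C12h = C12_strip_heat[OF pg pos heat_clock_deriv cont']
    \<comment> \<open>Before time \<open>b\<close> the flow part solves the linear equation exactly,
      so only the barrier contributes to the supersolution inequality.\<close>
    define W where "W = (\<lambda>t y. - heat0 g (?\<rho> t) y + A * \<epsilon> * barrier l k t y)"
    have "- u s x \<le> W s x"
    proof (rule viscosity_comparison[where L = "v\<^sup>2 / 2" and u = "\<lambda>t x. - u t x" and F = "\<lambda>p. v\<^sup>2 / 2 * p" and m' = "k + 1"])
      show "v\<^sup>2 / 2 * (p + q) \<le> v\<^sup>2 / 2 * p + v\<^sup>2 / 2 * \<bar>q\<bar>" for p q :: real
        unfolding distrib_left by (intro add_left_mono mult_left_mono) auto
      show "viscosity_subsolution (\<lambda>p. v\<^sup>2 / 2 * p) (\<lambda>t x. - u t x)"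
        using u unfolding heat_solution_def by (intro supersolution_minus[OF sl v]) auto
      show "continuous_on ({0..1} \<times> UNIV) (\<lambda>(t, x). - u t x)"
        using u unfolding heat_solution_def case_prod_beta by (intro continuous_on_minus) auto
      show "- u t x \<le> B * wt m x" if "0 \<le> t" "t \<le> 1" for t x using B[OF that, of x] by simp
      show "C12_strip W (\<lambda>t y. - (heat2 g (?\<rho> t) y / 2 * heat_clock' \<epsilon> v b t) + A * \<epsilon> * (- l * barrier l k t y))
         (\<lambda>t y. - heat1 g (?\<rho> t) y + A * \<epsilon> * exp (l * (1 - t)) * wt' k y) (\<lambda>t y. - heat2 g (?\<rho> t) y + A * \<epsilon> * exp (l * (1 - t)) * wt'' k y)"
        unfolding W_def by (intro C12_strip_add C12_strip_minus C12h C12_strip_barrier)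
      show "continuous_on ({a..b} \<times> UNIV) (\<lambda>q. W (fst q) (snd q))"
        unfolding W_def barrier_def by (intro continuous_intros C12h)
      show "- ((\<bar>g 0\<bar> + 2 * C + C * approx_const k (sqrt (1 + v\<^sup>2)) * sqrt (1 + v\<^sup>2)) * wt (k + 1) y) \<le> W t y"
        if "a \<le> t" "t \<le> b" for t y
      proof -
        have "?\<rho> t \<le> 1 + v\<^sup>2"
        proof -
          have "\<epsilon>\<^sup>2 \<le> 1" using e by (simp add: power_le_one)
          moreover have "v\<^sup>2 * (b - t) \<le> v\<^sup>2 * 1" using that ab by (intro mult_left_mono) auto
          ultimately show ?thesis using that by (simp add: heat_clock_before)
        qed
        hence "\<bar>gavg (sqrt (?\<rho> t)) g y\<bar> \<le> (\<bar>g 0\<bar> + 2 * C + C * approx_const k (sqrt (1 + v\<^sup>2)) * sqrt (1 + v\<^sup>2)) * wt (k + 1) y"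
          using pos[of t] by (intro gavg_growth[OF g]) auto
        moreover have "0 \<le> A * \<epsilon> * barrier l k t y" using A e by (simp add: barrier_def)
        ultimately show ?thesis
          unfolding W_def heat0_eq_gavg[OF pos poly_growth_measurable[OF pg]] by linarith
      qed
      show "- (heat2 g (?\<rho> t) y / 2 * heat_clock' \<epsilon> v b t) + A * \<epsilon> * (- l * barrier l k t y)
         + v\<^sup>2 / 2 * (- heat2 g (?\<rho> t) y + A * \<epsilon> * exp (l * (1 - t)) * wt'' k y) \<le> 0"
        if "a < t" "t < b" for t y
      proof -
        have "v\<^sup>2 / 2 * (exp (l * (1 - t)) * wt'' k y) \<le> v\<^sup>2 / 2 * \<bar>exp (l * (1 - t)) * wt'' k y\<bar>"
          by (intro mult_left_mono) auto
        hence "- l * barrier l k t y + v\<^sup>2 / 2 * (exp (l * (1 - t)) * wt'' k y) \<le> - barrier l k t y"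
          using barrier_supersolution[of "v\<^sup>2 / 2" k t y] unfolding l_def by simp
        also have "\<dots> \<le> 0" by (simp add: barrier_def)
        finally have "A * \<epsilon> * (- l * barrier l k t y + v\<^sup>2 / 2 * (exp (l * (1 - t)) * wt'' k y)) \<le> 0"
          using A e by (intro mult_nonneg_nonpos) auto
        moreover have "heat_clock' \<epsilon> v b t = - v\<^sup>2" using that by (simp add: heat_clock_before)
        ultimately show ?thesis by (simp add: algebra_simps)
      qed
      show "- u b y \<le> W b y" for y
      proof -
        have "\<bar>gavg \<epsilon> g y - g y\<bar> \<le> A * \<epsilon> * wt k y"
          using gavg_approx[OF g, of \<epsilon> 1 y] e unfolding A_def approx_const_def by simp
        moreover have "A * \<epsilon> * wt k y \<le> A * \<epsilon> * barrier l k b y"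
          using A e l ab by (intro mult_left_mono barrier_ge) auto
        moreover have "heat0 g (?\<rho> b) y = gavg \<epsilon> g y"
          using e pos[of b] poly_growth_measurable[OF pg] by (subst heat0_eq_gavg) (auto simp: heat_clock_before)
        ultimately show ?thesis unfolding W_def using le[of y] by linarith
      qed
    qed (use ab s in auto)
    thus ?thesis using s pos[of s] poly_growth_measurable[OF pg]
      by (simp add: W_def heat0_eq_gavg heat_clock_before)
  qed
  \<comment> \<open>Continuity of \<open>gavg\<close> in the standard deviation, including the value
    zero, covers \<open>v = 0\<close> and \<open>s = b\<close> as well.\<close>
  have "isCont (\<lambda>\<epsilon>. gavg (sqrt (\<epsilon>\<^sup>2 + v\<^sup>2 * (b - s))) g x) 0"
    by (rule isCont_o2[OF _ gavg_continuous[OF g]]) (intro continuous_intros)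
  hence "((\<lambda>\<epsilon>. gavg (sqrt (\<epsilon>\<^sup>2 + v\<^sup>2 * (b - s))) g x) \<longlongrightarrow> gavg (sqrt (0\<^sup>2 + v\<^sup>2 * (b - s))) g x) (at_right 0)"
    unfolding isCont_def by (rule filterlim_mono) (auto intro: at_le)
  moreover have "((\<lambda>\<epsilon>. A * \<epsilon> * barrier l k s x) \<longlongrightarrow> A * 0 * barrier l k s x) (at_right 0)"
    by (intro tendsto_intros)
  ultimately have "((\<lambda>\<epsilon>. gavg (sqrt (\<epsilon>\<^sup>2 + v\<^sup>2 * (b - s))) g x - A * \<epsilon> * barrier l k s x) \<longlongrightarrow> 
      gavg (sqrt (0\<^sup>2 + v\<^sup>2 * (b - s))) g x - A * 0 * barrier l k s x) (at_right 0)"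
    by (rule tendsto_diff)
  moreover have "\<forall>\<^sub>F \<epsilon> in at_right 0. gavg (sqrt (\<epsilon>\<^sup>2 + v\<^sup>2 * (b - s))) g x - A * \<epsilon> * barrier l k s x \<le> u s x"
    unfolding eventually_at_right[OF zero_less_one] using main by (intro exI[of _ 1]) auto
  ultimately have "gavg (sqrt (0\<^sup>2 + v\<^sup>2 * (b - s))) g x - A * 0 * barrier l k s x \<le> u s x"
    by (intro tendsto_upperbound) auto
  thus ?thesis using v0 by (simp add: real_sqrt_mult)
qed

text \<open>For fixed \<open>x\<close> the maximising volatility is frozen over one time step. The
  corresponding heat flow, started from the scheme value at the later grid time, lies below
  \<open>u\<close> by the induction hypothesis and is the next scheme value at
  \<open>x\<close>.\<close>

lemma scheme_le_solution:
  assumes sl: "0 \<le> sl" "sl \<le> su" and u: "heat_solution (G_fun sl su) \<phi> u" and f: "wlip C k \<phi>" and n: "n \<ge> 1"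
    and i: "i \<le> n"
  shows "scheme sl su \<phi> n i x \<le> u (1 - i / n) x"
  using i
proof (induction i arbitrary: x)
  case 0
  thus ?case using u by (simp add: heat_solution_def)
next
  case (Suc i)
  obtain c where c: "wt_rate k su c" using wt_rate_exists[of su k] sl by auto
  note S = scheme_wlip_and_Suc[OF sl f n c, of i]
  obtain v where v: "v \<in> {sl..su}" "one_step sl su (1 / sqrt n) (scheme sl su \<phi> n i) x = gavg (v * (1 / sqrt n)) (scheme sl su \<phi> n i) x"
    using one_step_attained[OF sl(2) S(1), of "1 / sqrt n" x] by metis
  have d: "(1 - i / n) - (1 - Suc i / n) = 1 / real n" using n by (simp add: field_simps)
  have "gavg (v * sqrt ((1 - i / n) - (1 - Suc i / n))) (scheme sl su \<phi> n i) x \<le> u (1 - Suc i / n) x"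
    using Suc n by (intro heat_flow_le_solution[OF sl(1) v(1) u S(1), where a = "1 - Suc i / n"])
      (auto simp: field_simps)
  thus ?case unfolding S(2) v(2) d by (simp add: real_sqrt_divide)
qed

section \<open>The mollified scheme bounds the solution from above\<close>

lemma gavg_diff:
  assumes "poly_growth f" "poly_growth g"
  shows "gavg s (\<lambda>y. f y - g y) x = gavg s f x - gavg s g x"
  unfolding gavg_def
  by (intro Bochner_Integration.integral_diff integrable_poly_growth
      poly_growth_compose[OF assms(1)] poly_growth_compose[OF assms(2)]) (intro poly_growth_intros)+

text \<open>The comparison function runs linearly in time from the mollified \<open>f\<close> at
  time \<open>b\<close> to the mollified \<open>one_step\<close> at time \<open>b - 1 / n\<close>.
  Its slope dominates every heat generator applied to the mollified \<open>f\<close>, because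
  \<open>one_step\<close> dominates each heat step and mollification respects this;
  \<open>heat_consistency\<close> quantifies the defect. The second defect is the second derivative
  of the linear correction. The barrier with factor \<open>\<kappa>\<close> absorbs both.\<close>

lemma one_step_upper:
  fixes n :: nat
  defines "r \<equiv> 1 / sqrt n"
  assumes sl: "0 \<le> sl" "sl \<le> su" and u: "heat_solution (G_fun sl su) \<phi> u" and n: "n \<ge> 1"
    and f: "wlip C k f" and g: "wlip C k (one_step sl su r f)"
    and e: "0 < \<epsilon>" "\<epsilon> \<le> 1" and b: "0 \<le> b - 1 / n" "b \<le> 1"
    and l: "l = barrier_rate k (su\<^sup>2 / 2)"
    and \<kappa>: "su\<^sup>2 * (C * approx_const k su * (su * r) * hess_const k / \<epsilon>\<^sup>2) \<le> \<kappa>"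
    and bd: "\<And>x. u b x \<le> gavg \<epsilon> f x + \<kappa> * barrier l k b x"
    and s: "b - 1 / n \<le> s" "s \<le> b"
  shows "u s x \<le> gavg \<epsilon> f x + real n * (b - s) * (gavg \<epsilon> (one_step sl su r f) x - gavg \<epsilon> f x) + \<kappa> * barrier l k s x"
proof -
  obtain B m where B: "\<And>t x. 0 \<le> t \<Longrightarrow> t \<le> 1 \<Longrightarrow> \<bar>u t x\<bar> \<le> B * wt m x"
    using heat_solutionE[OF u] by blast
  have C: "0 \<le> C" by (rule wlip_nonneg[OF f])
  have su: "0 \<le> su" using sl by simp
  have r: "0 < r" "r \<le> 1" "n * r\<^sup>2 = 1" using n by (auto simp: r_def power_divide)
  have sur: "su * r \<le> su" using su r by (intro mult_left_le) auto
  have l0: "0 \<le> l" unfolding l by (rule barrier_rate_nonneg) simp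
  define \<tau> where "\<tau> = \<epsilon>\<^sup>2"
  have \<tau>: "0 < \<tau>" "\<tau> \<le> 1" "sqrt \<tau> = \<epsilon>" using e by (auto simp: \<tau>_def power_le_one)
  define h where "h = one_step sl su r f"
  define d where "d = (\<lambda>y. h y - f y)"
  have pf: "poly_growth f" and ph: "poly_growth h"
    using f g unfolding h_def by (auto intro: wlip_poly_growth)
  have pd: "poly_growth d" unfolding d_def by (intro poly_growth_diff ph pf)
  \<comment> \<open>One step changes \<open>f\<close> by order \<open>su * r\<close>, and
    mollification with variance \<open>\<tau>\<close> turns this into a second derivative of order
    \<open>su * r / \<tau>\<close>. The same quantity bounds the consistency error, so
    \<open>Q\<close> serves for both defects.\<close>
  define Q where "Q = C * approx_const k su * (su * r) * hess_const k / \<tau>"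
  have Q: "0 \<le> Q" unfolding Q_def using C su r \<tau> approx_const_nonneg hess_const_nonneg by simp
  have \<kappa>': "su\<^sup>2 * Q \<le> \<kappa>" using \<kappa> unfolding Q_def \<tau>_def .
  have \<kappa>0: "0 \<le> \<kappa>" using \<kappa>' Q by (meson mult_nonneg_nonneg order_trans zero_le_power2)
  have h0: "heat0 f \<tau> y = gavg \<epsilon> f y" "heat0 d \<tau> y = gavg \<epsilon> h y - gavg \<epsilon> f y" for y
    using \<tau> pf pd gavg_diff[OF ph pf] by (simp_all add: heat0_eq_gavg poly_growth_measurable d_def)
  \<comment> \<open>The factors \<open>1\<close> here and \<open>0\<close> in \<open>Wt\<close>
    bring the stationary summand into the product form of \<open>C12_strip_prod\<close>.\<close>
  define W where "W = (\<lambda>t y. 1 * heat0 f \<tau> y + (real n * (b - t) * heat0 d \<tau> y + \<kappa> * barrier l k t y))"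
  define Wt where "Wt = (\<lambda>t y. 0 * heat0 f \<tau> y + (- real n * heat0 d \<tau> y + \<kappa> * (- l * barrier l k t y)))"
  define Wxx where "Wxx = (\<lambda>t y. 1 * heat2 f \<tau> y + (real n * (b - t) * heat2 d \<tau> y + \<kappa> * exp (l * (1 - t)) * wt'' k y))"
  have c2: "continuous_on UNIV (heat2 F \<tau>)" if "poly_growth F" for F
  proof -
    have "continuous_on UNIV (\<lambda>y. (\<tau>, y))" "(\<lambda>y. (\<tau>, y)) ` UNIV \<subseteq> {0<..} \<times> UNIV"
      using \<tau> by (auto intro!: continuous_intros)
    from continuous_on_compose2[OF heat_continuous_on(3)[OF that] this] show ?thesis by simp
  qed
  have nbt: "((\<lambda>t. real n * (b - t)) has_real_derivative - real n) (at t)" for t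
    by (auto intro!: derivative_eq_intros)
  have C12: "C12_strip W Wt (\<lambda>t y. 1 * heat1 f \<tau> y + (real n * (b - t) * heat1 d \<tau> y + \<kappa> * exp (l * (1 - t)) * wt' k y)) Wxx"
    unfolding W_def Wt_def Wxx_def
    by (intro C12_strip_add C12_strip_prod C12_strip_barrier heat0_deriv_x heat1_deriv_x pf pd \<tau> c2 nbt
        DERIV_const continuous_intros)
  have c0: "continuous_on UNIV (heat0 F \<tau>)" if "poly_growth F" for F
    using heat0_deriv_x[OF that \<tau>(1)] by (auto intro!: continuous_at_imp_continuous_on DERIV_isCont)
  have cW: "continuous_on A (\<lambda>q. W (fst q) (snd q))" for A
    unfolding W_def barrier_def
    by (intro continuous_intros continuous_on_compose2[OF c0[OF pf]] continuous_on_compose2[OF c0[OF pd]]) auto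
  define B1 where "B1 = \<bar>f 0\<bar> + 2 * C + C * approx_const k 1 * 1"
  define B2 where "B2 = \<bar>h 0\<bar> + 2 * C + C * approx_const k 1 * 1"
  have nb: "0 \<le> real n * (b - t)" "real n * (b - t) \<le> 1" if "b - 1 / n \<le> t" "t \<le> b" for t
    using that n by (auto simp: field_simps)
  have gW: "- ((2 * B1 + B2) * wt (k + 1) y) \<le> W t y" if "b - 1 / n \<le> t" "t \<le> b" for t y
  proof -
    have 1: "\<bar>gavg \<epsilon> f y\<bar> \<le> B1 * wt (k + 1) y" "\<bar>gavg \<epsilon> h y\<bar> \<le> B2 * wt (k + 1) y"
      using gavg_growth[OF f, of \<epsilon> 1 y] gavg_growth[OF g, of \<epsilon> 1 y] e by (simp_all add: B1_def B2_def h_def)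
    have "\<bar>real n * (b - t) * heat0 d \<tau> y\<bar> \<le> 1 * \<bar>heat0 d \<tau> y\<bar>"
      unfolding abs_mult[of "real n * (b - t)"] using nb[OF that] by (intro mult_right_mono) auto
    also have "\<dots> \<le> \<bar>gavg \<epsilon> h y\<bar> + \<bar>gavg \<epsilon> f y\<bar>" unfolding h0 by simp
    finally have 2: "\<bar>real n * (b - t) * heat0 d \<tau> y\<bar> \<le> (B1 + B2) * wt (k + 1) y"
      using 1 by (simp add: distrib_right)
    have 3: "0 \<le> \<kappa> * barrier l k t y" using \<kappa>0 by (simp add: barrier_def)
    have "- (B1 * wt (k + 1) y) - (B1 + B2) * wt (k + 1) y \<le> W t y"
      unfolding W_def using 1(1) 2 3 h0(1)[of y] by linarith
    thus ?thesis by (simp add: algebra_simps)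
  qed
  have super: "Wt t y + G_fun sl su (Wxx t y) \<le> 0" if "b - 1 / n < t" "t < b" for t y
  proof -
    \<comment> \<open>At a fixed point \<open>G\<close> acts as a single volatility, so one heat
      step has to be compared with \<open>one_step\<close>, the one with this
      \<open>v\<close>.\<close>
    obtain v where v: "v \<in> {sl..su}" "G_fun sl su (Wxx t y) = v\<^sup>2 / 2 * Wxx t y"
      using G_fun_attained[OF sl(2)] by blast
    have v0: "0 \<le> v" "v \<le> su" using v sl by auto
    have vr: "0 \<le> v * r" "v * r \<le> su * r" "v * r \<le> su"
    proof -
      show le: "v * r \<le> su * r" using v0 r by (intro mult_right_mono) auto
      show "v * r \<le> su" using le sur by simp
    qed (use v0 r in simp)
    have v2: "v\<^sup>2 / 2 \<le> su\<^sup>2 / 2" using v0 by (intro divide_right_mono power_mono) auto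
    have lower: "v\<^sup>2 / 2 * heat2 f \<tau> y - v\<^sup>2 / 2 * (Q * wt k y) \<le> n * heat0 d \<tau> y"
    proof -
      have "gavg (sqrt (\<tau> + (v * r)\<^sup>2)) f y = gavg \<epsilon> (gavg (v * r) f) y"
        using gavg_semigroup[OF pf, of \<epsilon> "v * r" y] e vr unfolding \<tau>_def by simp
      also have "\<dots> \<le> gavg \<epsilon> h y"
        using vr v unfolding h_def
        by (intro gavg_mono poly_growth_gavg[OF f] ph[unfolded h_def] gavg_le_one_step[OF sl(2) f])
      finally have 1: "gavg (sqrt (\<tau> + (v * r)\<^sup>2)) f y \<le> gavg \<epsilon> h y" .
      have 2: "C * approx_const k su * (v * r) * hess_const k / \<tau> * wt k y \<le> Q * wt k y"
        unfolding Q_def using C vr \<tau> approx_const_nonneg hess_const_nonneg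
        by (intro mult_right_mono[of _ _ "wt k y"] mult_right_mono[of _ _ "hess_const k"] divide_right_mono
            mult_left_mono[of "v * r"] mult_nonneg_nonneg) auto
      have "\<bar>gavg (sqrt (\<tau> + (v * r)\<^sup>2)) f y - gavg \<epsilon> f y - (v * r)\<^sup>2 / 2 * heat2 f \<tau> y\<bar>
         \<le> (v * r)\<^sup>2 / 2 * (C * approx_const k su * (v * r) * hess_const k / \<tau> * wt k y)"
        using heat_consistency[OF f \<tau>(1,2) vr(1) vr(3), of y] unfolding \<tau>(3) .
      also have "\<dots> \<le> (v * r)\<^sup>2 / 2 * (Q * wt k y)"
        using 2 by (intro mult_left_mono) auto
      finally have "(v * r)\<^sup>2 / 2 * heat2 f \<tau> y - (v * r)\<^sup>2 / 2 * (Q * wt k y) \<le> heat0 d \<tau> y"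
        using 1 h0(2)[of y] by linarith
      hence "n * ((v * r)\<^sup>2 / 2 * heat2 f \<tau> y - (v * r)\<^sup>2 / 2 * (Q * wt k y)) \<le> n * heat0 d \<tau> y"
        by (intro mult_left_mono) auto
      moreover have "n * ((v * r)\<^sup>2 / 2 * heat2 f \<tau> y - (v * r)\<^sup>2 / 2 * (Q * wt k y))
         = (n * r\<^sup>2) * (v\<^sup>2 / 2 * heat2 f \<tau> y - v\<^sup>2 / 2 * (Q * wt k y))"
        by (simp add: power_mult_distrib algebra_simps)
      ultimately show ?thesis using r(3) by simp
    qed
    have d2: "\<bar>heat2 d \<tau> y\<bar> \<le> Q * wt k y"
      unfolding Q_def
    proof (rule abs_heat2_le[OF pd _ \<tau>(1,2)])
      show "\<bar>d z\<bar> \<le> C * approx_const k su * (su * r) * wt k z" for z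
        using one_step_approx[OF sl f _ sur, of z] r unfolding d_def h_def approx_const_def by simp
    qed
    \<comment> \<open>The interpolation weight \<open>n * (b - t)\<close> lies between 0 and 1, so
      the linear correction contributes no more than the full increment \<open>d\<close>.\<close>
    have upper: "v\<^sup>2 / 2 * (real n * (b - t) * heat2 d \<tau> y) \<le> v\<^sup>2 / 2 * (Q * wt k y)"
    proof (intro mult_left_mono)
      have "real n * (b - t) * heat2 d \<tau> y \<le> real n * (b - t) * \<bar>heat2 d \<tau> y\<bar>"
        using nb[of t] that by (intro mult_left_mono) auto
      also have "\<dots> \<le> 1 * (Q * wt k y)" using nb[of t] that d2 Q by (intro mult_mono) auto
      finally show "real n * (b - t) * heat2 d \<tau> y \<le> Q * wt k y" by simp
    qed simp
    have bar: "\<kappa> * (- l * barrier l k t y) + v\<^sup>2 / 2 * (\<kappa> * exp (l * (1 - t)) * wt'' k y) \<le> - (\<kappa> * wt k y)"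
    proof -
      have "v\<^sup>2 / 2 * (exp (l * (1 - t)) * wt'' k y) \<le> su\<^sup>2 / 2 * \<bar>exp (l * (1 - t)) * wt'' k y\<bar>"
        by (rule order_trans[OF mult_left_mono[OF abs_ge_self] mult_right_mono[OF v2]]) auto
      hence "- l * barrier l k t y + v\<^sup>2 / 2 * (exp (l * (1 - t)) * wt'' k y) \<le> - barrier l k t y"
        using barrier_supersolution[of "su\<^sup>2 / 2" k t y] unfolding l by simp
      also have "\<dots> \<le> - wt k y" using barrier_ge[OF l0, of t k y] that b by simp
      finally have "\<kappa> * (- l * barrier l k t y + v\<^sup>2 / 2 * (exp (l * (1 - t)) * wt'' k y)) \<le> \<kappa> * (- wt k y)"
        using \<kappa>0 by (intro mult_left_mono)
      thus ?thesis by (simp add: algebra_simps)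
    qed
    \<comment> \<open>The consistency error and the linear correction contribute
      \<open>v\<^sup>2 / 2 * Q\<close> each; this is where the factor \<open>su\<^sup>2\<close> in
      the condition on \<open>\<kappa>\<close> comes from.\<close>
    have "v\<^sup>2 / 2 * (Q * wt k y) + v\<^sup>2 / 2 * (Q * wt k y) \<le> su\<^sup>2 * Q * wt k y"
      using mult_right_mono[OF v2, of "Q * wt k y"] Q by (simp add: mult_ac)
    also have "\<dots> \<le> \<kappa> * wt k y" using \<kappa>' by (intro mult_right_mono) auto
    finally have tot: "v\<^sup>2 / 2 * (Q * wt k y) + v\<^sup>2 / 2 * (Q * wt k y) \<le> \<kappa> * wt k y" .
    have "v\<^sup>2 / 2 * Wxx t y = v\<^sup>2 / 2 * heat2 f \<tau> y + v\<^sup>2 / 2 * (real n * (b - t) * heat2 d \<tau> y)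
       + v\<^sup>2 / 2 * (\<kappa> * exp (l * (1 - t)) * wt'' k y)"
      unfolding Wxx_def by (simp only: distrib_left mult_1 add.assoc)
    moreover have "Wt t y = - (n * heat0 d \<tau> y) + \<kappa> * (- l * barrier l k t y)"
      unfolding Wt_def by simp
    ultimately show ?thesis unfolding v(2) using lower upper bar tot by linarith
  qed
  have "u s x \<le> W s x"
  proof (rule viscosity_comparison[OF _ G_fun_add_le[OF sl] _ _ _ C12 cW gW super])
    show "viscosity_subsolution (G_fun sl su) u" "continuous_on ({0..1} \<times> UNIV) (\<lambda>(t, x). u t x)"
      using u unfolding heat_solution_def by auto
    show "u t x \<le> B * wt m x" if "0 \<le> t" "t \<le> 1" for t x using B[OF that, of x] by simp
    show "u b x \<le> W b x" for x using bd[of x] by (simp add: W_def h0)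
  qed (use b s n in auto)
  thus ?thesis by (simp add: W_def h0 h_def)
qed

text \<open>The barrier grows fast enough backwards in time to cancel the defect of each step, so
  the same \<open>\<kappa>\<close> serves at all grid times and errors do not accumulate. The second
  condition on \<open>\<kappa>\<close> pays for mollifying the terminal value.\<close>

lemma solution_le_mollified_scheme:
  fixes n :: nat
  assumes sl: "0 \<le> sl" "sl \<le> su" and u: "heat_solution (G_fun sl su) \<phi> u" and n: "n \<ge> 1"
    and f: "\<And>i. i \<le> n \<Longrightarrow> wlip C k (scheme sl su \<phi> n i)"
    and f_Suc: "\<And>i. scheme sl su \<phi> n (Suc i) = one_step sl su (1 / sqrt n) (scheme sl su \<phi> n i)"
    and e: "0 < \<epsilon>" "\<epsilon> \<le> 1"
    and l: "l = barrier_rate k (su\<^sup>2 / 2)"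
    and \<kappa>: "su\<^sup>2 * (C * approx_const k su * (su * (1 / sqrt n)) * hess_const k / \<epsilon>\<^sup>2) \<le> \<kappa>" "C * approx_const k 1 * \<epsilon> \<le> \<kappa>"
    and i: "i \<le> n"
  shows "u (1 - i / n) x \<le> gavg \<epsilon> (scheme sl su \<phi> n i) x + \<kappa> * barrier l k (1 - i / n) x"
  using i
proof (induction i arbitrary: x)
  case 0
  have l0: "0 \<le> l" unfolding l by (rule barrier_rate_nonneg) simp
  have "\<bar>gavg \<epsilon> \<phi> x - \<phi> x\<bar> \<le> C * approx_const k 1 * \<epsilon> * wt k x"
    using gavg_approx[OF f[of 0], of \<epsilon> 1 x] e unfolding approx_const_def by simp
  also have "\<dots> \<le> \<kappa> * wt k x" using \<kappa>(2) by (intro mult_right_mono) auto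
  finally show ?case using u by (simp add: heat_solution_def barrier_def)
next
  case (Suc i)
  have 1: "(1 - i / n) - 1 / n = 1 - Suc i / real n" by (simp add: add_divide_distrib)
  have "u (1 - Suc i / n) x \<le> gavg \<epsilon> (scheme sl su \<phi> n i) x
     + real n * ((1 - i / n) - (1 - Suc i / n)) * (gavg \<epsilon> (one_step sl su (1 / sqrt n) (scheme sl su \<phi> n i)) x - gavg \<epsilon> (scheme sl su \<phi> n i) x)
     + \<kappa> * barrier l k (1 - Suc i / n) x"
  proof (rule one_step_upper[OF sl u n f _ e _ _ l \<kappa>(1)])
    show "wlip C k (one_step sl su (1 / sqrt n) (scheme sl su \<phi> n i))"
      using f[OF Suc.prems] by (simp only: f_Suc)
    show "0 \<le> 1 - i / n - 1 / n" unfolding 1 using Suc.prems n by simp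
    show "u (1 - i / n) y \<le> gavg \<epsilon> (scheme sl su \<phi> n i) y + \<kappa> * barrier l k (1 - i / n) y" for y
      using Suc by simp
  qed (use Suc.prems n 1 in \<open>auto simp: field_simps\<close>)
  moreover have "real n * ((1 - i / n) - (1 - Suc i / n)) = 1" using n by (simp add: field_simps)
  ultimately show ?case by (simp add: f_Suc del: scheme.simps)
qed

section \<open>Rate of convergence at arbitrary times and uniqueness\<close>

lemma scheme_rate:
  assumes sl: "0 \<le> sl" "sl \<le> su" and u: "heat_solution (G_fun sl su) \<phi> u" and \<phi>: "wlip C0 k \<phi>"
  obtains K where "0 < K" "\<And>p x n. 0 < p \<Longrightarrow> p \<le> 1 \<Longrightarrow> n \<ge> 1 \<Longrightarrow>
    \<bar>u (1 - p) x - scheme sl su \<phi> n (nat \<lfloor>real n * p\<rfloor>) x\<bar> \<le> K * n powr (- 1 / 6) * wt k x"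
proof -
  have su: "0 \<le> su" using sl by simp
  obtain c where c: "wt_rate k su c" using wt_rate_exists[of su k] su by auto
  have c0: "0 \<le> c" using c by (simp add: wt_rate_def)
  have C0: "0 \<le> C0" by (rule wlip_nonneg[OF \<phi>])
  define C where "C = C0 * exp (c * su\<^sup>2)"
  have C: "0 \<le> C" using C0 by (simp add: C_def)
  define l where "l = barrier_rate k (su\<^sup>2 / 2)"
  have l0: "0 \<le> l" unfolding l_def by (rule barrier_rate_nonneg) simp
  define a1 where "a1 = C * approx_const k 1"
  define a2 where "a2 = C * approx_const k su * su"
  define a3 where "a3 = su\<^sup>2 * (a2 * hess_const k) + a1"
  have a: "0 \<le> a1" "0 \<le> a2" "0 \<le> a3"
    using C su approx_const_nonneg hess_const_nonneg by (auto simp: a1_def a2_def a3_def)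
  \<comment> \<open>One \<open>a1\<close> is the cost of mollifying at the grid time, two more arise
    in the mollified increment to the next stage, and \<open>a2\<close> is the increment itself. The
    barrier contributes \<open>a3 * exp l\<close>; the summand 1 makes \<open>K\<close>
    positive.\<close>
  define K where "K = 3 * a1 + a2 + a3 * exp l + 1"
  have K: "0 < K" unfolding K_def using a by (simp add: add_nonneg_pos)
  have "\<bar>u (1 - p) x - scheme sl su \<phi> n (nat \<lfloor>real n * p\<rfloor>) x\<bar> \<le> K * n powr (- 1 / 6) * wt k x"
    if p: "0 < p" "p \<le> 1" and n: "n \<ge> 1" for p x n
  proof -
    define r where "r = 1 / sqrt n"
    \<comment> \<open>With this choice \<open>r = \<epsilon> ^ 3\<close>, so the step error
      \<open>r / \<epsilon>\<^sup>2\<close> and the mollification error are both exactly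
      \<open>\<epsilon>\<close>.\<close>
    define \<epsilon> where "\<epsilon> = real n powr (- 1 / 6)"
    have e: "0 < \<epsilon>" "\<epsilon> \<le> 1" using n powr_mono[of "- 1 / 6" 0 "real n"] by (auto simp: \<epsilon>_def)
    have r_eq: "r = \<epsilon> ^ 3"
    proof -
      have "r = real n powr (- 1 / 2)" using n by (simp add: r_def powr_half_sqrt[symmetric] powr_minus_divide)
      also have "\<dots> = \<epsilon> ^ 3" using n by (simp add: \<epsilon>_def powr_power)
      finally show ?thesis .
    qed
    have r: "0 < r" "r \<le> \<epsilon>" "r / \<epsilon>\<^sup>2 = \<epsilon>"
    proof -
      show "0 < r" using e by (simp add: r_eq)
      show "r \<le> \<epsilon>" unfolding r_eq using power_decreasing[of 1 3 \<epsilon>] e by simp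
      show "r / \<epsilon>\<^sup>2 = \<epsilon>" unfolding r_eq using e by (simp add: power3_eq_cube power2_eq_square)
    qed
    have sur: "su * (1 / sqrt n) \<le> su" using su n by (intro mult_left_le) auto
    define f where "f = scheme sl su \<phi> n"
    note S = scheme_wlip_and_Suc[OF sl \<phi> n c, folded f_def]
    have f: "wlip C k (f i)" if "i \<le> n" for i
    proof (rule wlip_mono[OF S(1)])
      have "c * su\<^sup>2 * (i / n) \<le> c * su\<^sup>2 * 1" using that n c0 by (intro mult_left_mono) auto
      thus "C0 * exp (c * su\<^sup>2 * (i / n)) \<le> C" unfolding C_def using C0 by (intro mult_left_mono) auto
    qed
    define \<kappa> where "\<kappa> = a3 * \<epsilon>"
    have \<kappa>1: "su\<^sup>2 * (C * approx_const k su * (su * (1 / sqrt n)) * hess_const k / \<epsilon>\<^sup>2) \<le> \<kappa>"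
    proof -
      have "su\<^sup>2 * (C * approx_const k su * (su * (1 / sqrt n)) * hess_const k / \<epsilon>\<^sup>2) = su\<^sup>2 * (a2 * hess_const k) * (r / \<epsilon>\<^sup>2)"
        by (simp add: a2_def r_def)
      also have "\<dots> \<le> a3 * \<epsilon>" unfolding r(3) a3_def using a e by (intro mult_right_mono) auto
      finally show ?thesis unfolding \<kappa>_def .
    qed
    have \<kappa>2: "C * approx_const k 1 * \<epsilon> \<le> \<kappa>"
    proof -
      have "a1 \<le> a3" unfolding a3_def using a hess_const_nonneg by simp
      thus ?thesis unfolding \<kappa>_def a1_def[symmetric] using e by (intro mult_right_mono) auto
    qed
    have \<kappa>0: "0 \<le> \<kappa>" using a e by (simp add: \<kappa>_def)
    have node: "u (1 - i / n) y \<le> gavg \<epsilon> (f i) y + \<kappa> * barrier l k (1 - i / n) y" if "i \<le> n" for i y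
      unfolding f_def
      by (rule solution_le_mollified_scheme[OF sl u n f[unfolded f_def] S(2)[unfolded f_def] e l_def \<kappa>1 \<kappa>2 that])
    have moll: "\<bar>gavg \<epsilon> (f i) x - f i x\<bar> \<le> a1 * \<epsilon> * wt k x" if "i \<le> n" for i
      using gavg_approx[OF f[OF that], of \<epsilon> 1 x] e unfolding a1_def approx_const_def by simp
    define j where "j = nat \<lfloor>real n * p\<rfloor>"
    have np: "0 \<le> real n * p" "real n * p \<le> n" using p n by (auto intro: mult_left_le)
    have j: "real j \<le> real n * p" "real n * p < real j + 1"
      using np unfolding j_def by (auto simp: of_nat_nat)
    have jn: "j \<le> n" using j np by linarith
    \<comment> \<open>The earliest grid time not before \<open>1 - p\<close>; less than one time
      step lies between the two.\<close>
    define b where "b = 1 - j / n"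
    have bs: "0 \<le> b - (1 - p)" "b - (1 - p) < 1 / n" "b \<le> 1"
    proof -
      have "j / n \<le> p" "p < (j + 1) / n" using j n by (simp_all add: pos_divide_le_eq pos_less_divide_eq mult.commute)
      thus "0 \<le> b - (1 - p)" "b - (1 - p) < 1 / n" by (simp_all add: b_def add_divide_distrib)
    qed (simp add: b_def)
    have bar: "\<kappa> * barrier l k (1 - p) x \<le> a3 * exp l * \<epsilon> * wt k x"
    proof -
      have "\<kappa> * barrier l k (1 - p) x \<le> \<kappa> * (exp l * wt k x)"
        using \<kappa>0 l0 p by (intro mult_left_mono barrier_le) auto
      thus ?thesis by (simp add: \<kappa>_def mult_ac)
    qed
    have upper: "u (1 - p) x \<le> f j x + (3 * a1 + a2 + a3 * exp l) * \<epsilon> * wt k x"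
    proof (cases "j = n")
      case True
      \<comment> \<open>A further step from the last stage would leave the time interval, but here
        \<open>1 - p = 0\<close> is itself a grid time and the bound at grid times applies.\<close>
      have "p = 1" using True j np p n by (simp add: field_simps)
      hence "u (1 - p) x \<le> gavg \<epsilon> (f j) x + \<kappa> * barrier l k (1 - p) x"
        using node[of n x] True n by simp
      moreover have "0 \<le> a1 * \<epsilon> * wt k x" "0 \<le> a2 * \<epsilon> * wt k x" using a e by simp_all
      ultimately show ?thesis using moll[OF jn] bar by (simp add: distrib_right)
    next
      case False
      hence j1: "Suc j \<le> n" using jn by simp
      have th: "0 \<le> real n * (b - (1 - p))" "real n * (b - (1 - p)) \<le> 1"
        using bs(1,2) n by (simp_all add: pos_less_divide_eq mult.commute)
      have "u (1 - p) x \<le> gavg \<epsilon> (f j) x + real n * (b - (1 - p)) * (gavg \<epsilon> (one_step sl su (1 / sqrt n) (f j)) x - gavg \<epsilon> (f j) x)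
          + \<kappa> * barrier l k (1 - p) x"
      proof (rule one_step_upper[OF sl u n f[OF jn] _ e _ bs(3) l_def \<kappa>1])
        show "wlip C k (one_step sl su (1 / sqrt n) (f j))" using f[OF j1] by (simp add: S(2))
        show "u b y \<le> gavg \<epsilon> (f j) y + \<kappa> * barrier l k b y" for y unfolding b_def by (rule node[OF jn])
        have "real (Suc j) \<le> real n" using j1 by (simp only: of_nat_le_iff)
        hence "real (Suc j) / n \<le> 1" by simp
        thus "0 \<le> b - 1 / n" by (simp add: b_def add_divide_distrib)
      qed (use bs in auto)
      moreover have "real n * (b - (1 - p)) * (gavg \<epsilon> (one_step sl su (1 / sqrt n) (f j)) x - gavg \<epsilon> (f j) x)
         \<le> (2 * a1 + a2) * \<epsilon> * wt k x"
      proof -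
        have "\<bar>f (Suc j) x - f j x\<bar> \<le> a2 * r * wt k x"
          using one_step_approx[OF sl f[OF jn] _ sur, of x] unfolding S(2) a2_def approx_const_def r_def
          by (simp add: mult_ac)
        also have "\<dots> \<le> a2 * \<epsilon> * wt k x" using a r by (intro mult_right_mono mult_left_mono) auto
        finally have "\<bar>gavg \<epsilon> (f (Suc j)) x - gavg \<epsilon> (f j) x\<bar> \<le> a1 * \<epsilon> * wt k x + a2 * \<epsilon> * wt k x + a1 * \<epsilon> * wt k x"
          using moll[OF jn] moll[OF j1] by linarith
        hence d: "\<bar>gavg \<epsilon> (f (Suc j)) x - gavg \<epsilon> (f j) x\<bar> \<le> (2 * a1 + a2) * \<epsilon> * wt k x"
          by (simp add: algebra_simps)
        have "real n * (b - (1 - p)) * (gavg \<epsilon> (f (Suc j)) x - gavg \<epsilon> (f j) x) \<le> real n * (b - (1 - p)) * \<bar>gavg \<epsilon> (f (Suc j)) x - gavg \<epsilon> (f j) x\<bar>"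
          using th by (intro mult_left_mono) auto
        also have "\<dots> \<le> 1 * ((2 * a1 + a2) * \<epsilon> * wt k x)"
          using th d by (intro mult_mono) auto
        finally show ?thesis by (simp add: S(2))
      qed
      ultimately show ?thesis using moll[OF jn] bar by (simp add: algebra_simps)
    qed
    have lower: "f j x - a2 * \<epsilon> * wt k x \<le> u (1 - p) x"
    proof -
      \<comment> \<open>The remaining time is bridged by the heat flow with volatility
        \<open>sl\<close>, which stays below \<open>u\<close> and moves \<open>f j\<close> by no
        more than the one-step bound.\<close>
      have "gavg (sl * sqrt (b - (1 - p))) (f j) x \<le> u (1 - p) x"
      proof (cases "1 - p < b")
        case True
        show ?thesis
        proof (rule heat_flow_le_solution[OF sl(1) _ u f[OF jn] _ True bs(3)])
          show "f j y \<le> u b y" for y unfolding b_def f_def by (rule scheme_le_solution[OF sl u \<phi> n jn])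
        qed (use sl p True in auto)
      next
        case False
        hence "1 - p = b" using bs by simp
        thus ?thesis using scheme_le_solution[OF sl u \<phi> n jn, of x] by (simp add: b_def f_def)
      qed
      moreover have "\<bar>gavg (sl * sqrt (b - (1 - p))) (f j) x - f j x\<bar> \<le> a2 * \<epsilon> * wt k x"
      proof -
        have sq: "sqrt (b - (1 - p)) \<le> r"
          unfolding r_def using bs real_sqrt_le_mono[of "b - (1 - p)" "1 / n"] by (simp add: real_sqrt_divide)
        hence 1: "sl * sqrt (b - (1 - p)) \<le> su * r" using sl r bs(1) by (intro mult_mono) auto
        have "\<bar>gavg (sl * sqrt (b - (1 - p))) (f j) x - f j x\<bar>
            \<le> C * approx_const k su * (sl * sqrt (b - (1 - p))) * wt k x"
          unfolding approx_const_def using 1 sur sl bs by (intro gavg_approx[OF f[OF jn]]) (auto simp: r_def)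
        also have "\<dots> \<le> C * approx_const k su * (su * \<epsilon>) * wt k x"
          using 1 r su C approx_const_nonneg
          by (intro mult_right_mono mult_left_mono mult_nonneg_nonneg order_trans[OF 1]) auto
        finally show ?thesis by (simp add: a2_def mult_ac)
      qed
      ultimately show ?thesis by linarith
    qed
    have "(3 * a1 + a2 + a3 * exp l) * \<epsilon> * wt k x \<le> K * \<epsilon> * wt k x" "a2 * \<epsilon> * wt k x \<le> K * \<epsilon> * wt k x"
      unfolding K_def using a e by (intro mult_right_mono; simp)+
    thus ?thesis using upper lower unfolding f_def j_def \<epsilon>_def by linarith
  qed
  with K show ?thesis by (rule that)
qed

lemma heat_solution_unique:
  assumes sl: "0 \<le> sl" "sl \<le> su" and u: "heat_solution (G_fun sl su) \<phi> u" and w: "heat_solution (G_fun sl su) \<phi> w"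
    and \<phi>: "wlip C k \<phi>" and p: "0 < p" "p \<le> 1"
  shows "u (1 - p) x = w (1 - p) x"
proof -
  obtain K where K: "\<And>p x n. 0 < p \<Longrightarrow> p \<le> 1 \<Longrightarrow> n \<ge> 1 \<Longrightarrow>
    \<bar>u (1 - p) x - scheme sl su \<phi> n (nat \<lfloor>real n * p\<rfloor>) x\<bar> \<le> K * n powr (- 1 / 6) * wt k x"
    using scheme_rate[OF sl u \<phi>] by metis
  obtain K' where K': "\<And>p x n. 0 < p \<Longrightarrow> p \<le> 1 \<Longrightarrow> n \<ge> 1 \<Longrightarrow>
    \<bar>w (1 - p) x - scheme sl su \<phi> n (nat \<lfloor>real n * p\<rfloor>) x\<bar> \<le> K' * n powr (- 1 / 6) * wt k x"
    using scheme_rate[OF sl w \<phi>] by metis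
  have "\<bar>u (1 - p) x - w (1 - p) x\<bar> \<le> 0"
  proof (rule tendsto_lowerbound)
    have "(\<lambda>n. real n powr (- 1 / 6)) \<longlonglongrightarrow> 0"
      by (intro tendsto_neg_powr filterlim_real_sequentially) simp
    hence "(\<lambda>n. (K + K') * real n powr (- 1 / 6) * wt k x) \<longlonglongrightarrow> (K + K') * 0 * wt k x"
      by (intro tendsto_intros)
    thus "(\<lambda>n. (K + K') * real n powr (- 1 / 6) * wt k x) \<longlonglongrightarrow> 0" by simp
    show "\<forall>\<^sub>F n in sequentially. \<bar>u (1 - p) x - w (1 - p) x\<bar> \<le> (K + K') * real n powr (- 1 / 6) * wt k x"
      using eventually_ge_at_top[of 1]
    proof eventually_elim
      case (elim n)
      show ?case using K[OF p elim, of x] K'[OF p elim, of x] unfolding distrib_right by linarith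
    qed
  qed simp
  thus ?thesis by simp
qed

section \<open>Sums of independent semi-G-normal variables\<close>

lemma abs_le_L2_set: "finite A \<Longrightarrow> i \<in> A \<Longrightarrow> \<bar>f i\<bar> \<le> L2_set f A"
  using member_le_L2_set[of A i "\<lambda>i. \<bar>f i\<bar>"] by (simp add: L2_set_def)

text \<open>Powers of the common base \<open>1 + L2_set x {..<d} + L2_set y {..<d}\<close> multiply
  conveniently, unlike the sums of powers in \<open>C_lLip_dim\<close>; passing between them costs
  \<open>3 ^ m\<close>. The constant \<open>A + 1\<close> is strictly positive, as the class
  demands.\<close>

lemma C_lLip_dimI:
  assumes A: "0 \<le> A" and le: "\<And>x y. \<bar>\<psi> x - \<psi> y\<bar> \<le>
      A * (1 + L2_set x {..<d} + L2_set y {..<d}) ^ m * L2_set (\<lambda>i. x i - y i) {..<d}"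
  shows "\<psi> \<in> C_lLip_dim d"
proof -
  have "\<bar>\<psi> x - \<psi> y\<bar> \<le> (A + 1) * 3 ^ m * (1 + L2_set x {..<d} ^ m + L2_set y {..<d} ^ m) * L2_set (\<lambda>i. x i - y i) {..<d}" for x y
  proof -
    define a where "a = L2_set x {..<d}"
    define b where "b = L2_set y {..<d}"
    have ab: "0 \<le> a" "0 \<le> b" by (simp_all add: a_def b_def)
    have "(1 + a + b) ^ m \<le> (3 * max 1 (max a b)) ^ m" using ab by (intro power_mono) auto
    also have "\<dots> = 3 ^ m * max 1 (max a b) ^ m" by (simp add: power_mult_distrib)
    also have "max 1 (max a b) ^ m \<le> 1 + a ^ m + b ^ m" using ab by (auto simp: max_def)
    finally have "(1 + a + b) ^ m \<le> 3 ^ m * (1 + a ^ m + b ^ m)" by simp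
    hence "A * (1 + a + b) ^ m \<le> (A + 1) * (3 ^ m * (1 + a ^ m + b ^ m))"
      using A ab by (intro mult_mono) auto
    from order_trans[OF le mult_right_mono[OF this[unfolded a_def b_def]]]
    show ?thesis unfolding a_def b_def by (simp add: mult.assoc)
  qed
  thus ?thesis using A unfolding C_lLip_dim_def by (intro CollectI exI[of _ "(A + 1) * 3 ^ m"] conjI exI[of _ m]) auto
qed

text \<open>Quadratic growth of \<open>g\<close> is allowed so that the product of two coordinates
  is covered along with linear sums. The weights of \<open>f\<close> then have degree
  \<open>2 * k\<close>, and the Lipschitz bound of \<open>g\<close> adds one.\<close>

lemma wlip_compose_C_lLip_dim:
  assumes f: "wlip C k f" and B: "1 \<le> B"
    and growth: "\<And>x. \<bar>g x\<bar> \<le> B * (1 + L2_set x {..<d})\<^sup>2"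
    and lip: "\<And>x y. \<bar>g x - g y\<bar> \<le> B * (1 + L2_set x {..<d} + L2_set y {..<d}) * L2_set (\<lambda>i. x i - y i) {..<d}"
  shows "(\<lambda>x. f (g x)) \<in> C_lLip_dim d"
proof (rule C_lLip_dimI)
  have C: "0 \<le> C" by (rule wlip_nonneg[OF f])
  show "0 \<le> C * (2 * (2 * B) ^ k) * B" using C B by simp
  fix x y
  define S where "S = 1 + L2_set x {..<d} + L2_set y {..<d}"
  have S: "1 \<le> S" "1 + L2_set x {..<d} \<le> S" "1 + L2_set y {..<d} \<le> S" by (simp_all add: S_def)
  have w: "wt k (g z) \<le> ((2 * B) * S\<^sup>2) ^ k" if z: "1 + L2_set z {..<d} \<le> S" for z
  proof -
    have "\<bar>g z\<bar> \<le> B * S\<^sup>2"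
      by (rule order_trans[OF growth]) (use z B in \<open>intro mult_left_mono power_mono; simp\<close>)
    moreover have "1 * 1 \<le> B * S\<^sup>2" using B S by (intro mult_mono one_le_power) auto
    ultimately have "1 + \<bar>g z\<bar> \<le> (2 * B) * S\<^sup>2" by simp
    thus ?thesis using wt_le_pow[of k "g z"] by (meson abs_ge_zero add_nonneg_nonneg order_trans power_mono zero_le_one)
  qed
  have "\<bar>f (g x) - f (g y)\<bar> \<le> C * (wt k (g x) + wt k (g y)) * \<bar>g x - g y\<bar>" by (rule wlipD[OF f])
  also have "\<dots> \<le> C * (((2 * B) * S\<^sup>2) ^ k + ((2 * B) * S\<^sup>2) ^ k) * (B * S * L2_set (\<lambda>i. x i - y i) {..<d})"
    using C B S lip[of x y, folded S_def] w[OF S(2)] w[OF S(3)]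
    by (intro mult_mono mult_left_mono add_mono mult_nonneg_nonneg add_nonneg_nonneg) auto
  also have "\<dots> = C * (2 * (2 * B) ^ k) * B * S ^ (2 * k + 1) * L2_set (\<lambda>i. x i - y i) {..<d}"
  proof -
    have "((2 * B) * S\<^sup>2) ^ k = (2 * B) ^ k * S ^ (2 * k)" by (simp only: power_mult_distrib power_mult)
    moreover have "S ^ (2 * k + 1) = S ^ (2 * k) * S" by simp
    ultimately show ?thesis by (simp only: mult_2 distrib_left distrib_right mult_ac)
  qed
  finally show "\<bar>f (g x) - f (g y)\<bar> \<le> C * (2 * (2 * B) ^ k) * B * (1 + L2_set x {..<d} + L2_set y {..<d}) ^ (2 * k + 1)
      * L2_set (\<lambda>i. x i - y i) {..<d}" unfolding S_def .
qed

lemma wlip_sum_C_lLip_dim: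
  assumes f: "wlip C k f" shows "(\<lambda>v. f (x + (\<Sum>j<d. r * v j))) \<in> C_lLip_dim d"
proof -
  define B where "B = 1 + \<bar>x\<bar> + d * \<bar>r\<bar>"
  have B: "1 \<le> B" by (simp add: B_def)
  have sum: "\<bar>\<Sum>j<d. r * v j\<bar> \<le> d * \<bar>r\<bar> * L2_set v {..<d}" for v :: "nat \<Rightarrow> real"
  proof -
    have "\<bar>\<Sum>j<d. r * v j\<bar> \<le> (\<Sum>j<d. \<bar>r * v j\<bar>)" by (rule sum_abs)
    also have "\<dots> \<le> (\<Sum>j<d. \<bar>r\<bar> * L2_set v {..<d})"
      unfolding abs_mult by (intro sum_mono mult_left_mono abs_le_L2_set) auto
    finally show ?thesis by simp
  qed
  show ?thesis
  proof (rule wlip_compose_C_lLip_dim[OF f B])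
    fix v w :: "nat \<Rightarrow> real"
    define L where "L = L2_set v {..<d}"
    have L: "0 \<le> L" by (simp add: L_def)
    have "\<bar>x + (\<Sum>j<d. r * v j)\<bar> \<le> \<bar>x\<bar> + d * \<bar>r\<bar> * L" using sum[of v] by (simp add: L_def)
    also have "\<dots> \<le> B * (1 + L)" unfolding B_def using L by (simp add: algebra_simps)
    also have "\<dots> \<le> B * (1 + L)\<^sup>2" using B L by (intro mult_left_mono) (auto simp: power2_eq_square)
    finally show "\<bar>x + (\<Sum>j<d. r * v j)\<bar> \<le> B * (1 + L2_set v {..<d})\<^sup>2" unfolding L_def .
    have "(x + (\<Sum>j<d. r * v j)) - (x + (\<Sum>j<d. r * w j)) = (\<Sum>j<d. r * (v j - w j))"
      by (simp add: sum_subtractf right_diff_distrib)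
    hence "\<bar>(x + (\<Sum>j<d. r * v j)) - (x + (\<Sum>j<d. r * w j))\<bar> \<le> d * \<bar>r\<bar> * L2_set (\<lambda>i. v i - w i) {..<d}"
      using sum[of "\<lambda>i. v i - w i"] by simp
    also have "d * \<bar>r\<bar> \<le> B * (1 + L2_set v {..<d} + L2_set w {..<d})"
    proof -
      have "(d * \<bar>r\<bar>) * 1 \<le> B * (1 + L2_set v {..<d} + L2_set w {..<d})"
        unfolding B_def by (intro mult_mono) auto
      thus ?thesis by simp
    qed
    finally show "\<bar>(x + (\<Sum>j<d. r * v j)) - (x + (\<Sum>j<d. r * w j))\<bar>
       \<le> B * (1 + L2_set v {..<d} + L2_set w {..<d}) * L2_set (\<lambda>i. v i - w i) {..<d}" by (simp add: mult_right_mono)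
  qed
qed

lemma wlip_prod_C_lLip_dim:
  assumes f: "wlip C k f" shows "(\<lambda>v. f (x + r * (v 0 * v 1))) \<in> C_lLip_dim (Suc 1)"
proof -
  define B where "B = 1 + \<bar>x\<bar> + \<bar>r\<bar>"
  have B: "1 \<le> B" "\<bar>x\<bar> \<le> B" "\<bar>r\<bar> \<le> B" by (simp_all add: B_def)
  have c: "\<bar>v 0\<bar> \<le> L2_set v {..<Suc 1}" "\<bar>v 1\<bar> \<le> L2_set v {..<Suc 1}" for v :: "nat \<Rightarrow> real"
    by (intro abs_le_L2_set; simp)+
  show ?thesis
  proof (rule wlip_compose_C_lLip_dim[OF f B(1)])
    fix v w :: "nat \<Rightarrow> real"
    define L where "L = L2_set v {..<Suc 1}"
    define M where "M = L2_set w {..<Suc 1}"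
    define D where "D = L2_set (\<lambda>i. v i - w i) {..<Suc 1}"
    have L: "0 \<le> L" "\<bar>v 0\<bar> \<le> L" "\<bar>v 1\<bar> \<le> L" using c[of v] by (simp_all add: L_def)
    have M: "0 \<le> M" "\<bar>w 0\<bar> \<le> M" "\<bar>w 1\<bar> \<le> M" using c[of w] by (simp_all add: M_def)
    have D: "0 \<le> D" "\<bar>v 0 - w 0\<bar> \<le> D" "\<bar>v 1 - w 1\<bar> \<le> D" using c[of "\<lambda>i. v i - w i"] by (simp_all add: D_def)
    have "\<bar>x + r * (v 0 * v 1)\<bar> \<le> \<bar>x\<bar> + \<bar>r\<bar> * (\<bar>v 0\<bar> * \<bar>v 1\<bar>)"
      by (rule order_trans[OF abs_triangle_ineq]) (simp add: abs_mult)
    also have "\<dots> \<le> B + B * (L * L)" using B L by (intro add_mono mult_mono) auto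
    also have "\<dots> \<le> B * (1 + L)\<^sup>2" using B L by (simp add: power2_eq_square algebra_simps)
    finally show "\<bar>x + r * (v 0 * v 1)\<bar> \<le> B * (1 + L2_set v {..<Suc 1})\<^sup>2" unfolding L_def .
    have "(x + r * (v 0 * v 1)) - (x + r * (w 0 * w 1)) = r * (v 0 * (v 1 - w 1) + w 1 * (v 0 - w 0))"
      by (simp add: algebra_simps)
    also have "\<bar>\<dots>\<bar> \<le> \<bar>r\<bar> * (\<bar>v 0\<bar> * \<bar>v 1 - w 1\<bar> + \<bar>w 1\<bar> * \<bar>v 0 - w 0\<bar>)"
    proof -
      have "\<bar>v 0 * (v 1 - w 1) + w 1 * (v 0 - w 0)\<bar> \<le> \<bar>v 0\<bar> * \<bar>v 1 - w 1\<bar> + \<bar>w 1\<bar> * \<bar>v 0 - w 0\<bar>"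
        using abs_triangle_ineq[of "v 0 * (v 1 - w 1)" "w 1 * (v 0 - w 0)"] by (simp only: abs_mult)
      from mult_left_mono[OF this, of "\<bar>r\<bar>"] show ?thesis by (simp only: abs_mult abs_ge_zero)
    qed
    also have "\<dots> \<le> B * (L * D + M * D)"
      by (intro mult_mono add_mono B(3) L M D mult_nonneg_nonneg add_nonneg_nonneg abs_ge_zero
          order_trans[OF zero_le_one B(1)])
    also have "\<dots> \<le> B * ((1 + L + M) * D)"
      using B(1) D(1) by (intro mult_left_mono) (simp_all add: distrib_right)
    finally have "\<bar>(x + r * (v 0 * v 1)) - (x + r * (w 0 * w 1))\<bar> \<le> B * (1 + L + M) * D"
      by (simp only: mult.assoc)
    thus "\<bar>(x + r * (v 0 * v 1)) - (x + r * (w 0 * w 1))\<bar>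
       \<le> B * (1 + L2_set v {..<Suc 1} + L2_set w {..<Suc 1}) * L2_set (\<lambda>i. v i - w i) {..<Suc 1}"
      unfolding L_def M_def D_def .
  qed
qed

lemma wlip_affine:
  assumes f: "wlip C k f" shows "(\<lambda>z. f (x + s * z)) \<in> C_lLip"
proof -
  have C: "0 \<le> C" by (rule wlip_nonneg[OF f])
  have "wlip (C * (2 ^ k * (wt k x * wt k s)) * \<bar>s\<bar>) k (\<lambda>z. f (x + s * z))"
    unfolding wlip_def
  proof (intro conjI allI)
    show "0 \<le> C * (2 ^ k * (wt k x * wt k s)) * \<bar>s\<bar>" using C by simp
    fix z y
    have w: "wt k (x + s * z) \<le> 2 ^ k * (wt k x * (wt k s * wt k z))" for z
      by (rule order_trans[OF wt_add_le]) (intro mult_left_mono wt_mult_le; simp)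
    have "\<bar>f (x + s * z) - f (x + s * y)\<bar> \<le> C * (wt k (x + s * z) + wt k (x + s * y)) * \<bar>(x + s * z) - (x + s * y)\<bar>"
      by (rule wlipD[OF f])
    also have "\<bar>(x + s * z) - (x + s * y)\<bar> = \<bar>s\<bar> * \<bar>z - y\<bar>"
      by (simp add: abs_mult[symmetric] right_diff_distrib)
    also have "C * (wt k (x + s * z) + wt k (x + s * y)) * (\<bar>s\<bar> * \<bar>z - y\<bar>)
       \<le> C * (2 ^ k * (wt k x * (wt k s * wt k z)) + 2 ^ k * (wt k x * (wt k s * wt k y))) * (\<bar>s\<bar> * \<bar>z - y\<bar>)"
      using C by (intro mult_right_mono mult_left_mono add_mono w) auto
    finally show "\<bar>f (x + s * z) - f (x + s * y)\<bar> \<le> C * (2 ^ k * (wt k x * wt k s)) * \<bar>s\<bar> * (wt k z + wt k y) * \<bar>z - y\<bar>"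
      by (simp add: algebra_simps)
  qed
  thus ?thesis by (rule wlip_in_C_lLip)
qed

text \<open>Conditioning a semi-G-normal variable on its volatility leaves this function of
  \<open>v\<close>, which has to be admissible as a test function for the maximal
  distribution.\<close>

lemma gavg_volatility_in_C_lLip:
  assumes f: "wlip C k f" shows "(\<lambda>v. gavg (v * r) f x) \<in> C_lLip"
proof -
  have C: "0 \<le> C" by (rule wlip_nonneg[OF f])
  define A where "A = C * 2 ^ k * wt k x * wt k r * \<bar>r\<bar> * wt_moment (k + 1)"
  have "wlip A k (\<lambda>v. gavg (v * r) f x)"
    unfolding wlip_def
  proof (intro conjI allI)
    show "0 \<le> A" unfolding A_def using C wt_moment_nonneg by simp
    fix v w
    have "\<bar>gavg (v * r) f x - gavg (w * r) f x\<bar>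
      \<le> C * 2 ^ k * wt k x * (wt k (v * r) + wt k (w * r)) * \<bar>v * r - w * r\<bar> * wt_moment (k + 1)"
      by (rule gavg_diff_le[OF f])
    also have "\<bar>v * r - w * r\<bar> = \<bar>r\<bar> * \<bar>v - w\<bar>" by (simp add: abs_mult[symmetric] algebra_simps)
    also have "C * 2 ^ k * wt k x * (wt k (v * r) + wt k (w * r)) * (\<bar>r\<bar> * \<bar>v - w\<bar>) * wt_moment (k + 1)
       \<le> C * 2 ^ k * wt k x * (wt k v * wt k r + wt k w * wt k r) * (\<bar>r\<bar> * \<bar>v - w\<bar>) * wt_moment (k + 1)"
      using C wt_moment_nonneg by (intro mult_right_mono mult_left_mono add_mono wt_mult_le) auto
    finally show "\<bar>gavg (v * r) f x - gavg (w * r) f x\<bar> \<le> A * (wt k v + wt k w) * \<bar>v - w\<bar>"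
      by (simp add: A_def algebra_simps)
  qed
  thus ?thesis by (rule wlip_in_C_lLip)
qed

text \<open>Independence evaluates the normal factor first with the volatility frozen, which gives a
  Gaussian average; the maximal distribution of the volatility then takes its maximum. Hence one
  semi-G-normal variable acts exactly as one step of the scheme.\<close>

lemma semi_G_normal_expectation:
  assumes W: "semi_G_normal H E sl su W" and f: "wlip C k f"
  shows "E (\<lambda>\<omega>. f (x + r * W \<omega>)) = one_step sl su r f x"
proof -
  obtain Y Z where YZ: "std_normal_distributed H E Y" "maximal_distributed H E sl su Z"
    "independent_from E 1 (\<lambda>_. Z) Y" "W = (\<lambda>\<omega>. Z \<omega> * Y \<omega>)"
    using W unfolding semi_G_normal_def by blast
  have inner: "E (\<lambda>\<omega>. f (x + r * (z * Y \<omega>))) = gavg (z * r) f x" for z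
  proof -
    have "E (\<lambda>\<omega>. f (x + (z * r) * Y \<omega>)) = (\<integral>y. std_normal_density y * f (x + (z * r) * y) \<partial>lborel)"
      using YZ(1) wlip_affine[OF f, of x "z * r"] unfolding std_normal_distributed_def by auto
    also have "\<dots> = gavg (z * r) f x"
      unfolding gavg_def
      by (intro integral_gauss[symmetric] poly_growth_measurable wlip_poly_growth_compose[OF f] poly_growth_intros)
    finally show ?thesis by (simp add: mult_ac)
  qed
  have "E (\<lambda>\<omega>. f (x + r * (Z \<omega> * Y \<omega>))) = E (\<lambda>\<omega>. E (\<lambda>\<omega>'. f (x + r * (Z \<omega> * Y \<omega>'))))"
    using bspec[OF YZ(3)[unfolded independent_from_def] wlip_prod_C_lLip_dim[OF f, of x r]] by simp
  also have "\<dots> = E (\<lambda>\<omega>. gavg (Z \<omega> * r) f x)" by (simp add: inner)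
  also have "\<dots> = one_step sl su r f x"
    using YZ(2) gavg_volatility_in_C_lLip[OF f, of r x] unfolding maximal_distributed_def one_step_def by auto
  finally show ?thesis using YZ(4) by simp
qed

text \<open>Independence removes the last variable and replaces \<open>f\<close> by
  \<open>one_step sl su r f\<close>. The induction is therefore over arbitrary test functions, with
  the Lipschitz constant allowed to change.\<close>

lemma sum_semi_G_normal_expectation:
  assumes sl: "0 \<le> sl" "sl \<le> su" and r: "0 \<le> r"
    and E: "sublinear_expectation_space H E" and iid: "iid_sequence H E W"
    and W: "\<And>i. i \<ge> 1 \<Longrightarrow> semi_G_normal H E sl su (W i)" and f: "wlip C k f"
  shows "E (\<lambda>\<omega>. f (x + (\<Sum>j<m. r * W (j + 1) \<omega>))) = (one_step sl su r ^^ m) f x"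
  using f
proof (induction m arbitrary: f C)
  case 0
  show ?case using sublinear_expectation_space.const[OF E, of "f x"] by simp
next
  case (Suc m)
  obtain c where c: "wt_rate k (su * r) c" using wt_rate_exists[of "su * r" k] sl r by auto
  have Tf: "wlip (C * exp (c * (su * r)\<^sup>2)) k (one_step sl su r f)"
    by (rule wlip_one_step[OF sl Suc.prems c r order_refl])
  have "E (\<lambda>\<omega>. f (x + (\<Sum>j<Suc m. r * W (j + 1) \<omega>))) = E (\<lambda>\<omega>. one_step sl su r f (x + (\<Sum>j<m. r * W (j + 1) \<omega>)))"
  proof (cases "m = 0")
    \<comment> \<open>\<open>iid_sequence\<close> provides independence only from at least one
      preceding variable. Without any, the remaining outer expectation is that of a
      constant.\<close>
    case True
    thus ?thesis
      using semi_G_normal_expectation[OF W[of 1] Suc.prems, of x r] sublinear_expectation_space.const[OF E, of "one_step sl su r f x"]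
      by simp
  next
    case False
    hence "independent_from E m (\<lambda>j. W (j + 1)) (W (m + 1))" using iid unfolding iid_sequence_def by simp
    from bspec[OF this[unfolded independent_from_def] wlip_sum_C_lLip_dim[OF Suc.prems, of x r "Suc m"]]
    have "E (\<lambda>\<omega>. f (x + ((\<Sum>j<m. r * W (j + 1) \<omega>) + r * W (m + 1) \<omega>)))
       = E (\<lambda>\<omega>. E (\<lambda>\<omega>'. f (x + ((\<Sum>j<m. r * W (j + 1) \<omega>) + r * W (m + 1) \<omega>'))))"
      by simp
    also have "\<dots> = E (\<lambda>\<omega>. one_step sl su r f (x + (\<Sum>j<m. r * W (j + 1) \<omega>)))"
    proof -
      have "E (\<lambda>\<omega>'. f (x + (s + r * W (m + 1) \<omega>'))) = one_step sl su r f (x + s)" for s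
        using semi_G_normal_expectation[OF W[of "m + 1"] Suc.prems, of "x + s" r] by (simp add: add.assoc)
      thus ?thesis by simp
    qed
    finally show ?thesis by simp
  qed
  also have "\<dots> = (one_step sl su r ^^ m) (one_step sl su r f) x" by (rule Suc.IH[OF Tf])
  finally show ?case by (simp add: funpow_swap1)
qed

lemma scheme_eq_funpow:
  assumes "0 \<le> sl" "sl \<le> su" "wlip C k \<phi>" "n \<ge> 1"
  shows "scheme sl su \<phi> n i = (one_step sl su (1 / sqrt n) ^^ i) \<phi>"
proof (induction i)
  case (Suc i)
  obtain c where c: "wt_rate k su c" using wt_rate_exists[of su k] assms by auto
  show ?case using Suc scheme_wlip_and_Suc(2)[OF assms(1-4) c, of i] by (simp del: scheme.simps)
qed simp

theorem corollary3p4p1: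
  fixes sl su :: real
  assumes "0 \<le> sl" and "sl \<le> su"
  shows "\<exists>\<alpha>\<in>{0<..<1}. \<forall>(\<phi> :: real \<Rightarrow> real) (C :: real) (k :: nat) (u :: real \<Rightarrow> real \<Rightarrow> real).
    lLip_bound C k \<phi> \<and> heat_solution (G_fun sl su) \<phi> u \<longrightarrow>
      (\<exists>K > 0. \<exists>N > 0. \<forall>p\<in>{0<..1}. \<forall>(x :: real) (n :: nat). n \<ge> 1 \<and> real n * p \<ge> N \<longrightarrow>
         (\<forall>(H :: ('w \<Rightarrow> real) set) E X W.
            sublinear_expectation_space H E \<and>
            G_normal H E sl su X \<and>
            W 0 = (\<lambda>_. 0) \<and>
            iid_sequence H E W \<and> (\<forall>i\<ge>1. semi_G_normal H E sl su (W i)) \<longrightarrow>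
              \<bar>u (1 - p) x - scheme sl su \<phi> n (nat \<lfloor>real n * p\<rfloor>) x\<bar> =
              \<bar>E (\<lambda>\<omega>. \<phi> (x + sqrt p * X \<omega>))
                - E (\<lambda>\<omega>. \<phi> (x + (\<Sum>i=0..nat \<lfloor>real n * p\<rfloor>. W i \<omega> / sqrt (real n))))\<bar>) \<and>
         \<bar>u (1 - p) x - scheme sl su \<phi> n (nat \<lfloor>real n * p\<rfloor>) x\<bar>
           \<le> C * (1 + \<bar>x\<bar> ^ k) * (K / (real n * p) powr (\<alpha> / 2))) \<and>
      (\<forall>(x :: real) (n :: nat). n \<ge> 1 \<longrightarrow> u 1 x = \<phi> x \<and> \<phi> x = scheme sl su \<phi> n 0 x)"
proof (rule bexI[of _ "1 / 3"], intro allI impI, elim conjE, rule conjI)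
  fix \<phi> C k u
  assume lip: "lLip_bound C k \<phi>" and u: "heat_solution (G_fun sl su) \<phi> u"
  have C: "0 < C" using lip by (simp add: lLip_bound_def)
  have \<phi>: "wlip (2 * C) k \<phi>" by (rule lLip_bound_imp_wlip[OF lip])
  obtain K where K: "0 < K" "\<And>p x n. 0 < p \<Longrightarrow> p \<le> 1 \<Longrightarrow> n \<ge> 1 \<Longrightarrow>
    \<bar>u (1 - p) x - scheme sl su \<phi> n (nat \<lfloor>real n * p\<rfloor>) x\<bar> \<le> K * n powr (- 1 / 6) * wt k x"
    using scheme_rate[OF assms u \<phi>] by metis
  \<comment> \<open>The factor \<open>2 ^ k\<close> returns from the weight \<open>wt k\<close> to
    \<open>1 + \<bar>x\<bar> ^ k\<close>; dividing by \<open>C\<close> compensates for the factor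
    \<open>C\<close> in the claimed bound.\<close>
  define K' where "K' = K * 2 ^ k / C"
  have K': "0 < K'" using K C by (simp add: K'_def)
  have bound: "\<bar>u (1 - p) x - scheme sl su \<phi> n (nat \<lfloor>real n * p\<rfloor>) x\<bar>
      \<le> C * (1 + \<bar>x\<bar> ^ k) * (K' / (real n * p) powr (1 / 3 / 2))" if p: "0 < p" "p \<le> 1" and n: "n \<ge> 1" for p x n
  proof -
    have "real n * p \<le> real n" using p n by (intro mult_left_le) auto
    \<comment> \<open>As the exponent is negative, the smaller base \<open>n * p\<close> gives the
      larger power; the exponent is \<open>- \<alpha> / 2\<close> for
      \<open>\<alpha> = 1 / 3\<close>.\<close>
    hence "real n powr (- 1 / 6) \<le> (real n * p) powr (- 1 / 6)"
      using p n by (intro powr_mono2') auto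
    also have "\<dots> = 1 / (real n * p) powr (1 / 3 / 2)" by (simp add: powr_minus_divide)
    finally have "K * n powr (- 1 / 6) * wt k x \<le> K * (1 / (real n * p) powr (1 / 3 / 2)) * (2 ^ k * (1 + \<bar>x\<bar> ^ k))"
      using K by (intro mult_mono wt_le_1_plus_pow) auto
    also have "\<dots> = C * (1 + \<bar>x\<bar> ^ k) * (K' / (real n * p) powr (1 / 3 / 2))"
      using C by (simp add: K'_def)
    finally show ?thesis using K(2)[OF p n, of x] by linarith
  qed
  have eq: "\<bar>u (1 - p) x - scheme sl su \<phi> n (nat \<lfloor>real n * p\<rfloor>) x\<bar> =
              \<bar>E (\<lambda>\<omega>. \<phi> (x + sqrt p * X \<omega>))
                - E (\<lambda>\<omega>. \<phi> (x + (\<Sum>i=0..nat \<lfloor>real n * p\<rfloor>. W i \<omega> / sqrt (real n))))\<bar>"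
    if p: "0 < p" "p \<le> 1" and n: "n \<ge> 1" and E: "sublinear_expectation_space H E" and X: "G_normal H E sl su X"
      and W: "W 0 = (\<lambda>_. 0)" "iid_sequence H E W" "\<forall>i\<ge>1. semi_G_normal H E sl su (W i)"
    for p x n and H :: "('w \<Rightarrow> real) set" and E X W
  proof -
    have "heat_solution (G_fun sl su) \<phi> (\<lambda>t x. E (\<lambda>\<omega>. \<phi> (x + sqrt (1 - t) * X \<omega>)))"
      using X wlip_in_C_lLip[OF \<phi>] unfolding G_normal_def by blast
    from heat_solution_unique[OF assms u this \<phi> p, of x]
    have 1: "u (1 - p) x = E (\<lambda>\<omega>. \<phi> (x + sqrt p * X \<omega>))" by simp
    define m where "m = nat \<lfloor>real n * p\<rfloor>"
    \<comment> \<open>The summand with index 0 vanishes, so the sum over \<open>0..m\<close> has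
      exactly \<open>m\<close> random terms, matching the \<open>m\<close> steps of the
      scheme.\<close>
    have "(\<Sum>i=0..m. W i \<omega> / sqrt n) = (\<Sum>j<m. 1 / sqrt n * W (j + 1) \<omega>)" for \<omega>
      using W(1) by (simp add: atLeast0AtMost sum.atMost_shift)
    moreover have "E (\<lambda>\<omega>. \<phi> (x + (\<Sum>j<m. 1 / sqrt n * W (j + 1) \<omega>))) = (one_step sl su (1 / sqrt n) ^^ m) \<phi> x"
      using W(3) by (intro sum_semi_G_normal_expectation[OF assms _ E W(2) _ \<phi>]) auto
    ultimately have 2: "scheme sl su \<phi> n m x = E (\<lambda>\<omega>. \<phi> (x + (\<Sum>i=0..m. W i \<omega> / sqrt n)))"
      using scheme_eq_funpow[OF assms \<phi> n, of m] by simp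
    show ?thesis using 1 2 unfolding m_def by simp
  qed
  show "(\<exists>K > 0. \<exists>N > 0. \<forall>p\<in>{0<..1}. \<forall>(x :: real) (n :: nat). n \<ge> 1 \<and> real n * p \<ge> N \<longrightarrow>
         (\<forall>(H :: ('w \<Rightarrow> real) set) E X W.
            sublinear_expectation_space H E \<and>
            G_normal H E sl su X \<and>
            W 0 = (\<lambda>_. 0) \<and>
            iid_sequence H E W \<and> (\<forall>i\<ge>1. semi_G_normal H E sl su (W i)) \<longrightarrow>
              \<bar>u (1 - p) x - scheme sl su \<phi> n (nat \<lfloor>real n * p\<rfloor>) x\<bar> =
              \<bar>E (\<lambda>\<omega>. \<phi> (x + sqrt p * X \<omega>))
                - E (\<lambda>\<omega>. \<phi> (x + (\<Sum>i=0..nat \<lfloor>real n * p\<rfloor>. W i \<omega> / sqrt (real n))))\<bar>) \<and>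
         \<bar>u (1 - p) x - scheme sl su \<phi> n (nat \<lfloor>real n * p\<rfloor>) x\<bar>
           \<le> C * (1 + \<bar>x\<bar> ^ k) * (K / (real n * p) powr (1 / 3 / 2)))"
  proof (rule exI[of _ K'], intro conjI K' exI[of _ "1::real"] zero_less_one ballI allI impI)
    fix p x :: real and n :: nat
    assume "p \<in> {0<..1}" "n \<ge> 1 \<and> real n * p \<ge> 1"
    thus "\<bar>u (1 - p) x - scheme sl su \<phi> n (nat \<lfloor>real n * p\<rfloor>) x\<bar>
      \<le> C * (1 + \<bar>x\<bar> ^ k) * (K' / (real n * p) powr (1 / 3 / 2))" by (intro bound) auto
  next
    fix p x :: real and n :: nat and H :: "('w \<Rightarrow> real) set" and E X W
    assume "p \<in> {0<..1}" "n \<ge> 1 \<and> real n * p \<ge> 1" and "sublinear_expectation_space H E \<and>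
            G_normal H E sl su X \<and>
            W 0 = (\<lambda>_. 0) \<and>
            iid_sequence H E W \<and> (\<forall>i\<ge>1. semi_G_normal H E sl su (W i))"
    thus "\<bar>u (1 - p) x - scheme sl su \<phi> n (nat \<lfloor>real n * p\<rfloor>) x\<bar> =
              \<bar>E (\<lambda>\<omega>. \<phi> (x + sqrt p * X \<omega>))
                - E (\<lambda>\<omega>. \<phi> (x + (\<Sum>i=0..nat \<lfloor>real n * p\<rfloor>. W i \<omega> / sqrt (real n))))\<bar>"
      by (intro eq[of p n H E X W x]) auto
  qed
  show "\<forall>(x :: real) (n :: nat). n \<ge> 1 \<longrightarrow> u 1 x = \<phi> x \<and> \<phi> x = scheme sl su \<phi> n 0 x"
    using u by (simp add: heat_solution_def)
qed auto

end
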